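(* Let $X$ be an r.i. space on $(-1,1)$ such that $0<\underline{\alpha}_X\le\overline{\alpha}_X<1$, and let $T_X\colon X\to X$ be the finite Hilbert transform on $X$. Then $[-1,1]\subseteq\sigma(T_X)$.
   Context: The interval $(-1,1)$ carries Lebesgue measure; $L^0$ is the space of (equivalence classes of) complex-valued measurable functions on $(-1,1)$. For $f\in L^0$, $f^*\colon[0,2]\to[0,\infty]$ denotes its decreasing rearrangement. A rearrangement invariant (r.i.) space $X$ on $(-1,1)$ is a (nonzero) Banach space $X\subseteq L^0$ such that if $g\in L^0$, $f\in X$ and $g^*\le f^*$, then $g\in X$ and $\|g\|_X\le\|f\|_X$; all r.i. spaces are assumed to satisfy the Fatou property: if $(f_n)\subseteq X$, $0\le f_n\uparrow f$ a.e. and $\sup_n\|f_n\|_X<\infty$, then $f\in X$ and $\|f_n\|_X\to\|f\|_X$. For $t>0$ the dilation operator $E_t\colon X\to X$ is $E_t(f)(s):=f(st)$ if $-1\le st\le1$ and $0$ otherwise. The lower and upper Boyd indices of $X$ are $\underline{\alpha}_X:=\sup_{0<t<1}\frac{\log\|E_{1/t}\|_{X\to X}}{\log t}$ and $\overline{\alpha}_X:=\inf_{1<t<\infty}\frac{\log\|E_{1/t}\|_{X\to X}}{\log t}$. The finite Hilbert transform of $f\in L^1(-1,1)$ is $(T(f))(t)=\lim_{\varepsilon\to0^+}\frac{1}{\pi i}\left(\int_{-1}^{t-\varepsilon}+\int_{t+\varepsilon}^1\right)\frac{f(x)}{x-t}\,dx$, which exists for a.e. $t\in(-1,1)$. If $0<\underline{\alpha}_X\le\overline{\alpha}_X<1$,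 then $T$ maps $X$ boundedly into $X$ (Boyd); this operator is denoted $T_X$, and $\sigma(T_X)$ is its spectrum. *)

theory Defs
  imports "HOL-Analysis.Analysis"
begin

text \<open>
  An element of \<open>L\<^sup>0\<close> is represented by any measurable function that belongs to the class; the
  values of a representative outside (-1,1) are irrelevant. Identities between elements are
  identities almost everywhere on (-1,1).
\<close>

abbreviation leb_I :: "real measure" where
  "leb_I \<equiv> lebesgue_on {-1<..<1}"

abbreviation L0 :: "(real \<Rightarrow> complex) set" where
  "L0 \<equiv> borel_measurable leb_I"

definition decr_rearr :: "(real \<Rightarrow> complex) \<Rightarrow> real \<Rightarrow> ennreal" where
  "decr_rearr f t =
     Inf {ennreal s | s. 0 \<le> s \<and> emeasure leb_I {x \<in> space leb_I. s < norm (f x)} \<le> ennreal t}"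

text \<open>
  The carrier \<open>X\<close> consists of all representatives of the elements of the space, and \<open>N\<close> is the
  norm, meaningful only on \<open>X\<close>. That \<open>X\<close> and \<open>N\<close> respect almost everywhere equality
  follows from the axiom \<open>rearr\<close>, since functions that agree almost everywhere have the same
  decreasing rearrangement.
\<close>

locale ri_space =
  fixes X :: "(real \<Rightarrow> complex) set" and N :: "(real \<Rightarrow> complex) \<Rightarrow> real"
  assumes sub_L0: "X \<subseteq> L0"
    and zero_mem: "(\<lambda>x. 0) \<in> X"
    and add_mem: "\<And>f g. f \<in> X \<Longrightarrow> g \<in> X \<Longrightarrow> (\<lambda>x. f x + g x) \<in> X"
    and scale_mem: "\<And>c f. f \<in> X \<Longrightarrow> (\<lambda>x. c * f x) \<in> X"
    and nonzero: "\<exists>f\<in>X. \<not> (AE x in leb_I. f x = 0)"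
    and norm_nonneg: "\<And>f. f \<in> X \<Longrightarrow> 0 \<le> N f"
    and norm_eq_0: "\<And>f. f \<in> X \<Longrightarrow> N f = 0 \<longleftrightarrow> (AE x in leb_I. f x = 0)"
    and norm_scale: "\<And>c f. f \<in> X \<Longrightarrow> N (\<lambda>x. c * f x) = norm c * N f"
    and norm_triangle: "\<And>f g. f \<in> X \<Longrightarrow> g \<in> X \<Longrightarrow> N (\<lambda>x. f x + g x) \<le> N f + N g"
    and complete:
      "\<And>F :: nat \<Rightarrow> real \<Rightarrow> complex.
         (\<And>n. F n \<in> X) \<Longrightarrow>
         (\<forall>e>0. \<exists>K. \<forall>m\<ge>K. \<forall>n\<ge>K. N (\<lambda>x. F m x - F n x) < e) \<Longrightarrow>
         \<exists>f\<in>X. (\<lambda>n. N (\<lambda>x. F n x - f x)) \<longlonglongrightarrow> 0"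
    and rearr:
      "\<And>f g. g \<in> L0 \<Longrightarrow> f \<in> X \<Longrightarrow> (\<forall>t\<in>{0..2}. decr_rearr g t \<le> decr_rearr f t) \<Longrightarrow>
         g \<in> X \<and> N g \<le> N f"
    and fatou:
      "\<And>(u :: nat \<Rightarrow> real \<Rightarrow> real) (v :: real \<Rightarrow> real).
         (\<And>n. (\<lambda>x. complex_of_real (u n x)) \<in> X) \<Longrightarrow>
         (\<lambda>x. complex_of_real (v x)) \<in> L0 \<Longrightarrow>
         (AE x in leb_I. (\<forall>n. 0 \<le> u n x \<and> u n x \<le> u (Suc n) x) \<and> (\<lambda>n. u n x) \<longlonglongrightarrow> v x) \<Longrightarrow>
         bdd_above (range (\<lambda>n. N (\<lambda>x. complex_of_real (u n x)))) \<Longrightarrow>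
         (\<lambda>x. complex_of_real (v x)) \<in> X \<and>
         (\<lambda>n. N (\<lambda>x. complex_of_real (u n x))) \<longlonglongrightarrow> N (\<lambda>x. complex_of_real (v x))"

definition op_norm ::
  "(real \<Rightarrow> complex) set \<Rightarrow> ((real \<Rightarrow> complex) \<Rightarrow> real) \<Rightarrow>
   ((real \<Rightarrow> complex) \<Rightarrow> real \<Rightarrow> complex) \<Rightarrow> real" where
  "op_norm X N A = (SUP f\<in>{f \<in> X. N f \<le> 1}. N (A f))"

definition dilation :: "real \<Rightarrow> (real \<Rightarrow> complex) \<Rightarrow> real \<Rightarrow> complex" where
  "dilation t f s = (if -1 \<le> s * t \<and> s * t \<le> 1 then f (s * t) else 0)"

text \<open>
  On an r.i. space every dilation operator is bounded and nonzero, and all the quotients below lie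
  in the interval [0,1], so that the real-valued supremum and infimum are the intended ones.
\<close>

definition lower_boyd ::
  "(real \<Rightarrow> complex) set \<Rightarrow> ((real \<Rightarrow> complex) \<Rightarrow> real) \<Rightarrow> real" where
  "lower_boyd X N = (SUP t\<in>{0<..<1}. ln (op_norm X N (dilation (1 / t))) / ln t)"

definition upper_boyd ::
  "(real \<Rightarrow> complex) set \<Rightarrow> ((real \<Rightarrow> complex) \<Rightarrow> real) \<Rightarrow> real" where
  "upper_boyd X N = (INF t\<in>{1<..}. ln (op_norm X N (dilation (1 / t))) / ln t)"

text \<open>
  For integrable \<open>f\<close> the limit exists for almost every \<open>t\<close> in (-1,1); at the remaining
  points the value is arbitrary.
\<close>

definition finite_hilbert :: "(real \<Rightarrow> complex) \<Rightarrow> real \<Rightarrow> complex" where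
  "finite_hilbert f t =
     Lim (at_right 0) (\<lambda>\<epsilon>. 1 / (of_real pi * \<i>) *
       ((LINT x:{-1<..t - \<epsilon>}|lebesgue. f x / of_real (x - t)) +
        (LINT x:{t + \<epsilon>..<1}|lebesgue. f x / of_real (x - t))))"

text \<open>
  Linearity is required modulo null functions. Together with boundedness it implies that the
  operator respects almost everywhere equality, hence acts on equivalence classes.
\<close>

definition bounded_op ::
  "(real \<Rightarrow> complex) set \<Rightarrow> ((real \<Rightarrow> complex) \<Rightarrow> real) \<Rightarrow>
   ((real \<Rightarrow> complex) \<Rightarrow> real \<Rightarrow> complex) \<Rightarrow> bool" where
  "bounded_op X N A \<longleftrightarrow>
     (\<forall>f\<in>X. A f \<in> X) \<and>
     (\<forall>f\<in>X. \<forall>g\<in>X. AE x in leb_I. A (\<lambda>y. f y + g y) x = A f x + A g x) \<and>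
     (\<forall>f\<in>X. \<forall>c. AE x in leb_I. A (\<lambda>y. c * f y) x = c * A f x) \<and>
     (\<exists>C. \<forall>f\<in>X. N (A f) \<le> C * N f)"

definition invertible_op ::
  "(real \<Rightarrow> complex) set \<Rightarrow> ((real \<Rightarrow> complex) \<Rightarrow> real) \<Rightarrow>
   ((real \<Rightarrow> complex) \<Rightarrow> real \<Rightarrow> complex) \<Rightarrow> bool" where
  "invertible_op X N A \<longleftrightarrow> bounded_op X N A \<and>
     (\<exists>B. bounded_op X N B \<and>
        (\<forall>f\<in>X. (AE x in leb_I. B (A f) x = f x) \<and> (AE x in leb_I. A (B f) x = f x)))"

definition op_spectrum ::
  "(real \<Rightarrow> complex) set \<Rightarrow> ((real \<Rightarrow> complex) \<Rightarrow> real) \<Rightarrow>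
   ((real \<Rightarrow> complex) \<Rightarrow> real \<Rightarrow> complex) \<Rightarrow> complex set" where
  "op_spectrum X N A = {z. \<not> invertible_op X N (\<lambda>f x. z * f x - A f x)}"

end

theory Submission
  imports Defs "HOL-Complex_Analysis.Complex_Analysis" "HOL-Real_Asymp.Real_Asymp"
begin

text \<open>For real $\gamma$ the function $f_\gamma(x) = e^{2i\gamma\,\mathrm{artanh}\,x}/\sqrt{1-x^2}$ satisfies
  $T f_\gamma = \tanh(\pi\gamma) f_\gamma$ pointwise on $(-1,1)$. Suppose that $\lambda - T$ is invertible on $X$
  for some $\lambda \in [-1,1]$. For $\mu = \tanh(\pi\gamma)$ close to $\lambda$ the equation $(\mu - T)u = 1$
  is then solvable in $X$ by a Neumann series. Since $T(x f_\gamma)$ and $x\,T f_\gamma$ differ by a nonzero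
  constant, $u = (\kappa x + c) f_\gamma$ with $\kappa \neq 0$, provided that the kernel of $\mu - T$ is
  spanned by $f_\gamma$. The factor $\kappa x + c$ cannot vanish at both endpoints, so rearrangement invariance
  puts $f_\gamma$ itself into $X$, and this eigenfunction with eigenvalue close to $\lambda$ contradicts
  the invertibility of $\lambda - T$.

  The kernel is one-dimensional already in $L^q$, $q > 1$: if $f$ has mean zero and $T f = \mu f$,
  test the equation against $(1-x^2) p f_{-\gamma}$ with $p$ a polynomial. The operator $\mu + T$ maps
  these functions to polynomials of degree exactly $\deg p + 1$, so all moments of $f$ vanish.
  The transposition of principal values used here rests on Riesz's $L^q$ bound for conjugate
  Poisson integrals. Finally $X \subseteq L^q$ for some $q > 1$, because applying the bounded
  operator $T$ twice to an indicator function gains a logarithm.\<close>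

section \<open>Contour integrals\<close>

text \<open>In the coordinate r = 2 artanh x, with the weight (1 - x^2)^(1/2) split off, the
  transform becomes convolution with a multiple of 1 / sinh (r / 2). The f_\<gamma> correspond to
  its characters, and tanh (pi \<gamma>) is a Fourier integral, computed by shifting a contour. The
  obstacle is that |f_\<gamma>| = (1 - x^2)^(-1/2) need not lie in X: for X = L^p it does exactly
  when p < 2. A spectral value may thus be an eigenvalue or not, depending on X. Arguing by
  contradiction avoids this distinction, because solvability with right-hand side 1 already forces
  f_\<gamma> into X. A nearby \<mu> is needed because tanh omits the values 1 and -1. One inequality
  |\<mu> - \<lambda>| K \<le> 1/2, with K a bound for the inverse, serves twice: it makes the
  Neumann iteration contract, and at the end it gives N f \<le> N f / 2 for the eigenfunction. The
  exponent q has to stay below 2, both for f_\<gamma> to be in L^q and for the sign of cos (q s) on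
  which Riesz's inequality rests.\<close>

lemma vertical_integrals_diff_bound:
  fixes f :: "complex \<Rightarrow> complex" and a b R B :: real
  assumes ab: "a < b" and R: "0 < R" and B: "0 \<le> B"
    and cont: "continuous_on {z. a \<le> Re z \<and> Re z \<le> b \<and> \<bar>Im z\<bar> \<le> R} f"
    and diff: "\<And>z. a < Re z \<Longrightarrow> Re z < b \<Longrightarrow> \<bar>Im z\<bar> < R \<Longrightarrow> f field_differentiable at z"
    and bound: "\<And>z. a \<le> Re z \<Longrightarrow> Re z \<le> b \<Longrightarrow> \<bar>Im z\<bar> = R \<Longrightarrow> norm (f z) \<le> B"
  shows "norm (integral {-R..R} (\<lambda>x. f (Complex a x)) - integral {-R..R} (\<lambda>x. f (Complex b x)))
         \<le> 2 * (b - a) * B"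
proof -
  let ?S = "cbox (Complex a (-R)) (Complex b R)"
  let ?p1 = "Complex a (-R)" and ?p2 = "Complex b (-R)" and ?p3 = "Complex b R" and ?p4 = "Complex a R"
  have S: "?S = {z. a \<le> Re z \<and> Re z \<le> b \<and> \<bar>Im z\<bar> \<le> R}"
    by (auto simp: in_cbox_complex_iff)
  have cS: "continuous_on ?S f" using cont S by simp
  have mem: "?p1 \<in> ?S" "?p2 \<in> ?S" "?p3 \<in> ?S" "?p4 \<in> ?S"
    using ab R by (auto simp: in_cbox_complex_iff)
  have seg: "closed_segment p q \<subseteq> ?S" if "p \<in> ?S" "q \<in> ?S" for p q
    using that by (simp add: closed_segment_subset)
  have ci: "f contour_integrable_on (linepath p q)" if "p \<in> ?S" "q \<in> ?S" for p q
    by (rule contour_integrable_continuous_linepath)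
       (rule continuous_on_subset[OF cS seg[OF that]])
  let ?g = "linepath ?p1 ?p2 +++ linepath ?p2 ?p3 +++ linepath ?p3 ?p4 +++ linepath ?p4 ?p1"
  have "(f has_contour_integral 0) ?g"
  proof (rule Cauchy_theorem_convex[OF cS, where K="{}"])
    show "f field_differentiable at x" if "x \<in> interior ?S - {}" for x
      using that diff[of x] by (auto simp: in_box_complex_iff)
    show "path_image ?g \<subseteq> ?S"
      using seg mem by (intro subset_path_image_join) (simp_all add: path_image_linepath)
  qed (auto intro!: valid_path_join)
  then have "contour_integral (linepath ?p1 ?p2) f + (contour_integral (linepath ?p2 ?p3) f
     + (contour_integral (linepath ?p3 ?p4) f + contour_integral (linepath ?p4 ?p1) f)) = 0"
    using contour_integral_unique mem ci
    by (fastforce simp: contour_integrable_joinI)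
  moreover have "contour_integral (linepath ?p4 ?p1) f = - contour_integral (linepath ?p1 ?p4) f"
    using contour_integral_reverse_linepath[of ?p1 ?p4 f] continuous_on_subset[OF cS seg] mem by auto
  moreover have "contour_integral (linepath ?p1 ?p4) f = \<i> * integral {-R..R} (\<lambda>x. f (Complex a x))"
    by (rule contour_integral_linepath_same_Re) (use R in auto)
  moreover have "contour_integral (linepath ?p2 ?p3) f = \<i> * integral {-R..R} (\<lambda>x. f (Complex b x))"
    by (rule contour_integral_linepath_same_Re) (use R in auto)
  \<comment> \<open>The difference of the vertical sides equals the sum of the two horizontal ones,
    which have length b - a each and lie where f is bounded by B.\<close>
  ultimately have eq: "\<i> * (integral {-R..R} (\<lambda>x. f (Complex a x)) - integral {-R..R} (\<lambda>x. f (Complex b x)))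
      = contour_integral (linepath ?p1 ?p2) f + contour_integral (linepath ?p3 ?p4) f"
    by (simp add: algebra_simps)
  have b1: "norm (contour_integral (linepath ?p1 ?p2) f) \<le> B * norm (?p2 - ?p1)"
  proof (rule contour_integral_bound_linepath[OF ci B])
    fix x assume "x \<in> closed_segment ?p1 ?p2"
    then show "norm (f x) \<le> B"
      using ab R by (intro bound) (auto simp: closed_segment_same_Im closed_segment_eq_real_ivl)
  qed (use mem in auto)
  have b2: "norm (contour_integral (linepath ?p3 ?p4) f) \<le> B * norm (?p4 - ?p3)"
  proof (rule contour_integral_bound_linepath[OF ci B])
    fix x assume "x \<in> closed_segment ?p3 ?p4"
    then show "norm (f x) \<le> B"
      using ab R by (intro bound) (auto simp: closed_segment_same_Im closed_segment_eq_real_ivl)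
  qed (use mem in auto)
  have n: "norm (?p2 - ?p1) = b - a" "norm (?p4 - ?p3) = b - a"
    using ab by (simp_all add: cmod_def)
  have "norm (\<i> * (integral {-R..R} (\<lambda>x. f (Complex a x)) - integral {-R..R} (\<lambda>x. f (Complex b x))))
      \<le> 2 * (b - a) * B"
    unfolding eq using norm_triangle_mono[OF b1 b2] n by (simp add: algebra_simps)
  then show ?thesis by (simp add: norm_mult)
qed

lemma exp_neg_abs_integrable: "(\<lambda>v::real. exp (- \<bar>v\<bar> / 2)) integrable_on UNIV"
proof -
  have 1: "(\<lambda>v::real. exp (- \<bar>v\<bar> / 2)) integrable_on {0..}"
    using integrable_on_exp_minus_to_infinity[of "1/2" 0]
    by (rule integrable_eq) auto
  have "(\<lambda>v::real. exp (- \<bar>v\<bar> / 2)) absolutely_integrable_on {0..}"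
    using 1 by (intro nonnegative_absolutely_integrable_1) auto
  then have "(\<lambda>v::real. exp (- \<bar>- v\<bar> / 2)) absolutely_integrable_on {..0}"
    using has_absolute_integral_reflect_real[of "{..0}" "{0..}" "\<lambda>v::real. exp (- \<bar>v\<bar> / 2)"] by auto
  then have 2: "(\<lambda>v::real. exp (- \<bar>v\<bar> / 2)) integrable_on {..0}"
    using set_lebesgue_integral_eq_integral(1) by auto
  have "(\<lambda>v::real. exp (- \<bar>v\<bar> / 2)) integrable_on {..0} \<union> {0..}"
    by (rule integrable_Un'[OF 2 1]) (auto intro: negligible_subset[of "{0}"])
  moreover have "{..0} \<union> {0..} = (UNIV :: real set)" by auto
  ultimately show ?thesis by simp
qed

text \<open>Contour shifting compares integrals over symmetric intervals [-n, n] only; the second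
  conclusion passes to the whole line.\<close>

lemma exp_decay_integral:
  fixes g :: "real \<Rightarrow> complex"
  assumes cont: "continuous_on UNIV g" and bd: "\<And>v. norm (g v) \<le> C * exp (- \<bar>v\<bar> / 2)"
  shows "g absolutely_integrable_on UNIV"
    and "(\<lambda>n. integral {-real n..real n} g) \<longlonglongrightarrow> integral UNIV g"
proof -
  have i: "(\<lambda>v::real. C * exp (- \<bar>v\<bar> / 2)) integrable_on UNIV"
    using exp_neg_abs_integrable by (rule integrable_on_mult_right)
  show "g absolutely_integrable_on UNIV"
    by (rule measurable_bounded_by_integrable_imp_absolutely_integrable[OF _ _ i bd])
       (use continuous_imp_measurable_on_sets_lebesgue[OF cont] in \<open>auto simp: lebesgue_on_UNIV_eq\<close>)
  let ?h = "\<lambda>n v. if v \<in> {-real n..real n} then g v else 0"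
  have "(\<lambda>n. integral UNIV (?h n)) \<longlonglongrightarrow> integral UNIV g"
  proof (rule dominated_convergence(2)[OF _ i])
    show "?h n integrable_on UNIV" for n
      by (simp only: integrable_restrict_UNIV)
         (intro integrable_continuous_interval continuous_on_subset[OF cont], auto)
    show "norm (?h n v) \<le> C * exp (- \<bar>v\<bar> / 2)" for n v
      using bd[of v] order_trans[OF norm_ge_zero bd[of v]] by auto
    show "(\<lambda>n. ?h n v) \<longlonglongrightarrow> g v" for v
    proof (rule tendsto_eventually)
      obtain m where "\<bar>v\<bar> \<le> real m" using real_arch_simple by blast
      then show "\<forall>\<^sub>F n in sequentially. ?h n v = g v"
        by (intro eventually_sequentiallyI[of m]) auto
    qed
  qed
  then show "(\<lambda>n. integral {-real n..real n} g) \<longlonglongrightarrow> integral UNIV g"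
    by (simp only: integral_restrict_UNIV)
qed

section \<open>Fourier integrals of hyperbolic kernels\<close>

text \<open>The integrand of the integral of \<open>hilbert_eigenfun\<close> after the substitution
  x = tanh (v / 2).\<close>

definition cosh_kernel :: "real \<Rightarrow> real \<Rightarrow> complex" where
  "cosh_kernel \<gamma> v = cis (\<gamma> * v) / of_real (2 * cosh (v / 2))"

text \<open>The regularised difference quotient in the principal value after the same substitution.
  Subtracting 1 removes the pole at 0, and the value there is the limit.\<close>

definition sinh_kernel :: "real \<Rightarrow> real \<Rightarrow> complex" where
  "sinh_kernel \<gamma> v = (if v = 0 then \<i> * \<gamma> else (cis (\<gamma> * v) - 1) / of_real (2 * sinh (v / 2)))"

text \<open>The meromorphic function that links the two kernels: it is \<open>sinh_kernel\<close> on
  the imaginary axis and a combination of values of \<open>cosh_kernel\<close> on the line Re w =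
  -pi. Between these lines sin (w / 2) vanishes at w = 0 only, where the singularity is
  removable.\<close>

definition strip_fun :: "real \<Rightarrow> complex \<Rightarrow> complex" where
  "strip_fun \<gamma> w = (if w = 0 then \<i> * \<gamma> else (exp (of_real \<gamma> * w) - 1) / (- 2 * \<i> * sin (w / 2)))"

lemma strip_fun_imaginary: "strip_fun \<gamma> (Complex 0 v) = sinh_kernel \<gamma> v"
proof -
  have "sin (Complex 0 v / 2) = \<i> * of_real (sinh (v/2))"
  proof -
    have "sin (Complex 0 v / 2) = sin (\<i> * of_real (v/2))" by (simp add: Complex_eq)
    also have "\<dots> = \<i> * of_real (sinh (v/2))"
      unfolding sin_i_times
      by (simp add: sinh_field_def exp_minus exp_of_real[symmetric])
    finally show ?thesis .
  qed
  moreover have "exp (of_real \<gamma> * Complex 0 v) = cis (\<gamma> * v)"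
    by (simp add: cis_conv_exp Complex_eq mult_ac)
  moreover have "Complex 0 v = 0 \<longleftrightarrow> v = 0" by (simp add: complex_eq_iff)
  ultimately show ?thesis
    by (simp add: strip_fun_def sinh_kernel_def mult.assoc)
qed

lemma strip_fun_shifted:
  "strip_fun \<gamma> (Complex (-pi) v)
    = - \<i> * (of_real (exp (- pi * \<gamma>)) * cosh_kernel \<gamma> v - cosh_kernel 0 v)"
proof -
  have "sin (Complex (-pi) v / 2) = - cos (\<i> * of_real (v/2))"
  proof -
    have "sin (Complex (-pi) v / 2) = sin (\<i> * of_real (v/2) - of_real pi / 2)"
      by (simp add: Complex_eq diff_divide_distrib)
    also have "\<dots> = - cos (\<i> * of_real (v/2))"
      by (simp add: sin_diff)
    finally show ?thesis .
  qed
  also have "cos (\<i> * of_real (v/2)) = of_real (cosh (v/2))"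
    unfolding cos_i_times by (simp add: cosh_field_def exp_minus exp_of_real[symmetric])
  finally have s: "sin (Complex (-pi) v / 2) = - of_real (cosh (v/2))" .
  have e: "exp (of_real \<gamma> * Complex (-pi) v) = of_real (exp (- pi * \<gamma>)) * cis (\<gamma> * v)"
    by (simp add: cis_conv_exp Complex_eq algebra_simps exp_add[symmetric] exp_of_real[symmetric])
  have nz: "Complex (-pi) v \<noteq> 0" by (simp add: complex_eq_iff)
  have c: "complex_of_real (cosh (v/2)) \<noteq> 0"
    by (simp add: of_real_eq_0_iff) 
  show ?thesis
    using nz c by (simp add: strip_fun_def s e cosh_kernel_def field_simps)
qed

lemma sin_half_zero_strip:
  assumes "-pi \<le> Re w" "Re w \<le> 0" "sin (w / 2) = 0" shows "w = 0"
proof -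
  obtain n :: int where "w / 2 = of_real (of_int n * pi)"
    using assms(3) by (auto simp: sin_eq_0)
  then have w: "w = of_real (2 * of_int n * pi)" by (simp add: field_simps)
  then have "-pi \<le> 2 * of_int n * pi" "2 * of_int n * pi \<le> 0" using assms by auto
  then have "(-1) * pi \<le> (2 * real_of_int n) * pi" "pi * real_of_int n \<le> 0"
    by (auto simp: mult.commute)
  then have "-1 \<le> 2 * real_of_int n" "real_of_int n \<le> 0"
    using pi_gt_zero by (metis mult_le_cancel_right_pos, simp add: mult_le_0_iff)
  then have "n = 0" by linarith
  then show ?thesis using w by simp
qed

lemma continuous_strip_fun: "continuous_on {w. -pi \<le> Re w \<and> Re w \<le> 0} (strip_fun \<gamma>)"
proof (rule continuous_at_imp_continuous_on, intro ballI)
  fix w assume w: "w \<in> {w. -pi \<le> Re w \<and> Re w \<le> 0}"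
  show "isCont (strip_fun \<gamma>) w"
  proof (cases "w = 0")
    case False
    then have s: "sin (w/2) \<noteq> 0" using w sin_half_zero_strip by auto
    have "isCont (\<lambda>w. (exp (of_real \<gamma> * w) - 1) / (- 2 * \<i> * sin (w / 2))) w"
      using s by (intro continuous_intros) auto
    then show ?thesis
      using eventually_mono[OF t1_space_nhds[OF False]]
      by (subst isCont_cong[where g="\<lambda>w. (exp (of_real \<gamma> * w) - 1) / (- 2 * \<i> * sin (w / 2))"])
         (simp_all add: strip_fun_def)
  next
    case True
    \<comment> \<open>Numerator and denominator are each divided by w; the quotient of the limits
      \<gamma> and -i is the value i \<gamma> prescribed at 0.\<close>
    have a: "((\<lambda>w. (exp (of_real \<gamma> * w) - 1) / w) \<longlongrightarrow> of_real \<gamma>) (at (0::complex))"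
    proof -
      have "((\<lambda>w. exp (of_real \<gamma> * w)) has_field_derivative of_real \<gamma>) (at (0::complex))"
        by (auto intro!: derivative_eq_intros)
      then show ?thesis by (simp add: has_field_derivative_iff)
    qed
    have b: "((\<lambda>w. sin (w / 2) / w) \<longlongrightarrow> 1/2) (at (0::complex))"
    proof -
      have "((\<lambda>w. sin (w/2)) has_field_derivative 1/2) (at (0::complex))"
        by (auto intro!: derivative_eq_intros)
      then show ?thesis by (simp add: has_field_derivative_iff)
    qed
    have "((\<lambda>w. ((exp (of_real \<gamma> * w) - 1) / w) / (- 2 * \<i> * (sin (w / 2) / w)))
        \<longlongrightarrow> of_real \<gamma> / (- 2 * \<i> * (1/2))) (at 0)"
      by (intro tendsto_intros a b) auto
    moreover have "\<forall>\<^sub>F w in at 0. ((exp (of_real \<gamma> * w) - 1) / w) / (- 2 * \<i> * (sin (w / 2) / w)) = strip_fun \<gamma> w"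
      by (auto simp: strip_fun_def eventually_at_filter)
    ultimately have "(strip_fun \<gamma> \<longlongrightarrow> of_real \<gamma> / (- 2 * \<i> * (1/2))) (at 0)"
      by (rule Lim_transform_eventually)
    then show ?thesis using True by (simp add: isCont_def strip_fun_def field_simps)
  qed
qed

lemma strip_fun_differentiable:
  assumes "-pi \<le> Re w" "Re w \<le> 0" "w \<noteq> 0"
  shows "strip_fun \<gamma> field_differentiable at w"
proof -
  have s: "sin (w/2) \<noteq> 0" using assms sin_half_zero_strip by auto
  have "(\<lambda>w. (exp (of_real \<gamma> * w) - 1) / (- 2 * \<i> * sin (w / 2))) field_differentiable at w"
    unfolding field_differentiable_def
    by (rule exI) (rule derivative_eq_intros refl | use s in simp)+
  then show ?thesis
    by (rule field_differentiable_transform_within[where d="norm w", rotated 3])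
       (use assms in \<open>auto simp: strip_fun_def dist_norm\<close>)
qed

text \<open>This is |sin z|^2 = sin^2 (Re z) + sinh^2 (Im z) without its first summand. It makes
  \<open>strip_fun\<close> small on the horizontal sides of a long rectangle.\<close>

lemma sin_norm_lower: "sinh \<bar>Im z\<bar> \<le> norm (sin z)"
proof (rule power2_le_imp_le)
  have "(sinh \<bar>Im z\<bar>)\<^sup>2 = (sinh (Im z))\<^sup>2" by (simp add: abs_if)
  also have "\<dots> = (exp(2 * Im z) + inverse(exp(2 * Im z)) - 2) / 4"
    unfolding mult_2 exp_add by (simp add: sinh_field_def power2_eq_square exp_minus field_simps)
  also have "\<dots> \<le> (norm (sin z))\<^sup>2"
    unfolding norm_sin_squared using cos_le_one[of "2 * Re z"] by (intro divide_right_mono) auto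
  finally show "(sinh \<bar>Im z\<bar>)\<^sup>2 \<le> (norm (sin z))\<^sup>2" .
qed auto

text \<open>The factor 1 is kept so that the bound has the form required by
  \<open>exp_decay_integral\<close>.\<close>

lemma cosh_kernel_bound: "norm (cosh_kernel \<gamma> v) \<le> 1 * exp (- \<bar>v\<bar> / 2)"
proof -
  have "exp (\<bar>v\<bar> / 2) \<le> 2 * cosh (v / 2)"
    using exp_gt_zero[of "v/2"] exp_gt_zero[of "-v/2"]
    unfolding cosh_field_def by (cases "v \<ge> 0") (auto simp: abs_if)
  then have "1 / (2 * cosh (v/2)) \<le> 1 / exp (\<bar>v\<bar> / 2)"
    by (intro divide_left_mono) auto
  moreover have "exp (- \<bar>v\<bar> / 2) = 1 / exp (\<bar>v\<bar> / 2)" by (simp add: exp_minus inverse_eq_divide)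
  ultimately show ?thesis
    by (simp add: cosh_kernel_def norm_divide norm_mult)
qed

lemma norm_cis_minus_1_le: "norm (cis x - 1) \<le> \<bar>x\<bar>"
  using dist_exp_i_1[of x] abs_sin_x_le_abs_x[of "x/2"] by (simp add: cis_conv_exp)

text \<open>For |v| \<le> 1 the zero of the numerator leaves |\<gamma>|, and exp (-|v| / 2) \<ge>
  1/2. For |v| > 1 the numerator is at most 2, and exp |v| \<ge> 2 yields 2 sinh (|v| / 2) \<ge> exp
  (|v| / 2) / 2. The constant adds the two cases.\<close>

lemma sinh_kernel_bound: "norm (sinh_kernel \<gamma> v) \<le> (4 + 2 * \<bar>\<gamma>\<bar>) * exp (- \<bar>v\<bar> / 2)"
proof (cases "v = 0")
  case False
  define x where "x = \<bar>v\<bar> / 2"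
  have x: "x > 0" using False by (simp add: x_def)
  have eq: "norm (sinh_kernel \<gamma> v) = norm (cis (\<gamma> * v) - 1) / (2 * sinh x)"
    using False sinh_real_abs[of "v/2"]
    by (simp add: x_def sinh_kernel_def norm_divide norm_mult abs_mult del: of_real_mult sinh_real_abs)
  show ?thesis
  proof (cases "\<bar>v\<bar> \<le> 1")
    case True
    have "norm (cis (\<gamma> * v) - 1) / (2 * sinh x) \<le> \<bar>\<gamma> * v\<bar> / (2 * x)"
      using x by (intro frac_le norm_cis_minus_1_le) (use real_le_x_sinh[of x] in \<open>auto simp: sinh_field_def exp_minus\<close>)
    also have "\<dots> = \<bar>\<gamma>\<bar>" using False by (simp add: x_def abs_mult)
    also have "\<dots> \<le> \<bar>\<gamma>\<bar> * (2 * exp (- x))"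
      using exp_ge_add_one_self[of "-x"] True by (intro mult_left_mono[of 1 _ "\<bar>\<gamma>\<bar>", simplified]) (auto simp: x_def)
    also have "\<dots> \<le> (4 + 2 * \<bar>\<gamma>\<bar>) * exp (- x)" by (simp add: algebra_simps)
    finally show ?thesis by (simp add: eq x_def)
  next
    case False
    have "exp 1 \<le> exp (2 * x)" using False by (simp add: x_def)
    then have e: "2 \<le> exp x * exp x" using exp_ge_add_one_self[of "1::real"]
      unfolding exp_add[symmetric] mult_2[symmetric] by linarith
    have "exp x / 2 \<le> 2 * sinh x"
      using e by (simp add: sinh_field_def exp_minus field_simps)
    then have "norm (cis (\<gamma> * v) - 1) / (2 * sinh x) \<le> 2 / (exp x / 2)"
      using norm_triangle_ineq4[of "cis (\<gamma> * v)" 1] by (intro frac_le) auto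
    also have "\<dots> = 4 * exp (-x)" by (simp add: exp_minus field_simps)
    also have "\<dots> \<le> (4 + 2 * \<bar>\<gamma>\<bar>) * exp (- x)" by simp
    finally show ?thesis by (simp add: eq x_def)
  qed
qed (simp add: sinh_kernel_def norm_mult)

lemma continuous_cosh_kernel: "continuous_on UNIV (cosh_kernel \<gamma>)"
  unfolding cosh_kernel_def by (intro continuous_intros) auto

lemma continuous_sinh_kernel: "continuous_on UNIV (sinh_kernel \<gamma>)"
proof -
  have "continuous_on UNIV (\<lambda>v. strip_fun \<gamma> (Complex 0 v))"
    by (rule continuous_on_compose2[OF continuous_strip_fun])
       (auto intro!: continuous_intros simp: Complex_eq)
  then show ?thesis by (simp add: strip_fun_imaginary)
qed

lemmas cosh_kernel_integral = exp_decay_integral[OF continuous_cosh_kernel cosh_kernel_bound]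
lemmas sinh_kernel_integral = exp_decay_integral[OF continuous_sinh_kernel sinh_kernel_bound]

text \<open>Cauchy's theorem for \<open>strip_fun\<close> on rectangles of width pi and height 2 n,
  with n tending to infinity.\<close>

lemma sinh_kernel_integral_shift:
  "integral UNIV (sinh_kernel \<gamma>)
    = - \<i> * (of_real (exp (- pi * \<gamma>)) * integral UNIV (cosh_kernel \<gamma>) - integral UNIV (cosh_kernel 0))"
proof -
  let ?B = "\<lambda>n. (exp (\<bar>\<gamma>\<bar> * pi) + 1) / real n"
  let ?I = "\<lambda>n f. integral {-real n..real n} f"
  have bound: "norm (?I n (\<lambda>v. strip_fun \<gamma> (Complex (-pi) v)) - ?I n (\<lambda>v. strip_fun \<gamma> (Complex 0 v)))
        \<le> 2 * (0 - (-pi)) * ?B n" if "n > 0" for n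
  proof (rule vertical_integrals_diff_bound)
    show "continuous_on {z. - pi \<le> Re z \<and> Re z \<le> 0 \<and> \<bar>Im z\<bar> \<le> real n} (strip_fun \<gamma>)"
      by (rule continuous_on_subset[OF continuous_strip_fun]) auto
    show "strip_fun \<gamma> field_differentiable at z" if "- pi < Re z" "Re z < 0" for z
      using that by (intro strip_fun_differentiable) auto
    show "norm (strip_fun \<gamma> z) \<le> ?B n" if z: "- pi \<le> Re z" "Re z \<le> 0" "\<bar>Im z\<bar> = real n" for z
    proof -
      have nz: "z \<noteq> 0" using z \<open>n > 0\<close> by auto
      \<comment> \<open>The linear bound sinh x \<ge> x is enough: the horizontal sides have fixed
        length, so decay of order 1 / n suffices.\<close>
      have "real n / 2 \<le> sinh \<bar>Im (z / 2)\<bar>"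
        using z real_le_x_sinh[of "real n / 2"]
        by (simp add: sinh_field_def exp_minus del: sinh_real_abs)
      also have "\<dots> \<le> norm (sin (z/2))" by (rule sin_norm_lower)
      finally have s: "real n \<le> 2 * norm (sin (z/2))" by simp
      have "\<gamma> * Re z \<le> \<bar>\<gamma>\<bar> * \<bar>Re z\<bar>" by (simp add: abs_mult[symmetric])
      also have "\<dots> \<le> \<bar>\<gamma>\<bar> * pi" using z by (intro mult_left_mono) auto
      finally have "norm (exp (of_real \<gamma> * z)) \<le> exp (\<bar>\<gamma>\<bar> * pi)" by simp
      then have "norm (exp (of_real \<gamma> * z) - 1) \<le> exp (\<bar>\<gamma>\<bar> * pi) + 1"
        using norm_triangle_ineq4[of "exp (of_real \<gamma> * z)" 1] by (simp only: norm_one)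
      then have "norm (exp (of_real \<gamma> * z) - 1) / (2 * norm (sin (z/2))) \<le> ?B n"
        using s \<open>n > 0\<close> by (intro frac_le) auto
      then show ?thesis using nz by (simp add: strip_fun_def norm_divide norm_mult)
    qed
  qed (use that in \<open>auto intro!: divide_nonneg_nonneg add_nonneg_nonneg\<close>)
  have int: "cosh_kernel c integrable_on {-real n..real n}" for n c
    by (rule integrable_continuous_interval) (rule continuous_on_subset[OF continuous_cosh_kernel], simp)
  let ?d = "\<lambda>n. - \<i> * (of_real (exp (- pi * \<gamma>)) * ?I n (cosh_kernel \<gamma>) - ?I n (cosh_kernel 0))
        - ?I n (sinh_kernel \<gamma>)"
  have "?I n (\<lambda>v. strip_fun \<gamma> (Complex (-pi) v)) - ?I n (\<lambda>v. strip_fun \<gamma> (Complex 0 v)) = ?d n" for n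
    unfolding strip_fun_imaginary strip_fun_shifted
    by (simp only: integral_mult_right integral_diff[OF integrable_on_mult_right[OF int] int])
  with bound have "norm (?d n) \<le> 2 * (0 - (-pi)) * ?B n" if "n > 0" for n
    using that by (simp only:)
  then have "\<forall>\<^sub>F n in sequentially. norm (?d n) \<le> 2 * (0 - (-pi)) * ?B n"
    by (rule eventually_sequentiallyI[of 1]) simp
  moreover have "(\<lambda>n. 2 * (0 - (-pi)) * ?B n) \<longlonglongrightarrow> 2 * (0 - (-pi)) * 0"
    by (intro tendsto_mult tendsto_const lim_const_over_n)
  ultimately have "?d \<longlonglongrightarrow> 0"
    by (intro Lim_null_comparison[of ?d]) (simp_all only: mult_zero_right)
  moreover have "?d \<longlonglongrightarrow> - \<i> * (of_real (exp (- pi * \<gamma>)) * integral UNIV (cosh_kernel \<gamma>) - integral UNIV (cosh_kernel 0))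
        - integral UNIV (sinh_kernel \<gamma>)"
    by (rule tendsto_diff tendsto_mult tendsto_const cosh_kernel_integral(2) sinh_kernel_integral(2))+
  ultimately have "0 = - \<i> * (of_real (exp (- pi * \<gamma>)) * integral UNIV (cosh_kernel \<gamma>) - integral UNIV (cosh_kernel 0))
        - integral UNIV (sinh_kernel \<gamma>)"
    by (rule LIMSEQ_unique)
  then show ?thesis by (metis eq_iff_diff_eq_0)
qed

lemma integral_reflect_UNIV:
  fixes f :: "real \<Rightarrow> complex"
  assumes "f absolutely_integrable_on UNIV"
  shows "integral UNIV (\<lambda>v. f (- v)) = integral UNIV f"
proof -
  have "range uminus = (UNIV :: real set)" by (simp add: surj_def)
  moreover have "(uminus has_real_derivative -1) (at x)" for x :: real
    by (auto intro!: derivative_eq_intros)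
  ultimately show ?thesis
    using has_absolute_integral_change_of_variables_real[of UNIV uminus "\<lambda>_. -1" f "integral UNIV f"] assms
    by auto
qed

text \<open>At \<gamma> = 0 the contour relation reads 0 = 0, so this normalising value is computed
  from an antiderivative instead.\<close>

lemma cosh_kernel_0_integral: "integral UNIV (cosh_kernel 0) = of_real pi"
proof -
  let ?F = "\<lambda>v::real. 2 * arctan (exp (v/2))"
  have d: "(?F has_real_derivative 1 / (2 * cosh (v/2))) (at v within A)" for v A
  proof -
    have "(?F has_real_derivative 2 * (inverse (1 + (exp (v/2))\<^sup>2) * (exp (v/2) * (1/2)))) (at v within A)"
      by (auto intro!: derivative_eq_intros)
    moreover have "1 + (exp (v/2))\<^sup>2 \<noteq> 0" by (smt (verit) zero_le_power2)
    then have "2 * (inverse (1 + (exp (v/2))\<^sup>2) * (exp (v/2) * (1/2))) = 1 / (2 * cosh (v/2))"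
      by (simp add: cosh_field_def exp_minus divide_simps power2_eq_square)
    ultimately show ?thesis by simp
  qed
  have k: "cosh_kernel 0 = (\<lambda>v. complex_of_real (1 / (2 * cosh (v/2))))"
    by (simp add: fun_eq_iff cosh_kernel_def)
  have "(cosh_kernel 0 has_integral (complex_of_real (?F n) - complex_of_real (?F (-n)))) {-n..n}"
    if "n \<ge> 0" for n
    unfolding k
  proof (rule fundamental_theorem_of_calculus)
    show "((\<lambda>a. complex_of_real (?F a)) has_vector_derivative complex_of_real (1 / (2 * cosh (x / 2))))
       (at x within {- n..n})" for x
      by (rule has_vector_derivative_of_real, rule d)
  qed (use that in simp)
  from integral_unique[OF this[of "real _"]]
  have "integral {-real n..real n} (cosh_kernel 0) = of_real (?F (real n) - ?F (-real n))" for n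
    by simp
  moreover have "(\<lambda>n. complex_of_real (?F (real n) - ?F (-real n))) \<longlonglongrightarrow> of_real (2 * (pi/2) - 2 * arctan 0)"
  proof (intro tendsto_intros)
    have e: "filterlim (\<lambda>n. exp (real n / 2)) at_top sequentially" by real_asymp
    show "(\<lambda>n. arctan (exp (real n / 2))) \<longlonglongrightarrow> pi / 2"
      by (rule filterlim_compose[OF tendsto_arctan_at_top e])
    show "(\<lambda>n. exp (- real n / 2)) \<longlonglongrightarrow> 0" by real_asymp
  qed
  ultimately show ?thesis
    using LIMSEQ_unique[OF cosh_kernel_integral(2)[of 0]] by simp
qed

text \<open>The integral of \<open>cosh_kernel\<close> is even in \<gamma> and that of
  \<open>sinh_kernel\<close> is odd. The contour relation at \<gamma> and -\<gamma> therefore gives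
  two linear equations for two unknowns.\<close>

lemma kernel_integrals:
  shows integral_cosh_kernel: "integral UNIV (cosh_kernel \<gamma>) = of_real (pi / cosh (pi * \<gamma>))"
    and integral_sinh_kernel: "integral UNIV (sinh_kernel \<gamma>) = \<i> * of_real (pi * tanh (pi * \<gamma>))"
proof -
  let ?K = "integral UNIV (cosh_kernel \<gamma>)" and ?S = "integral UNIV (sinh_kernel \<gamma>)"
  let ?e = "complex_of_real (exp (pi * \<gamma>))"
  have K: "integral UNIV (cosh_kernel (-\<gamma>)) = ?K"
    using integral_reflect_UNIV[OF cosh_kernel_integral(1)[of \<gamma>]] by (simp add: cosh_kernel_def[abs_def])
  have "integral UNIV (\<lambda>v. sinh_kernel (-\<gamma>) (- v)) = integral UNIV (\<lambda>v. - sinh_kernel \<gamma> v)"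
    by (rule arg_cong[where f="integral UNIV"]) (auto simp: sinh_kernel_def)
  then have S: "integral UNIV (sinh_kernel (-\<gamma>)) = - ?S"
    using integral_reflect_UNIV[OF sinh_kernel_integral(1)[of "-\<gamma>"]] by simp
  have e: "of_real (exp (- pi * \<gamma>)) = inverse ?e" by (simp add: exp_minus)
  have 1: "?S = - \<i> * (inverse ?e * ?K - of_real pi)"
    using sinh_kernel_integral_shift[of \<gamma>] by (simp only: cosh_kernel_0_integral e)
  have 2: "- ?S = - \<i> * (?e * ?K - of_real pi)"
    using sinh_kernel_integral_shift[of "-\<gamma>"] by (simp add: cosh_kernel_0_integral K S)
  have "\<i> * ((?e + inverse ?e) * ?K) = \<i> * (2 * of_real pi)"
    using 1 2 by (simp add: algebra_simps)
  then have "(?e + inverse ?e) * ?K = 2 * of_real pi" by simp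
  moreover have c: "?e + inverse ?e = 2 * of_real (cosh (pi * \<gamma>))"
    by (simp add: cosh_field_def exp_minus)
  moreover have nz: "complex_of_real (cosh (pi * \<gamma>)) \<noteq> 0" by (metis cosh_real_nonzero of_real_eq_0_iff)
  ultimately have "?K * of_real (cosh (pi * \<gamma>)) = of_real pi"
    unfolding c by (simp add: mult_ac)
  with nz show Kv: "?K = of_real (pi / cosh (pi * \<gamma>))"
    by (metis nonzero_eq_divide_eq of_real_divide)
  have "?S = \<i> * of_real (pi - exp (- pi * \<gamma>) * (pi / cosh (pi * \<gamma>)))"
    unfolding 1 Kv e[symmetric] by (simp add: algebra_simps)
  also have "pi - exp (- pi * \<gamma>) * (pi / cosh (pi * \<gamma>)) = pi * tanh (pi * \<gamma>)"
    using cosh_minus_sinh[of "pi * \<gamma>"] cosh_real_nonzero[of "pi * \<gamma>"]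
    by (simp add: tanh_def divide_simps) (simp add: algebra_simps flip: cosh_minus_sinh)
  finally show "?S = \<i> * of_real (pi * tanh (pi * \<gamma>))" .
qed

section \<open>Eigenfunctions of the finite Hilbert transform\<close>

text \<open>Written as one integral with a cut-off kernel and without the factor 1 / (pi i), so that
  it makes sense wherever the points t - \<epsilon> and t + \<epsilon> lie.\<close>

definition trunc_hilbert :: "real \<Rightarrow> (real \<Rightarrow> complex) \<Rightarrow> real \<Rightarrow> complex" where
  "trunc_hilbert \<epsilon> u t = (\<integral>x. (if \<epsilon> \<le> \<bar>x - t\<bar> then u x / of_real (x - t) else 0) \<partial>leb_I)"

text \<open>A relation rather than a function, because \<open>finite_hilbert\<close> also returns a
  value where no limit exists.\<close>

definition has_pv :: "(real \<Rightarrow> complex) \<Rightarrow> real \<Rightarrow> complex \<Rightarrow> bool" where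
  "has_pv u t L \<longleftrightarrow> ((\<lambda>\<epsilon>. trunc_hilbert \<epsilon> u t) \<longlongrightarrow> L) (at_right 0)"

lemma ident_measurable_leb_I [measurable]: "(\<lambda>x. x) \<in> borel_measurable leb_I"
  using id_borel_measurable_lebesgue_on[of "{-1<..<1}"] by (simp add: id_def)

lemma borel_measurable_leb_I:
  assumes "f \<in> borel_measurable borel" shows "f \<in> borel_measurable leb_I"
  using measurable_compose[OF ident_measurable_leb_I assms] .

lemma finite_measure_leb_I: "finite_measure leb_I"
  by (rule finite_measureI) (simp add: space_restrict_space emeasure_restrict_space)

interpretation leb_I: finite_measure leb_I by (rule finite_measure_leb_I)

lemma AE_leb_I_neq: "AE x in leb_I. x \<noteq> t"
proof -
  have "AE x in lebesgue. x \<notin> {t}" by (rule AE_not_in) (simp add: null_sets_completionI)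
  then show ?thesis by (subst AE_restrict_space_iff) auto
qed

lemma AE_leb_I_in: "AE x in leb_I. -1 < x \<and> x < 1"
  by (rule AE_I2) (simp add: space_restrict_space)

lemma trunc_kernel_integrable:
  fixes u :: "real \<Rightarrow> complex"
  assumes u: "integrable leb_I u" and e: "0 < \<epsilon>"
  shows "integrable leb_I (\<lambda>x. if \<epsilon> \<le> \<bar>x - t\<bar> then u x / of_real (x - t) else 0)"
proof (rule Bochner_Integration.integrable_bound[where f="\<lambda>x. u x / of_real \<epsilon>"])
  show "integrable leb_I (\<lambda>x. u x / of_real \<epsilon>)" using u by simp
  show "(\<lambda>x. if \<epsilon> \<le> \<bar>x - t\<bar> then u x / of_real (x - t) else 0) \<in> borel_measurable leb_I"
    using borel_measurable_integrable[OF u] by measurable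
  show "AE x in leb_I. norm (if \<epsilon> \<le> \<bar>x - t\<bar> then u x / of_real (x - t) else 0) \<le> norm (u x / of_real \<epsilon>)"
    using e by (intro AE_I2) (auto simp: norm_divide simp flip: of_real_diff intro!: divide_left_mono)
qed

lemma finite_hilbert_eq_trunc:
  assumes u: "integrable leb_I u" and t: "-1 < t" "t < 1" and e: "0 < \<epsilon>"
  shows "(LINT x:{-1<..t - \<epsilon>}|lebesgue. u x / of_real (x - t)) + (LINT x:{t + \<epsilon>..<1}|lebesgue. u x / of_real (x - t))
     = trunc_hilbert \<epsilon> u t"
proof -
  let ?k = "\<lambda>x. if \<epsilon> \<le> \<bar>x - t\<bar> then u x / of_real (x - t) else 0"
  have i: "integrable lebesgue (\<lambda>x. indicator {-1<..<1} x *\<^sub>R ?k x)"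
    using trunc_kernel_integrable[OF u e, of t] by (subst (asm) integrable_restrict_space) auto
  have s: "set_integrable lebesgue A ?k" if "A \<subseteq> {-1<..<1}" "A \<in> sets lebesgue" for A
    by (rule set_integrable_subset[of _ "{-1<..<1}"]) (use i that in \<open>auto simp: set_integrable_def\<close>)
  have "trunc_hilbert \<epsilon> u t = (LINT x:{-1<..<1}|lebesgue. ?k x)"
    unfolding trunc_hilbert_def set_lebesgue_integral_def by (rule integral_restrict_space) simp
  also have "\<dots> = (LINT x:{-1<..t - \<epsilon>} \<union> {t + \<epsilon>..<1}|lebesgue. ?k x)"
    unfolding set_lebesgue_integral_def
    by (rule Bochner_Integration.integral_cong) (use t e in \<open>auto simp: indicator_def\<close>)
  also have "\<dots> = (LINT x:{-1<..t - \<epsilon>}|lebesgue. ?k x) + (LINT x:{t + \<epsilon>..<1}|lebesgue. ?k x)"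
    by (rule set_integral_Un) (use t e in \<open>auto intro!: s\<close>)
  also have "(LINT x:{-1<..t - \<epsilon>}|lebesgue. ?k x) = (LINT x:{-1<..t - \<epsilon>}|lebesgue. u x / of_real (x - t))"
    unfolding set_lebesgue_integral_def
    by (rule Bochner_Integration.integral_cong) (use e in \<open>auto simp: indicator_def\<close>)
  also have "(LINT x:{t + \<epsilon>..<1}|lebesgue. ?k x) = (LINT x:{t + \<epsilon>..<1}|lebesgue. u x / of_real (x - t))"
    unfolding set_lebesgue_integral_def
    by (rule Bochner_Integration.integral_cong) (use e in \<open>auto simp: indicator_def\<close>)
  finally show ?thesis by simp
qed

text \<open>An equivalence, because points at which no principal value exists have to be recognised
  as points without a limit, too.\<close>

lemma finite_hilbert_tendsto_iff:
  assumes u: "integrable leb_I u" and t: "-1 < t" "t < 1"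
  shows "((\<lambda>\<epsilon>. 1 / (of_real pi * \<i>) *
       ((LINT x:{-1<..t - \<epsilon>}|lebesgue. u x / of_real (x - t)) +
        (LINT x:{t + \<epsilon>..<1}|lebesgue. u x / of_real (x - t)))) \<longlongrightarrow> l) (at_right 0)
     \<longleftrightarrow> has_pv u t (of_real pi * \<i> * l)"
proof -
  have "\<forall>\<^sub>F \<epsilon> in at_right 0. (1 / (of_real pi * \<i>) *
       ((LINT x:{-1<..t - \<epsilon>}|lebesgue. u x / of_real (x - t)) +
        (LINT x:{t + \<epsilon>..<1}|lebesgue. u x / of_real (x - t)))) = 1 / (of_real pi * \<i>) * trunc_hilbert \<epsilon> u t"
    using eventually_at_right_less[of 0]
    by (rule eventually_mono) (simp only: finite_hilbert_eq_trunc[OF u t])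
  note tendsto_cong[OF this]
  moreover have "((\<lambda>\<epsilon>. 1 / (of_real pi * \<i>) * trunc_hilbert \<epsilon> u t) \<longlongrightarrow> l) (at_right 0) \<longleftrightarrow> has_pv u t (of_real pi * \<i> * l)"
    unfolding has_pv_def
    using tendsto_mult_left_iff[of "1 / (of_real pi * \<i>)" "\<lambda>\<epsilon>. trunc_hilbert \<epsilon> u t" "of_real pi * \<i> * l" "at_right 0"]
    by simp
  ultimately show ?thesis by simp
qed

lemma finite_hilbert_eqI:
  assumes "integrable leb_I u" "-1 < t" "t < 1" "has_pv u t L"
  shows "finite_hilbert u t = L / (of_real pi * \<i>)"
  unfolding finite_hilbert_def
  by (rule tendsto_Lim, simp) (subst finite_hilbert_tendsto_iff[OF assms(1-3)], use assms(4) in simp)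

lemma trunc_hilbert_add:
  assumes "integrable leb_I u" "integrable leb_I v" "0 < \<epsilon>"
  shows "trunc_hilbert \<epsilon> (\<lambda>x. u x + v x) t = trunc_hilbert \<epsilon> u t + trunc_hilbert \<epsilon> v t"
  unfolding trunc_hilbert_def
  by (subst Bochner_Integration.integral_add[symmetric])
     (use assms in \<open>auto intro!: trunc_kernel_integrable Bochner_Integration.integral_cong simp: add_divide_distrib\<close>)

lemma trunc_hilbert_cmult: "trunc_hilbert \<epsilon> (\<lambda>x. c * u x) t = c * trunc_hilbert \<epsilon> u t"
  unfolding trunc_hilbert_def integral_mult_right_zero[symmetric]
  by (rule Bochner_Integration.integral_cong) auto

lemma has_pv_add:
  assumes "integrable leb_I u" "integrable leb_I v" "has_pv u t K" "has_pv v t L"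
  shows "has_pv (\<lambda>x. u x + v x) t (K + L)"
proof -
  have "((\<lambda>\<epsilon>. trunc_hilbert \<epsilon> u t + trunc_hilbert \<epsilon> v t) \<longlongrightarrow> K + L) (at_right 0)"
    using assms(3,4) unfolding has_pv_def by (rule tendsto_add)
  moreover have "\<forall>\<^sub>F \<epsilon> in at_right 0. trunc_hilbert \<epsilon> u t + trunc_hilbert \<epsilon> v t = trunc_hilbert \<epsilon> (\<lambda>x. u x + v x) t"
    using eventually_at_right_less[of 0]
    by (rule eventually_mono) (simp add: trunc_hilbert_add assms)
  ultimately show ?thesis unfolding has_pv_def by (rule Lim_transform_eventually)
qed

lemma has_pv_cmult: "has_pv u t L \<Longrightarrow> has_pv (\<lambda>x. c * u x) t (c * L)"
  unfolding has_pv_def trunc_hilbert_cmult by (rule tendsto_mult_left)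

text \<open>No cancellation is involved: the cut-off quotients are dominated by the quotient
  itself.\<close>

lemma has_pv_integrable_quotient:
  assumes "integrable leb_I (\<lambda>x. u x / of_real (x - t))"
  shows "has_pv u t (\<integral>x. u x / of_real (x - t) \<partial>leb_I)"
  unfolding has_pv_def trunc_hilbert_def tendsto_at_iff_sequentially o_def
proof (intro allI impI)
  fix E :: "nat \<Rightarrow> real"
  assume E: "\<forall>i. E i \<in> {0<..} - {0}" "E \<longlonglongrightarrow> 0"
  show "(\<lambda>n. \<integral>x. (if E n \<le> \<bar>x - t\<bar> then u x / of_real (x - t) else 0) \<partial>leb_I)
        \<longlonglongrightarrow> (\<integral>x. u x / of_real (x - t) \<partial>leb_I)"
  proof (rule integral_dominated_convergence[where w="\<lambda>x. norm (u x / of_real (x - t))"])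
    show "(\<lambda>x. u x / of_real (x - t)) \<in> borel_measurable leb_I" using assms by simp
    then have "(\<lambda>x. if E n \<le> \<bar>x - t\<bar> then u x / of_real (x - t) else 0) \<in> borel_measurable leb_I" for n
      by measurable
    then show "(\<lambda>x. if E n \<le> \<bar>x - t\<bar> then u x / of_real (x - t) else 0) \<in> borel_measurable leb_I" for n .
    show "integrable leb_I (\<lambda>x. norm (u x / of_real (x - t)))"
      using assms by (rule integrable_norm)
    show "AE x in leb_I. (\<lambda>n. if E n \<le> \<bar>x - t\<bar> then u x / of_real (x - t) else 0) \<longlonglongrightarrow> u x / of_real (x - t)"
      using AE_leb_I_neq[of t]
    proof eventually_elim
      case (elim x)
      have "\<forall>\<^sub>F n in sequentially. E n < \<bar>x - t\<bar>"
        by (rule order_tendstoD(2)[OF E(2)]) (use elim in simp)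
      then have "\<forall>\<^sub>F n in sequentially. (if E n \<le> \<bar>x - t\<bar> then u x / of_real (x - t) else 0) = u x / of_real (x - t)"
        by (rule eventually_mono) simp
      then show ?case by (rule tendsto_eventually)
    qed
  qed auto
qed

text \<open>Write P f as P t times f plus (x - t) Q f. The factor x - t cancels the singularity of
  the second summand, whose principal value is then the integral of Q f.\<close>

lemma has_pv_poly_factor:
  assumes f: "has_pv f t L"
    and PQ: "\<And>x. P x - P t = (x - t) * Q x"
    and i: "integrable leb_I f" and iQ: "integrable leb_I (\<lambda>x. Q x * f x)"
  shows "has_pv (\<lambda>x. of_real (P x) * f x) t (of_real (P t) * L + (\<integral>x. of_real (Q x) * f x \<partial>leb_I))"
proof -
  let ?g = "\<lambda>x. of_real (x - t) * (of_real (Q x) * f x)"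
  have ae: "AE x in leb_I. ?g x / of_real (x - t) = of_real (Q x) * f x"
    using AE_leb_I_neq[of t] by eventually_elim simp
  have ig: "integrable leb_I ?g"
  proof (rule Bochner_Integration.integrable_bound[OF integrable_mult_right[where c="of_real (1 + \<bar>t\<bar>)"]])
    show "integrable leb_I (\<lambda>x. of_real (Q x) * f x)" by (rule iQ)
    show "?g \<in> borel_measurable leb_I"
      by (intro borel_measurable_times borel_measurable_integrable[OF iQ])
         (auto intro!: borel_measurable_leb_I)
    show "AE x in leb_I. norm (?g x) \<le> norm (of_real (1 + \<bar>t\<bar>) * (of_real (Q x) * f x))"
      using AE_leb_I_in
      by eventually_elim (auto simp: norm_mult simp del: of_real_add of_real_diff intro!: mult_right_mono)
  qed
  have mq: "(\<lambda>x. ?g x / of_real (x - t)) \<in> borel_measurable leb_I"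
    by (rule borel_measurable_divide[OF borel_measurable_integrable[OF ig]])
       (auto intro!: borel_measurable_leb_I)
  have iq: "integrable leb_I (\<lambda>x. ?g x / of_real (x - t))"
    by (rule integrable_cong_AE_imp[OF iQ mq]) (rule eventually_mono[OF ae], simp)
  have "has_pv ?g t (\<integral>x. ?g x / of_real (x - t) \<partial>leb_I)"
    by (rule has_pv_integrable_quotient[OF iq])
  also have "(\<integral>x. ?g x / of_real (x - t) \<partial>leb_I) = (\<integral>x. of_real (Q x) * f x \<partial>leb_I)"
    by (rule integral_cong_AE) (use ae borel_measurable_integrable[OF iq] borel_measurable_integrable[OF iQ] in auto)
  finally have "has_pv (\<lambda>x. of_real (P t) * f x + ?g x) t
      (of_real (P t) * L + (\<integral>x. of_real (Q x) * f x \<partial>leb_I))"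
    using ig i by (intro has_pv_add has_pv_cmult f) auto
  moreover have "of_real (P t) * f x + ?g x = of_real (P x) * f x" for x
  proof -
    have "P x = P t + (x - t) * Q x" using PQ[of x] by simp
    then show ?thesis by (simp only: of_real_add of_real_mult) (simp add: algebra_simps)
  qed
  ultimately show ?thesis by simp
qed

section \<open>The eigenvalue equation\<close>

definition hilbert_eigenfun :: "real \<Rightarrow> real \<Rightarrow> complex" where
  "hilbert_eigenfun \<gamma> x = cis (2 * \<gamma> * artanh x) / of_real (sqrt (1 - x\<^sup>2))"

lemma hilbert_eigenfun_tanh: "hilbert_eigenfun \<gamma> (tanh v) = cis (2 * \<gamma> * v) * of_real (cosh v)"
proof -
  have "1 - (tanh v)\<^sup>2 = 1 / (cosh v)\<^sup>2"
    using hyperbolic_pythagoras[of v] by (simp add: tanh_def power_divide divide_simps)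
  then have "sqrt (1 - (tanh v)\<^sup>2) = 1 / cosh v" by (simp add: real_sqrt_divide)
  then show ?thesis by (simp add: hilbert_eigenfun_def artanh_tanh_real)
qed

lemma tanh_artanh:
  fixes x :: real
  assumes "-1 < x" "x < 1"
  shows "tanh (artanh x) = x"
proof -
  have "exp (- 2 * artanh x) = (1 - x) / (1 + x)"
    using assms by (simp add: artanh_def exp_minus)
  then show ?thesis
    unfolding tanh_real_altdef using assms by (simp only:) (simp add: divide_simps)
qed

lemma range_tanh_shift: "range (\<lambda>r. tanh ((r + \<rho>) / 2)) = {-1<..<1::real}"
proof -
  have "x \<in> range (\<lambda>r. tanh ((r + \<rho>) / 2))" if "-1 < x" "x < 1" for x :: real
    by (rule range_eqI[of _ _ "2 * artanh x - \<rho>"]) (use that in \<open>simp add: tanh_artanh\<close>)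
  then show ?thesis using tanh_real_gt_neg1 tanh_real_lt_1 by auto
qed

text \<open>The shift \<rho> is there to be taken as 2 artanh t, which moves the singular point x =
  t to r = 0.\<close>

lemma integral_leb_I_tanh:
  fixes f :: "real \<Rightarrow> complex"
  assumes "(\<lambda>r. (1 / (2 * (cosh ((r + \<rho>) / 2))\<^sup>2)) *\<^sub>R f (tanh ((r + \<rho>) / 2))) absolutely_integrable_on UNIV"
  shows "integrable leb_I f"
    and "(\<integral>x. f x \<partial>leb_I) = integral UNIV (\<lambda>r. (1 / (2 * (cosh ((r + \<rho>) / 2))\<^sup>2)) *\<^sub>R f (tanh ((r + \<rho>) / 2)))"
      (is "_ = ?I")
proof -
  let ?g = "\<lambda>r. tanh ((r + \<rho>) / 2)" and ?g' = "\<lambda>r. 1 / (2 * (cosh ((r + \<rho>) / 2))\<^sup>2)"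
  have d: "(?g has_field_derivative ?g' r) (at r within UNIV)" for r
  proof -
    have "(?g has_field_derivative (1 - (tanh ((r + \<rho>) / 2))\<^sup>2) * (1/2)) (at r within UNIV)"
      by (auto intro!: derivative_eq_intros)
    moreover have "(1 - (tanh ((r + \<rho>) / 2))\<^sup>2) * (1/2) = ?g' r"
      using hyperbolic_pythagoras[of "(r+\<rho>)/2"] by (simp add: tanh_def power_divide divide_simps)
    ultimately show ?thesis by (simp only:)
  qed
  have inj: "inj_on ?g UNIV" by (auto simp: inj_on_def)
  have abs: "\<bar>?g' r\<bar> = ?g' r" for r by simp
  have "f absolutely_integrable_on range ?g \<and> integral (range ?g) f = ?I"
    using has_absolute_integral_change_of_variables_real[OF _ d inj, of f ?I] assms unfolding abs by auto
  then have a: "f absolutely_integrable_on {-1<..<1}" and i: "integral {-1<..<1} f = ?I"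
    unfolding range_tanh_shift by auto
  show "integrable leb_I f"
    using a by (subst integrable_restrict_space) (auto simp: set_integrable_def)
  have "(\<integral>x. f x \<partial>leb_I) = (LINT x:{-1<..<1}|lebesgue. f x)"
    unfolding set_lebesgue_integral_def by (rule integral_restrict_space) simp
  also have "\<dots> = integral {-1<..<1} f"
    using a by (rule set_lebesgue_integral_eq_integral)
  finally show "(\<integral>x. f x \<partial>leb_I) = ?I" using i by simp
qed

lemma hilbert_eigenfun_integral:
  shows integrable_hilbert_eigenfun: "integrable leb_I (hilbert_eigenfun \<gamma>)"
    and integral_hilbert_eigenfun: "(\<integral>x. hilbert_eigenfun \<gamma> x \<partial>leb_I) = of_real (pi / cosh (pi * \<gamma>))"
proof -
  have "(1 / (2 * (cosh ((r + 0) / 2))\<^sup>2)) *\<^sub>R hilbert_eigenfun \<gamma> (tanh ((r + 0) / 2)) = cosh_kernel \<gamma> r" for r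
    unfolding hilbert_eigenfun_tanh
    by (simp add: cosh_kernel_def scaleR_conv_of_real power2_eq_square field_simps)
  note eq = ext[of "\<lambda>r. (1 / (2 * (cosh ((r + 0) / 2))\<^sup>2)) *\<^sub>R hilbert_eigenfun \<gamma> (tanh ((r + 0) / 2))", OF this]
  show "integrable leb_I (hilbert_eigenfun \<gamma>)"
    by (rule integral_leb_I_tanh(1)[of 0]) (unfold eq, rule cosh_kernel_integral(1))
  show "(\<integral>x. hilbert_eigenfun \<gamma> x \<partial>leb_I) = of_real (pi / cosh (pi * \<gamma>))"
    unfolding integral_cosh_kernel[symmetric] eq[symmetric]
    by (rule integral_leb_I_tanh(2)[of 0]) (unfold eq, rule cosh_kernel_integral(1))
qed

text \<open>The subtracted multiple of f_0 agrees with f_\<gamma> at t, so the numerator vanishes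
  there. In the coordinate centred at t the quotient becomes a multiple of a kernel that depends on
  \<gamma> alone, which is why the eigenvalue does not depend on t.\<close>

lemma hilbert_eigenfun_difference_tanh:
  fixes \<gamma> t :: real
  assumes t: "-1 < t" "t < 1"
  defines "d \<equiv> \<lambda>x. (hilbert_eigenfun \<gamma> x - cis (2 * \<gamma> * artanh t) * hilbert_eigenfun 0 x) / of_real (x - t)"
  shows "\<exists>d' \<rho>. (\<forall>x. x \<noteq> t \<longrightarrow> d' x = d x) \<and> (\<lambda>r. (1 / (2 * (cosh ((r + \<rho>) / 2))\<^sup>2)) *\<^sub>R d' (tanh ((r + \<rho>) / 2))) = (\<lambda>r. hilbert_eigenfun \<gamma> t * sinh_kernel \<gamma> r)"
proof -
  define \<rho> where "\<rho> = 2 * artanh t"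
  have t_eq: "t = tanh (\<rho> / 2)" unfolding \<rho>_def using t by (simp add: tanh_artanh)
  let ?C = "hilbert_eigenfun \<gamma> t"
  \<comment> \<open>At x = t the quotient \<open>d\<close> is a division by zero; \<open>d'\<close>
    has there the value that corresponds to the limit, and so matches \<open>sinh_kernel\<close> at
    0.\<close>
  define d' where "d' x = (if x = t then ?C * (\<i> * of_real \<gamma>) * of_real (2 * (cosh (\<rho> / 2))\<^sup>2) else d x)" for x
  have C: "?C = cis (\<gamma> * \<rho>) * of_real (cosh (\<rho> / 2))"
    unfolding t_eq hilbert_eigenfun_tanh by (simp add: mult_ac)
  have "(\<lambda>r. (1 / (2 * (cosh ((r + \<rho>) / 2))\<^sup>2)) *\<^sub>R d' (tanh ((r + \<rho>) / 2))) = (\<lambda>r. ?C * sinh_kernel \<gamma> r)"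
  proof
    fix r
    show "(1 / (2 * (cosh ((r + \<rho>) / 2))\<^sup>2)) *\<^sub>R d' (tanh ((r + \<rho>) / 2)) = ?C * sinh_kernel \<gamma> r"
    proof (cases "r = 0")
      case True
      have nz: "complex_of_real (cosh (\<rho> / 2)) \<noteq> 0" by (metis cosh_real_nonzero of_real_eq_0_iff)
      show ?thesis using True nz
        by (simp add: d'_def t_eq[symmetric] sinh_kernel_def scaleR_conv_of_real)
    next
      case False
      define v where "v = (r + \<rho>) / 2"
      have ne: "tanh v \<noteq> t" using False by (simp add: t_eq v_def)
      have nz: "complex_of_real (cosh v) \<noteq> 0" "complex_of_real (cosh (\<rho> / 2)) \<noteq> 0" "complex_of_real (sinh (r / 2)) \<noteq> 0"
        using False by (metis cosh_real_nonzero of_real_eq_0_iff, metis cosh_real_nonzero of_real_eq_0_iff, simp)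
      have h0: "hilbert_eigenfun 0 (tanh v) = of_real (cosh v)" by (simp add: hilbert_eigenfun_tanh)
      \<comment> \<open>The addition theorem for sinh gives tanh v - tanh (\<rho> / 2) = sinh (r /
        2) / (cosh v cosh (\<rho> / 2)), which supplies the denominator of the kernel.\<close>
      have "r / 2 = v - \<rho> / 2" by (simp add: v_def add_divide_distrib)
      then have "sinh (r / 2) = sinh v * cosh (\<rho> / 2) - cosh v * sinh (\<rho> / 2)" by (simp only: sinh_diff)
      then have "tanh v - t = sinh (r / 2) / (cosh v * cosh (\<rho> / 2))"
        unfolding t_eq tanh_def by (simp add: divide_simps)
      moreover have "cis (2 * \<gamma> * v) = cis (\<gamma> * \<rho>) * cis (\<gamma> * r)"
      proof -
        have "2 * \<gamma> * v = \<gamma> * \<rho> + \<gamma> * r" by (simp add: v_def field_simps)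
        then show ?thesis by (simp add: cis_mult)
      qed
      moreover have "2 * \<gamma> * artanh t = \<gamma> * \<rho>" by (simp add: \<rho>_def)
      ultimately have "d (tanh v) = (cis (\<gamma> * \<rho>) * cis (\<gamma> * r) * of_real (cosh v) - cis (\<gamma> * \<rho>) * of_real (cosh v))
           / (of_real (sinh (r / 2)) / (of_real (cosh v) * of_real (cosh (\<rho> / 2))))"
        unfolding d_def h0 hilbert_eigenfun_tanh by (simp only: of_real_divide of_real_mult) simp
      then have "(1 / (2 * (cosh v)\<^sup>2)) *\<^sub>R d (tanh v) = ?C * sinh_kernel \<gamma> r"
        using nz False by (simp add: sinh_kernel_def C scaleR_conv_of_real field_simps power2_eq_square)
      then show ?thesis using ne by (simp add: d'_def v_def)
    qed
  qed
  moreover have "\<forall>x. x \<noteq> t \<longrightarrow> d' x = d x" by (simp add: d'_def)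
  ultimately show ?thesis by (intro exI conjI)
qed

text \<open>The second equation yields the eigenvalue. The third bounds all truncations of the
  difference simultaneously, whatever the cut-off.\<close>

lemma hilbert_eigenfun_difference_integral:
  fixes \<gamma> t :: real
  assumes t: "-1 < t" "t < 1"
  defines "d \<equiv> \<lambda>x. (hilbert_eigenfun \<gamma> x - cis (2 * \<gamma> * artanh t) * hilbert_eigenfun 0 x) / of_real (x - t)"
  shows "integrable leb_I d" "(\<integral>x. d x \<partial>leb_I) = hilbert_eigenfun \<gamma> t * (\<i> * of_real (pi * tanh (pi * \<gamma>)))"
    "(\<integral>x. norm (d x) \<partial>leb_I) = norm (hilbert_eigenfun \<gamma> t) * integral UNIV (\<lambda>r. norm (sinh_kernel \<gamma> r))"
proof -
  let ?C = "hilbert_eigenfun \<gamma> t"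
  have "\<exists>d' \<rho>. (\<forall>x. x \<noteq> t \<longrightarrow> d' x = d x) \<and>
      (\<lambda>r. (1 / (2 * (cosh ((r + \<rho>) / 2))\<^sup>2)) *\<^sub>R d' (tanh ((r + \<rho>) / 2))) = (\<lambda>r. ?C * sinh_kernel \<gamma> r)"
    unfolding d_def by (rule hilbert_eigenfun_difference_tanh[OF t])
  then obtain d' \<rho> where d0: "\<forall>x. x \<noteq> t \<longrightarrow> d' x = d x"
    and eq: "(\<lambda>r. (1 / (2 * (cosh ((r + \<rho>) / 2))\<^sup>2)) *\<^sub>R d' (tanh ((r + \<rho>) / 2))) = (\<lambda>r. ?C * sinh_kernel \<gamma> r)"
    by (elim exE conjE) (rule that)
  have d': "d' x = d x" if "x \<noteq> t" for x
    using d0 that by simp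
  have abs: "(\<lambda>r. ?C * sinh_kernel \<gamma> r) absolutely_integrable_on UNIV"
    using set_integrable_mult_right[OF sinh_kernel_integral(1)] by simp
  have i': "integrable leb_I d'"
    by (rule integral_leb_I_tanh(1)[of \<rho>]) (unfold eq, rule abs)
  have I': "(\<integral>x. d' x \<partial>leb_I) = integral UNIV (\<lambda>r. ?C * sinh_kernel \<gamma> r)"
    unfolding eq[symmetric] by (rule integral_leb_I_tanh(2)[of \<rho>]) (unfold eq, rule abs)
  have ae: "AE x in leb_I. d' x = d x"
    using AE_leb_I_neq[of t] by eventually_elim (simp add: d')
  have m: "d \<in> borel_measurable leb_I"
    unfolding d_def
    using borel_measurable_integrable[OF integrable_hilbert_eigenfun]
    by (intro borel_measurable_divide borel_measurable_diff borel_measurable_times)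
       (auto intro!: borel_measurable_leb_I)
  show "integrable leb_I d" by (rule integrable_cong_AE_imp[OF i' m]) (rule eventually_mono[OF ae], simp)
  have "(\<integral>x. d x \<partial>leb_I) = (\<integral>x. d' x \<partial>leb_I)"
    by (rule integral_cong_AE) (use ae m i' in \<open>auto elim: eventually_mono\<close>)
  then show "(\<integral>x. d x \<partial>leb_I) = ?C * (\<i> * of_real (pi * tanh (pi * \<gamma>)))"
    unfolding I' by (simp only: integral_mult_right integral_sinh_kernel)
  have eqn: "(\<lambda>r. (1 / (2 * (cosh ((r + \<rho>) / 2))\<^sup>2)) *\<^sub>R complex_of_real (norm (d' (tanh ((r + \<rho>) / 2)))))
      = (\<lambda>r. complex_of_real (norm ?C * norm (sinh_kernel \<gamma> r)))"
  proof
    fix r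
    have "(1 / (2 * (cosh ((r + \<rho>) / 2))\<^sup>2)) *\<^sub>R complex_of_real (norm (d' (tanh ((r + \<rho>) / 2))))
       = complex_of_real (norm ((1 / (2 * (cosh ((r + \<rho>) / 2))\<^sup>2)) *\<^sub>R d' (tanh ((r + \<rho>) / 2))))"
      by (simp only: norm_scaleR) (simp add: scaleR_conv_of_real)
    also have "\<dots> = complex_of_real (norm ?C * norm (sinh_kernel \<gamma> r))"
      unfolding fun_cong[OF eq] norm_mult ..
    finally show "(1 / (2 * (cosh ((r + \<rho>) / 2))\<^sup>2)) *\<^sub>R complex_of_real (norm (d' (tanh ((r + \<rho>) / 2))))
       = complex_of_real (norm ?C * norm (sinh_kernel \<gamma> r))" .
  qed
  have absn: "(\<lambda>r. norm ?C * norm (sinh_kernel \<gamma> r)) absolutely_integrable_on UNIV"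
    using set_integrable_mult_right[OF absolutely_integrable_norm[OF sinh_kernel_integral(1)], of "norm ?C"]
    by (simp add: o_def)
  then have hi: "((\<lambda>r. norm ?C * norm (sinh_kernel \<gamma> r)) has_integral norm ?C * integral UNIV (\<lambda>r. norm (sinh_kernel \<gamma> r))) UNIV"
    using set_lebesgue_integral_eq_integral(1)[OF absn] by (simp add: has_integral_integrable_integral)
  have absnc: "(\<lambda>r. complex_of_real (norm ?C * norm (sinh_kernel \<gamma> r))) absolutely_integrable_on UNIV"
    using absolutely_integrable_linear[OF absn bounded_linear_of_real] by (simp add: o_def)
  have "complex_of_real (\<integral>x. norm (d' x) \<partial>leb_I) = (\<integral>x. complex_of_real (norm (d' x)) \<partial>leb_I)"
    by (rule integral_complex_of_real[symmetric])
  also have "\<dots> = integral UNIV (\<lambda>r. complex_of_real (norm ?C * norm (sinh_kernel \<gamma> r)))"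
    unfolding eqn[symmetric] by (rule integral_leb_I_tanh(2)[of \<rho>]) (unfold eqn, rule absnc)
  also have "\<dots> = complex_of_real (norm ?C * integral UNIV (\<lambda>r. norm (sinh_kernel \<gamma> r)))"
    using has_integral_of_real[OF hi] by (rule integral_unique)
  finally have "(\<integral>x. norm (d' x) \<partial>leb_I) = norm ?C * integral UNIV (\<lambda>r. norm (sinh_kernel \<gamma> r))"
    by (simp only: of_real_eq_iff)
  moreover have "(\<integral>x. norm (d x) \<partial>leb_I) = (\<integral>x. norm (d' x) \<partial>leb_I)"
    by (rule integral_cong_AE) (use ae m i' in \<open>auto elim: eventually_mono\<close>)
  ultimately show "(\<integral>x. norm (d x) \<partial>leb_I) = norm ?C * integral UNIV (\<lambda>r. norm (sinh_kernel \<gamma> r))" by simp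
qed

lemma integral_leb_I_eq_HK:
  fixes f :: "real \<Rightarrow> real"
  assumes "f absolutely_integrable_on {-1..1}"
  shows "integrable leb_I f" "(\<integral>x. f x \<partial>leb_I) = integral {-1..1} f"
proof -
  have a: "f absolutely_integrable_on {-1<..<1}"
    by (rule set_integrable_subset[OF assms]) auto
  show "integrable leb_I f"
    using a by (subst integrable_restrict_space) (auto simp: set_integrable_def)
  have "(\<integral>x. f x \<partial>leb_I) = (LINT x:{-1<..<1}|lebesgue. f x)"
    unfolding set_lebesgue_integral_def by (rule integral_restrict_space) simp
  also have "\<dots> = integral {-1<..<1} f"
    using a by (rule set_lebesgue_integral_eq_integral)
  also have "\<dots> = integral {-1..1} f"
    using integral_open_interval[of "-1::real" 1 f] by simp
  finally show "(\<integral>x. f x \<partial>leb_I) = integral {-1..1} f" .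
qed

section \<open>The principal value of 1 / sqrt (1 - x^2)\<close>

text \<open>With t = cos a and x = cos b for a, b in [0, pi] this is 1 - cos (a + b). It is the
  argument of the logarithm in an antiderivative of 1 / (sqrt (1 - x^2) (x - t)).\<close>

definition arc_kernel :: "real \<Rightarrow> real \<Rightarrow> real" where
  "arc_kernel t x = 1 - t * x + sqrt (1 - t\<^sup>2) * sqrt (1 - x\<^sup>2)"

lemma arc_kernel_bounds:
  assumes "\<bar>t\<bar> \<le> 1" "\<bar>x\<bar> \<le> 1"
  shows "1 - \<bar>t\<bar> \<le> arc_kernel t x" "arc_kernel t x \<le> 2"
proof -
  have sq: "t\<^sup>2 \<le> 1" "x\<^sup>2 \<le> 1" using assms by (simp_all add: abs_square_le_1)
  have "t * x \<le> \<bar>t\<bar> * \<bar>x\<bar>" by (simp flip: abs_mult)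
  also have "\<dots> \<le> \<bar>t\<bar> * 1" using assms by (intro mult_left_mono) auto
  finally have "t * x \<le> \<bar>t\<bar>" by simp
  moreover have "0 \<le> sqrt (1 - t\<^sup>2) * sqrt (1 - x\<^sup>2)" using sq by simp
  ultimately show "1 - \<bar>t\<bar> \<le> arc_kernel t x" by (simp add: arc_kernel_def)
  have "2 * (sqrt (1 - t\<^sup>2) * sqrt (1 - x\<^sup>2)) \<le> (sqrt (1 - t\<^sup>2))\<^sup>2 + (sqrt (1 - x\<^sup>2))\<^sup>2"
    using sum_squares_bound[of "sqrt (1 - t\<^sup>2)" "sqrt (1 - x\<^sup>2)"] by simp
  moreover have "2 * (- t * x) \<le> t\<^sup>2 + x\<^sup>2"
    using sum_squares_bound[of "- t" x] by simp
  ultimately show "arc_kernel t x \<le> 2" using sq by (simp add: arc_kernel_def)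
qed

text \<open>The antiderivative vanishes at -1 and at 1, so only its values at t - \<epsilon> and t +
  \<epsilon> remain; their singular parts ln \<epsilon> are equal and cancel.\<close>

lemma trunc_hilbert_eigenfun_0:
  assumes t: "-1 < t" "t < 1" and e: "0 < \<epsilon>" "-1 < t - \<epsilon>" "t + \<epsilon> < 1"
  shows "trunc_hilbert \<epsilon> (hilbert_eigenfun 0) t
     = of_real ((ln (arc_kernel t (t + \<epsilon>)) - ln (arc_kernel t (t - \<epsilon>))) / sqrt (1 - t\<^sup>2))"
proof -
  define w where "w = sqrt (1 - t\<^sup>2)"
  define v where "v = (\<lambda>x. sqrt (1 - x\<^sup>2))"
  define D where "D = (\<lambda>x. 1 - t * x + w * v x)"
  \<comment> \<open>Half the logarithm of the square stands for ln |x - t|, so that one formula can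
    be differentiated on both sides of t.\<close>
  define G where "G = (\<lambda>x. - (ln (D x) - ln ((x - t)\<^sup>2) / 2) / w)"
  have t2: "t\<^sup>2 < 1" using t by (simp add: abs_square_less_1 abs_less_iff)
  have w: "w > 0" and w2: "w\<^sup>2 = 1 - t\<^sup>2" using t2 by (simp_all add: w_def)
  have Dpos: "D x > 0" if "-1 \<le> x" "x \<le> 1" for x
  proof -
    have "1 - \<bar>t\<bar> \<le> arc_kernel t x" by (rule arc_kernel_bounds) (use t that in auto)
    then have "0 < arc_kernel t x" using t by linarith
    then show ?thesis by (simp add: D_def arc_kernel_def w_def v_def)
  qed
  have contD: "continuous_on A D" for A
    unfolding D_def v_def by (intro continuous_intros)
  have dG: "(G has_real_derivative 1 / v x / (x - t)) (at x)" if x: "-1 < x" "x < 1" "x \<noteq> t" for x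
  proof -
    have x2: "x\<^sup>2 < 1" using x by (simp add: abs_square_less_1 abs_less_iff)
    then have v: "v x > 0" and v2: "(v x)\<^sup>2 = 1 - x\<^sup>2" by (simp_all add: v_def)
    have dv: "(v has_real_derivative - x / v x) (at x)"
      unfolding v_def using x2 by (auto intro!: derivative_eq_intros simp: field_simps)
    have dD: "(D has_real_derivative - t - w * x / v x) (at x)"
      unfolding D_def by (rule derivative_eq_intros dv refl | simp)+
    have p: "0 < (x - t) * (x - t)"
      using x(3) by (metis zero_less_power2 power2_eq_square right_minus_eq)
    have dl: "((\<lambda>x. ln ((x - t)\<^sup>2) / 2) has_real_derivative 1 / (x - t)) (at x)"
      using x(3) p by (auto intro!: derivative_eq_intros simp: power2_eq_square divide_simps)
    have dlnD: "((\<lambda>x. ln (D x)) has_real_derivative (- t - w * x / v x) / D x) (at x)"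
      using DERIV_chain2[OF DERIV_ln_divide dD] Dpos[of x] x by simp
    have "(G has_real_derivative - ((- t - w * x / v x) / D x - 1 / (x - t)) / w) (at x)"
      unfolding G_def by (rule DERIV_cdivide[OF DERIV_minus[OF DERIV_diff[OF dlnD dl]]])
    moreover have "- ((- t - w * x / v x) / D x - 1 / (x - t)) / w = 1 / v x / (x - t)"
    proof -
      \<comment> \<open>This is D - (x - t) D' = w D / v; it rests on w^2 = 1 - t^2 and v^2 = 1 -
        x^2.\<close>
      have "D x - (x - t) * (- t - w * x / v x) = w * D x / v x"
        using v w2 v2 unfolding D_def by (simp add: field_simps power2_eq_square) algebra
      then show ?thesis
        using Dpos[of x] x w v by (simp add: field_simps)
    qed
    ultimately show ?thesis by simp
  qed
  have "(- 1 - t)\<^sup>2 = (1 + t)\<^sup>2" by (simp add: power2_eq_square algebra_simps)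
  then have G1: "G 1 = 0" "G (-1) = 0"
    using t by (simp_all only: G_def) (simp_all add: D_def v_def ln_realpow)
  have v0: "hilbert_eigenfun 0 x = of_real (1 / v x)" for x
    by (simp add: hilbert_eigenfun_def v_def)
    define k where "k = (\<lambda>x. 1 / v x / (x - t))"
    have cG: "continuous_on {a..b} G" if "-1 \<le> a" "b \<le> 1" "t \<notin> {a..b}" for a b
    proof -
      have "D x \<noteq> 0" if "x \<in> {a..b}" for x
        using Dpos[of x] that \<open>-1 \<le> a\<close> \<open>b \<le> 1\<close> by auto
      then show ?thesis
        unfolding G_def using that w by (intro continuous_intros contD) auto
    qed
    have hi: "(k has_integral (G b - G a)) {a..b}" if "-1 \<le> a" "a \<le> b" "b \<le> 1" "t \<notin> {a..b}" for a b
    proof (rule fundamental_theorem_of_calculus_interior[OF \<open>a \<le> b\<close> cG])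
      show "(G has_vector_derivative k x) (at x)" if "x \<in> {a<..<b}" for x
        unfolding has_real_derivative_iff_has_vector_derivative[symmetric] k_def
        by (rule dG) (use that \<open>-1 \<le> a\<close> \<open>b \<le> 1\<close> \<open>t \<notin> {a..b}\<close> in auto)
    qed (use that in auto)
    have i1: "(k has_integral (G (t - \<epsilon>) - G (-1))) {-1..t-\<epsilon>}"
      and i2: "(k has_integral (G 1 - G (t + \<epsilon>))) {t+\<epsilon>..1}"
      using hi[of "-1" "t - \<epsilon>"] hi[of "t + \<epsilon>" 1] e t by simp_all
    have vp: "0 \<le> v x" if "-1 \<le> x" "x \<le> 1" for x
      using that by (auto simp: v_def abs_square_le_1)
    \<comment> \<open>The integrand is unbounded at the endpoints. Since it has one sign on each
      side of t, the gauge integrability obtained from the antiderivative improves to absolute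
      integrability.\<close>
    have k_sign: "0 \<le> k x" if "t \<le> x" "x \<le> 1" for x
      using that vp[of x] t by (simp add: k_def)
    have k_sign': "k x \<le> 0" if "x \<le> t" "-1 \<le> x" for x
      using that vp[of x] t by (simp add: k_def mult_nonneg_nonpos)
    have a2: "k absolutely_integrable_on {t+\<epsilon>..1}"
      by (rule nonnegative_absolutely_integrable_1) (use i2 e k_sign in auto)
    have "(\<lambda>x. - k x) absolutely_integrable_on {-1..t-\<epsilon>}"
      by (rule nonnegative_absolutely_integrable_1)
         (use i1 e t k_sign' in \<open>auto simp: integrable_neg_iff\<close>)
    then have a1: "k absolutely_integrable_on {-1..t-\<epsilon>}"
      using set_integrable_mult_right[of "-1" lebesgue "{-1..t-\<epsilon>}" "\<lambda>x. - k x"] by simp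
    let ?A = "{-1..t-\<epsilon>} \<union> {t+\<epsilon>..1}"
    let ?h = "\<lambda>x. if x \<in> ?A then k x else 0"
    have ka: "k absolutely_integrable_on ?A" by (rule set_integrable_Un[OF a1 a2]) auto
    have "(k has_integral (G (t - \<epsilon>) - G (-1)) + (G 1 - G (t + \<epsilon>))) ?A"
      by (rule has_integral_Un[OF i1 i2]) (use e in auto)
    then have kI: "integral ?A k = G (t - \<epsilon>) - G (t + \<epsilon>)" by (simp add: G1 integral_unique)
    have sub: "?A \<subseteq> {-1..1}" using e by auto
    have "(\<lambda>x. indicator {-1..1} x *\<^sub>R ?h x) = (\<lambda>x. indicator ?A x *\<^sub>R k x)"
      using sub by (auto simp: fun_eq_iff indicator_def)
    then have ha: "?h absolutely_integrable_on {-1..1}"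
      using ka by (simp only: set_integrable_def)
    have hI: "integral {-1..1} ?h = G (t - \<epsilon>) - G (t + \<epsilon>)"
      unfolding kI[symmetric] Henstock_Kurzweil_Integration.integral_restrict_Int Int_absorb2[OF sub] ..
    have "trunc_hilbert \<epsilon> (hilbert_eigenfun 0) t = (\<integral>x. of_real (?h x) \<partial>leb_I)"
      unfolding trunc_hilbert_def v0
      by (rule Bochner_Integration.integral_cong) (use e in \<open>auto simp: space_restrict_space abs_if k_def split: if_splits\<close>)
    also have "\<dots> = of_real (\<integral>x. ?h x \<partial>leb_I)" by (rule integral_complex_of_real)
    also have "(\<integral>x. ?h x \<partial>leb_I) = G (t - \<epsilon>) - G (t + \<epsilon>)"
      unfolding hI[symmetric] by (rule integral_leb_I_eq_HK(2)[OF ha])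
    finally have "trunc_hilbert \<epsilon> (hilbert_eigenfun 0) t = of_real (G (t - \<epsilon>) - G (t + \<epsilon>))" .
  moreover have "G (t - \<epsilon>) - G (t + \<epsilon>) = (ln (D (t + \<epsilon>)) - ln (D (t - \<epsilon>))) / w"
    using e w by (simp add: G_def field_simps)
  ultimately show ?thesis by (simp only: D_def arc_kernel_def w_def v_def)
qed

lemma has_pv_hilbert_eigenfun_0:
  assumes t: "-1 < t" "t < 1"
  shows "has_pv (hilbert_eigenfun 0) t 0"
proof -
  define w where "w = sqrt (1 - t\<^sup>2)"
  define D where "D = arc_kernel t"
  have t2: "t\<^sup>2 < 1" using t by (simp add: abs_square_less_1 abs_less_iff)
  have w: "w > 0" using t2 by (simp add: w_def)
  have Dpos: "D t > 0"
  proof -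
    have "1 - \<bar>t\<bar> \<le> arc_kernel t t" by (rule arc_kernel_bounds) (use t in auto)
    then show ?thesis unfolding D_def using t by linarith
  qed
  have contD: "continuous_on A D" for A
    unfolding D_def arc_kernel_def by (intro continuous_intros)
  have Dlim: "(D \<longlongrightarrow> D t) (nhds t)"
    using contD[of UNIV] by (simp add: continuous_on_eq_continuous_at isCont_def tendsto_at_iff_tendsto_nhds)
  have "((\<lambda>\<epsilon>. t + \<epsilon>) \<longlongrightarrow> t + 0) (at_right 0)" "((\<lambda>\<epsilon>. t - \<epsilon>) \<longlongrightarrow> t - 0) (at_right 0)"
    by (intro tendsto_intros)+
  then have "((\<lambda>\<epsilon>. D (t + \<epsilon>)) \<longlongrightarrow> D t) (at_right 0)" "((\<lambda>\<epsilon>. D (t - \<epsilon>)) \<longlongrightarrow> D t) (at_right 0)"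
    by (simp_all add: filterlim_compose[OF Dlim])
  then have "((\<lambda>\<epsilon>. (ln (D (t + \<epsilon>)) - ln (D (t - \<epsilon>))) / w) \<longlongrightarrow> (ln (D t) - ln (D t)) / w) (at_right 0)"
    using Dpos w by (intro tendsto_divide tendsto_diff tendsto_ln tendsto_const) auto
  then have lim: "((\<lambda>\<epsilon>. complex_of_real ((ln (D (t + \<epsilon>)) - ln (D (t - \<epsilon>))) / w)) \<longlongrightarrow> of_real 0) (at_right 0)"
    by (intro tendsto_of_real) simp
  have "\<forall>\<^sub>F \<epsilon> in at_right 0. \<epsilon> \<in> {0<..<min (1 - t) (1 + t)}"
    by (rule eventually_at_right_real) (use t in auto)
  then have "\<forall>\<^sub>F \<epsilon> in at_right 0. complex_of_real ((ln (D (t + \<epsilon>)) - ln (D (t - \<epsilon>))) / w) = trunc_hilbert \<epsilon> (hilbert_eigenfun 0) t"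
    by (rule eventually_mono) (subst trunc_hilbert_eigenfun_0, use t in \<open>auto simp: D_def w_def\<close>)
  from Lim_transform_eventually[OF lim this] show ?thesis by (simp add: has_pv_def)
qed

text \<open>The multiple of f_0 with the same value at t carries the whole singularity and has
  principal value 0; the remainder is an ordinary integral.\<close>

lemma has_pv_hilbert_eigenfun:
  assumes t: "-1 < t" "t < 1"
  shows "has_pv (hilbert_eigenfun \<gamma>) t (\<i> * of_real (pi * tanh (pi * \<gamma>)) * hilbert_eigenfun \<gamma> t)"
proof -
  let ?c = "cis (2 * \<gamma> * artanh t)"
  let ?d = "\<lambda>x. hilbert_eigenfun \<gamma> x - ?c * hilbert_eigenfun 0 x"
  have "has_pv ?d t (\<integral>x. ?d x / of_real (x - t) \<partial>leb_I)"
    by (rule has_pv_integrable_quotient) (rule hilbert_eigenfun_difference_integral(1)[OF t])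
  then have "has_pv (\<lambda>x. ?d x + ?c * hilbert_eigenfun 0 x) t ((\<integral>x. ?d x / of_real (x - t) \<partial>leb_I) + ?c * 0)"
    by (intro has_pv_add has_pv_cmult has_pv_hilbert_eigenfun_0 t Bochner_Integration.integrable_diff
        integrable_mult_right integrable_hilbert_eigenfun)
  then show ?thesis
    using hilbert_eigenfun_difference_integral(2)[OF t] by (simp add: mult_ac)
qed

section \<open>Riesz's inequality for conjugate Poisson integrals\<close>

lemma integrable_powr_endpoint:
  fixes q :: real
  assumes q: "0 < q" "q < 1"
  shows "integrable leb_I (\<lambda>x. (1 - x) powr (-q))"
proof -
  define F where "F = (\<lambda>x::real. (1 - x) powr (1 - q) * (- 1 / (1 - q)))"
  have "((\<lambda>x. (1 - x) powr (-q)) has_integral (F 1 - F (-1))) {-1..1}"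
  proof (rule fundamental_theorem_of_calculus_interior)
    show "continuous_on {-1..1} F"
      unfolding F_def using q by (intro continuous_intros continuous_on_powr') auto
    fix x :: real assume "x \<in> {-1<..<1}"
    then have "((\<lambda>x. (1 - x) powr (1 - q)) has_real_derivative (1 - q) * (1 - x) powr (1 - q - 1) * (- 1)) (at x)"
      by (intro DERIV_chain2[OF has_real_derivative_powr]) (auto intro!: derivative_eq_intros)
    from DERIV_cmult_right[OF this, of "- 1 / (1 - q)"]
    have "(F has_real_derivative (1 - x) powr (-q)) (at x)"
      unfolding F_def using q by simp
    then show "(F has_vector_derivative (1 - x) powr (-q)) (at x)"
      by (simp add: has_real_derivative_iff_has_vector_derivative)
  qed simp
  then show ?thesis
    by (intro integral_leb_I_eq_HK nonnegative_absolutely_integrable_1) auto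
qed

text \<open>A bound on the L^1 norms of the kernel that is uniform in x gives joint integrability.
  The lemma serves the Poisson kernel, the conjugate Poisson kernel and the averaging over cut-offs,
  hence the scalar type that covers both real and complex values.\<close>

lemma Fubini_kernel:
  fixes u :: "'a \<Rightarrow> 'c::{real_normed_field, banach, second_countable_topology}" and k :: "'a \<Rightarrow> 'b \<Rightarrow> 'c"
  assumes M: "sigma_finite_measure M1" "sigma_finite_measure M2"
    and u: "integrable M1 u"
    and k: "(\<lambda>(x, y). k x y) \<in> borel_measurable (M1 \<Otimes>\<^sub>M M2)"
    and ik: "\<And>x. x \<in> space M1 \<Longrightarrow> integrable M2 (k x)"
    and bk: "\<And>x. x \<in> space M1 \<Longrightarrow> (\<integral>y. norm (k x y) \<partial>M2) \<le> C"
  shows "(\<integral>y. (\<integral>x. u x * k x y \<partial>M1) \<partial>M2) = (\<integral>x. u x * (\<integral>y. k x y \<partial>M2) \<partial>M1)"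
    and "integrable M2 (\<lambda>y. \<integral>x. u x * k x y \<partial>M1)"
proof -
  interpret pair_sigma_finite M1 M2 using M by (simp add: pair_sigma_finite_def)
  have um [measurable]: "u \<in> borel_measurable M1" using u by simp
  note k [measurable]
  have [measurable]: "(\<lambda>p. u (fst p) * k (fst p) (snd p)) \<in> borel_measurable (M1 \<Otimes>\<^sub>M M2)"
    using k by (intro borel_measurable_times) (auto simp: case_prod_beta)
  have m: "(\<lambda>(x, y). u x * k x y) \<in> borel_measurable (M1 \<Otimes>\<^sub>M M2)"
    by (simp add: case_prod_beta)
  have i: "integrable (M1 \<Otimes>\<^sub>M M2) (\<lambda>(x, y). u x * k x y)"
  proof (rule Fubini_integrable[OF m])
    show "integrable M1 (\<lambda>x. \<integral>y. norm (case (x, y) of (x, y) \<Rightarrow> u x * k x y) \<partial>M2)"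
    proof (rule Bochner_Integration.integrable_bound[of _ "\<lambda>x. of_real C * u x"])
      show "integrable M1 (\<lambda>x. of_real C * u x)" using u by simp
      show "(\<lambda>x. \<integral>y. norm (case (x, y) of (x, y) \<Rightarrow> u x * k x y) \<partial>M2) \<in> borel_measurable M1"
        using M by (intro sigma_finite_measure.borel_measurable_lebesgue_integral) (simp_all add: case_prod_beta)
      show "AE x in M1. norm (\<integral>y. norm (case (x, y) of (x, y) \<Rightarrow> u x * k x y) \<partial>M2) \<le> norm (of_real C * u x)"
      proof (rule AE_I2)
        fix x assume x: "x \<in> space M1"
        have "norm (u x) * (\<integral>y. norm (k x y) \<partial>M2) \<le> norm (u x) * \<bar>C\<bar>"
          using bk[OF x] by (intro mult_left_mono) auto
        then show "norm (\<integral>y. norm (case (x, y) of (x, y) \<Rightarrow> u x * k x y) \<partial>M2) \<le> norm (of_real C * u x)"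
          by (simp add: norm_mult mult.commute)
      qed
    qed
    show "AE x in M1. integrable M2 (\<lambda>y. case (x, y) of (x, y) \<Rightarrow> u x * k x y)"
      by (rule AE_I2) (simp add: ik)
  qed
  show "(\<integral>y. (\<integral>x. u x * k x y \<partial>M1) \<partial>M2) = (\<integral>x. u x * (\<integral>y. k x y \<partial>M2) \<partial>M1)"
    using Fubini_integral[OF i] by simp
  show "integrable M2 (\<lambda>y. \<integral>x. u x * k x y \<partial>M1)"
    using integrable_snd[OF i] by simp
qed

section \<open>Cauchy transforms on the right half plane\<close>

text \<open>For real u and w = y + i t the real part is the Poisson integral of u and the imaginary
  part the conjugate one, up to the usual factor 1 / pi. The half plane Re w > 0 is chosen so that
  lines of constant height y are vertical and powers use the principal branch.\<close>

definition cauchy_transform :: "(real \<Rightarrow> complex) \<Rightarrow> complex \<Rightarrow> complex" where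
  "cauchy_transform u w = (\<integral>x. u x / (w - \<i> * of_real x) \<partial>leb_I)"

lemma cauchy_kernel_bound: "0 < Re w \<Longrightarrow> Re w \<le> norm (w - \<i> * of_real x)"
  using complex_Re_le_cmod[of "w - \<i> * of_real x"] by simp

lemma cauchy_kernel_measurable: "(\<lambda>x. 1 / (w - \<i> * complex_of_real x)) \<in> borel_measurable leb_I"
  by (rule borel_measurable_leb_I) measurable

lemma cauchy_kernel_integrable:
  assumes u: "integrable leb_I u" and k: "k \<in> borel_measurable leb_I" and b: "\<And>x. norm (k x) \<le> C"
  shows "integrable leb_I (\<lambda>x. u x * k x :: complex)"
proof (rule Bochner_Integration.integrable_bound[of _ "\<lambda>x. of_real C * u x"])
  show "integrable leb_I (\<lambda>x. of_real C * u x)" using u by simp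
  show "(\<lambda>x. u x * k x) \<in> borel_measurable leb_I"
    using u k by (intro borel_measurable_times) auto
  have "0 \<le> C" using order_trans[OF norm_ge_zero b] .
  then show "AE x in leb_I. norm (u x * k x) \<le> norm (of_real C * u x)"
    using b by (intro AE_I2) (simp add: norm_mult mult.commute mult_right_mono)
qed

lemma integral_bound_kernel:
  fixes u k :: "real \<Rightarrow> complex"
  assumes u: "integrable leb_I u" and k: "k \<in> borel_measurable leb_I"
    and b: "\<And>x. x \<in> {-1<..<1} \<Longrightarrow> norm (k x) \<le> C" and C: "0 \<le> C"
  shows "norm (\<integral>x. u x * k x \<partial>leb_I) \<le> C * (\<integral>x. norm (u x) \<partial>leb_I)"
proof -
  have i1: "integrable leb_I (\<lambda>x. C * norm (u x))" using u by simp
  then have i2: "integrable leb_I (\<lambda>x. norm (u x * k x))"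
    by (intro integrable_norm, elim Bochner_Integration.integrable_bound)
       (use u k b C in \<open>auto simp: norm_mult mult.commute space_restrict_space intro!: AE_I2 mult_right_mono\<close>)
  have "norm (\<integral>x. u x * k x \<partial>leb_I) \<le> (\<integral>x. norm (u x * k x) \<partial>leb_I)"
    by (rule integral_norm_bound)
  also have "\<dots> \<le> (\<integral>x. C * norm (u x) \<partial>leb_I)"
  proof (rule integral_mono[OF i2 i1])
    show "norm (u x * k x) \<le> C * norm (u x)" if "x \<in> space leb_I" for x
      using b[of x] that by (simp add: space_restrict_space norm_mult mult.commute mult_right_mono)
  qed
  finally show ?thesis by simp
qed

text \<open>The error of the difference quotient is itself an integral against u with the kernel h /
  ((w + h - i x) (w - i x)^2), hence of order h.\<close>

lemma cauchy_transform_differentiable: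
  assumes u: "integrable leb_I u" and w: "0 < Re w"
  shows "cauchy_transform u field_differentiable at w"
proof -
  let ?y = "Re w" and ?U = "\<integral>x. norm (u x) \<partial>leb_I"
  let ?c = "\<lambda>w x. w - \<i> * complex_of_real x"
  have int1: "integrable leb_I (\<lambda>x. u x * (1 / ?c z x))" if "0 < Re z" for z
  proof (rule cauchy_kernel_integrable[OF u cauchy_kernel_measurable])
    show "norm (1 / ?c z x) \<le> 1 / Re z" for x
      using that cauchy_kernel_bound[OF that, of x] by (simp add: norm_divide frac_le)
  qed
  have m2: "(\<lambda>x. 1 / (?c w x)\<^sup>2) \<in> borel_measurable leb_I"
    by (rule borel_measurable_leb_I) measurable
  have int2: "integrable leb_I (\<lambda>x. u x * (1 / (?c w x)\<^sup>2))"
  proof (rule cauchy_kernel_integrable[OF u m2])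
    show "norm (1 / (?c w x)\<^sup>2) \<le> 1 / ?y\<^sup>2" for x
      using w cauchy_kernel_bound[OF w, of x] by (simp add: norm_divide norm_power frac_le power_mono)
  qed
  let ?D = "\<integral>x. u x * (1 / (?c w x)\<^sup>2) \<partial>leb_I"
  have est: "norm ((cauchy_transform u (w + h) - cauchy_transform u w) / h - (- ?D)) \<le> norm h * (2 / ?y ^ 3 * ?U)"
    if h: "h \<noteq> 0" "norm h < ?y / 2" for h
  proof -
    \<comment> \<open>The restriction on h keeps w + h at distance y / 2 from the boundary; this is
      the origin of the factor 2 in the estimate.\<close>
    have re: "?y / 2 < Re (w + h)" using h complex_Re_le_cmod[of "-h"] by simp
    then have re0: "0 < Re (w + h)" using w by linarith
    let ?k = "\<lambda>x. h / (?c (w + h) x * (?c w x)\<^sup>2)"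
    have ptw: "(u x * (1 / ?c (w + h) x) - u x * (1 / ?c w x)) / h + u x * (1 / (?c w x)\<^sup>2) = u x * ?k x" for x
    proof -
      define a where "a = ?c w x"
      have a: "?c (w + h) x = a + h" by (simp add: a_def)
      have "a + h \<noteq> 0" using cauchy_kernel_bound[OF re0, of x] re0 a by auto
      moreover have "a \<noteq> 0" using cauchy_kernel_bound[OF w, of x] w by (auto simp: a_def)
      ultimately have "(1 / (a + h) - 1 / a) / h + 1 / a\<^sup>2 = h / ((a + h) * a\<^sup>2)"
        using h(1) by (simp add: divide_simps power2_eq_square)
      from arg_cong[OF this, of "\<lambda>z. u x * z"]
      have "u x * ((1 / (a + h) - 1 / a) / h + 1 / a\<^sup>2) = u x * (h / ((a + h) * a\<^sup>2))" .
      moreover have "u x * ((1 / (a + h) - 1 / a) / h + 1 / a\<^sup>2)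
          = (u x * (1 / (a + h)) - u x * (1 / a)) / h + u x * (1 / a\<^sup>2)"
        by (simp add: ring_distribs diff_divide_distrib)
      ultimately show ?thesis unfolding a a_def[symmetric] by (simp only:)
    qed
    have "(cauchy_transform u (w + h) - cauchy_transform u w) / h - (- ?D)
        = (\<integral>x. (u x * (1 / ?c (w + h) x) - u x * (1 / ?c w x)) / h + u x * (1 / (?c w x)\<^sup>2) \<partial>leb_I)"
      using int1[OF re0] int1[OF w] int2
      by (simp add: cauchy_transform_def)
    also have "\<dots> = (\<integral>x. u x * ?k x \<partial>leb_I)" by (simp only: ptw)
    also have "norm \<dots> \<le> (norm h * (2 / ?y ^ 3)) * ?U"
    proof (rule integral_bound_kernel[OF u])
      show "?k \<in> borel_measurable leb_I" by (rule borel_measurable_leb_I) measurable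
      show "0 \<le> norm h * (2 / ?y ^ 3)" using w by simp
      show "norm (?k x) \<le> norm h * (2 / ?y ^ 3)" for x
      proof -
        have "(?y / 2) * ?y\<^sup>2 \<le> norm (?c (w + h) x) * (norm (?c w x))\<^sup>2"
          using w re cauchy_kernel_bound[OF re0, of x] cauchy_kernel_bound[OF w, of x]
          by (intro mult_mono power_mono) auto
        then have "norm h / (norm (?c (w + h) x) * (norm (?c w x))\<^sup>2) \<le> norm h / ((?y / 2) * ?y\<^sup>2)"
          using w by (intro frac_le) auto
        also have "\<dots> = norm h * (2 / ?y ^ 3)" by (simp add: power2_eq_square power3_eq_cube)
        finally show ?thesis by (simp add: norm_divide norm_mult norm_power)
      qed
    qed
    finally show ?thesis by (simp add: mult.assoc)
  qed
  have "((\<lambda>h. (cauchy_transform u (w + h) - cauchy_transform u w) / h - (- ?D)) \<longlongrightarrow> 0) (at 0)"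
  proof (rule Lim_null_comparison)
    have "\<forall>\<^sub>F h in at 0. h \<noteq> 0 \<and> norm h < ?y / 2"
      using w by (auto simp: eventually_at intro!: exI[of _ "?y/2"])
    then show "\<forall>\<^sub>F h in at 0. norm ((cauchy_transform u (w + h) - cauchy_transform u w) / h - (- ?D)) \<le> norm h * (2 / ?y ^ 3 * ?U)"
      by (rule eventually_mono) (use est in blast)
    show "((\<lambda>h. norm h * (2 / ?y ^ 3 * ?U)) \<longlongrightarrow> 0) (at (0::complex))"
      using tendsto_mult_left_zero[OF tendsto_norm_zero[OF tendsto_ident_at]] .
  qed
  then have "(cauchy_transform u has_field_derivative (- ?D)) (at w)"
    unfolding DERIV_def by (rule LIM_zero_cancel)
  then show ?thesis unfolding field_differentiable_def by blast
qed

text \<open>The second bound uses |w - i x| \<ge> |w| / 2 for |x| < 1 \<le> |w| / 2. The decay makes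
  the q-th power of the transform O(n^(-q)) on contours of length O(n).\<close>

lemma cauchy_transform_bounds:
  assumes u: "integrable leb_I u"
  shows "0 < Re w \<Longrightarrow> norm (cauchy_transform u w) \<le> 1 / Re w * (\<integral>x. norm (u x) \<partial>leb_I)"
    and "2 \<le> norm w \<Longrightarrow> norm (cauchy_transform u w) \<le> 2 / norm w * (\<integral>x. norm (u x) \<partial>leb_I)"
proof -
  have eq: "cauchy_transform u w = (\<integral>x. u x * (1 / (w - \<i> * of_real x)) \<partial>leb_I)"
    by (simp add: cauchy_transform_def)
  show "norm (cauchy_transform u w) \<le> 1 / Re w * (\<integral>x. norm (u x) \<partial>leb_I)" if w: "0 < Re w"
    unfolding eq
    using w cauchy_kernel_bound[OF w]
    by (intro integral_bound_kernel[OF u cauchy_kernel_measurable]) (auto simp: norm_divide frac_le)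
  show "norm (cauchy_transform u w) \<le> 2 / norm w * (\<integral>x. norm (u x) \<partial>leb_I)" if w: "2 \<le> norm w"
    unfolding eq
  proof (rule integral_bound_kernel[OF u cauchy_kernel_measurable])
    fix x :: real assume "x \<in> {-1<..<1}"
    then have "norm (\<i> * complex_of_real x) \<le> 1" by (auto simp: norm_mult)
    then have "norm w / 2 \<le> norm (w - \<i> * of_real x)"
      using norm_triangle_ineq2[of w "\<i> * of_real x"] w by linarith
    then have "1 / norm (w - \<i> * of_real x) \<le> 1 / (norm w / 2)"
      using w by (intro frac_le) auto
    then show "norm (1 / (w - \<i> * of_real x)) \<le> 2 / norm w" by (simp add: norm_divide)
  qed simp
qed

text \<open>The inequality behind Riesz's proof. Put z = |z| e^(i s) with |s| < pi / 2. Away from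
  the imaginary axis Re z is comparable to |z|. Near the axis q |s| lies between pi / 2 and pi, so
  that Re (z^q) = |z|^q cos (q s) is negative and controls |z|^q.\<close>

lemma powr_cos_inequality:
  fixes q :: real
  assumes q: "1 < q" "q < 2"
  obtains A B where "0 \<le> A" "0 \<le> B"
    "\<And>z. 0 < Re z \<Longrightarrow> norm z powr q \<le> A * Re z powr q - B * Re (z powr of_real q)"
proof -
  \<comment> \<open>The midpoint of pi / (2 q) and pi / 2, so that q a lies strictly between pi / 2
    and pi. B is then normalised by -B cos (q a) = 1, and A makes up for the loss of at most B where
    |s| < a.\<close>
  define a where "a = (pi / (2 * q) + pi / 2) / 2"
  have a: "pi / (2 * q) < a" "a < pi / 2" "0 < a" using q pi_gt_zero
    by (auto simp: a_def field_simps intro: add_pos_pos)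
  have qa: "pi / 2 < q * a" "q * a < pi"
  proof -
    show "pi / 2 < q * a" using a(1) q by (simp add: field_simps)
    have "q * a < q * (pi / 2)" using a(2) q by simp
    also have "\<dots> \<le> pi" using q by simp
    finally show "q * a < pi" .
  qed
  define B where "B = 1 / (- cos (q * a))"
  have cneg: "cos (q * a) < 0"
  proof -
    have "cos (q * a) < cos (pi / 2)" using qa by (intro cos_monotone_0_pi) auto
    then show ?thesis by simp
  qed
  have B: "0 < B" using cneg by (simp add: B_def)
  have ca: "0 < cos a" using a by (intro cos_gt_zero) auto
  define A where "A = (1 + B) / cos a powr q"
  have A: "0 < A" using B ca by (simp add: A_def)
  have main: "1 \<le> A * cos s powr q - B * cos (q * s)" if s: "0 \<le> s" "s < pi / 2" for s
  proof (cases "a \<le> s")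
    case True
    have "q * s \<le> q * (pi / 2)" using s q by simp
    also have "\<dots> \<le> pi" using q by simp
    finally have "cos (q * s) \<le> cos (q * a)"
      using True q a by (intro cos_monotone_0_pi_le) auto
    then have "B * cos (q * s) \<le> B * cos (q * a)" using B by simp
    also have "\<dots> = -1" using cneg by (simp add: B_def)
    finally have "B * cos (q * s) \<le> -1" .
    moreover have "0 \<le> A * cos s powr q" using A by simp
    ultimately show ?thesis by linarith
  next
    case False
    then have "cos a \<le> cos s" using s a by (intro cos_monotone_0_pi_le) auto
    then have "cos a powr q \<le> cos s powr q" using ca q by (intro powr_mono2) auto
    then have "A * cos a powr q \<le> A * cos s powr q" using A by simp
    moreover have "A * cos a powr q = 1 + B" using ca by (simp add: A_def)
    moreover have "B * cos (q * s) \<le> B" using B by simp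
    ultimately show ?thesis by linarith
  qed
  have "norm z powr q \<le> A * Re z powr q - B * Re (z powr of_real q)" if z: "0 < Re z" for z
  proof -
    have nz: "z \<noteq> 0" using z by auto
    define s where "s = \<bar>Im (Ln z)\<bar>"
    have s: "0 \<le> s" "s < pi / 2" using Re_Ln_pos_lt[OF nz] z by (auto simp: s_def)
    have "z = of_real (norm z) * exp (\<i> * of_real (Im (Ln z)))"
      using nz by (metis Arg_eq Arg_eq_Im_Ln)
    from arg_cong[OF this, of Re] have re: "Re z = norm z * cos s"
      by (simp add: Re_exp s_def)
    have "Re (z powr of_real q) = norm z powr q * cos (q * s)"
    proof -
      have "Re (z powr of_real q) = exp (q * ln (norm z)) * cos (q * Im (Ln z))"
        using nz by (simp add: powr_def Re_exp)
      also have "cos (q * Im (Ln z)) = cos (q * s)"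
        using q by (metis abs_mult abs_of_pos cos_abs_real less_trans s_def zero_less_one)
      finally show ?thesis using nz by (simp add: powr_def)
    qed
    moreover have "Re z powr q = norm z powr q * cos s powr q"
      unfolding re using s by (intro powr_mult)
    ultimately have "A * Re z powr q - B * Re (z powr of_real q) = norm z powr q * (A * cos s powr q - B * cos (q * s))"
      by (simp add: algebra_simps)
    moreover have "norm z powr q * 1 \<le> norm z powr q * (A * cos s powr q - B * cos (q * s))"
      by (intro mult_left_mono main s) auto
    ultimately show ?thesis by simp
  qed
  then show thesis using that[of A B] A B by simp
qed

lemma poisson_kernel_integral_le:
  fixes x y :: real
  assumes "0 < y" "a \<le> b"
  shows "(\<lambda>s. y / (y\<^sup>2 + (s - x)\<^sup>2)) absolutely_integrable_on {a..b}"
    and "integral {a..b} (\<lambda>s. y / (y\<^sup>2 + (s - x)\<^sup>2)) \<le> pi"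
proof -
  have "((\<lambda>s. y / (y\<^sup>2 + (s - x)\<^sup>2)) has_integral (arctan ((b - x) / y) - arctan ((a - x) / y))) {a..b}"
  proof (rule fundamental_theorem_of_calculus[OF assms(2)])
    fix s
    have p: "0 < y\<^sup>2 + (s - x)\<^sup>2" using assms(1) by (simp add: add_pos_nonneg)
    have "((\<lambda>s. arctan ((s - x) / y)) has_real_derivative inverse (1 + ((s - x) / y)\<^sup>2) * (1 / y)) (at s within {a..b})"
      using assms(1) by (auto intro!: derivative_eq_intros)
    moreover have "inverse (1 + ((s - x) / y)\<^sup>2) * (1 / y) = y / (y\<^sup>2 + (s - x)\<^sup>2)"
      using assms(1) p by (simp add: power_divide divide_simps power2_eq_square)
    ultimately show "((\<lambda>s. arctan ((s - x) / y)) has_vector_derivative y / (y\<^sup>2 + (s - x)\<^sup>2)) (at s within {a..b})"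
      by (simp add: has_real_derivative_iff_has_vector_derivative)
  qed
  then have i: "(\<lambda>s. y / (y\<^sup>2 + (s - x)\<^sup>2)) integrable_on {a..b}"
    and I: "integral {a..b} (\<lambda>s. y / (y\<^sup>2 + (s - x)\<^sup>2)) = arctan ((b - x) / y) - arctan ((a - x) / y)"
    by (auto simp: has_integral_iff)
  show "(\<lambda>s. y / (y\<^sup>2 + (s - x)\<^sup>2)) absolutely_integrable_on {a..b}"
    by (rule nonnegative_absolutely_integrable_1[OF i]) (use assms in simp)
  show "integral {a..b} (\<lambda>s. y / (y\<^sup>2 + (s - x)\<^sup>2)) \<le> pi"
    unfolding I using arctan_lbound[of "(a-x)/y"] arctan_ubound[of "(b-x)/y"] by linarith
qed

lemma norm_powr_of_real: "z \<noteq> 0 \<Longrightarrow> norm (z powr of_real q) = norm z powr q" for z :: complex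
  by (simp add: powr_def)

text \<open>The tangent form of Jensen's inequality, suited to a kernel whose mass is only bounded
  from above.\<close>

lemma powr_above_tangent:
  fixes q c x :: real
  assumes q: "1 < q" and c: "0 < c" and x: "0 \<le> x"
  shows "c powr q + q * c powr (q - 1) * (x - c) \<le> x powr q"
proof (cases "x = 0")
  case True
  have "c powr (q - 1) * c = c powr q" using c by (simp add: powr_diff)
  then have "c powr q + q * c powr (q - 1) * (x - c) = (1 - q) * c powr q" using True by (simp add: algebra_simps)
  also have "\<dots> \<le> 0" using q by (intro mult_nonpos_nonneg) auto
  finally show ?thesis using True by simp
next
  case False
  have "x powr q - c powr q \<ge> (q * c powr (q - 1)) * (x - c)"
  proof (rule convex_on_imp_above_tangent[where A="{0<..}"])
    show "convex_on {0<..} (\<lambda>x. x powr q)" using q by (intro powr_convex) auto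
    show "((\<lambda>x. x powr q) has_real_derivative q * c powr (q - 1)) (at c within {0<..})"
      using c by (auto intro!: derivative_eq_intros)
  qed (use c x False in \<open>auto simp: interior_open\<close>)
  then show ?thesis by simp
qed

lemma Re_Im_cauchy_kernel:
  "Re (1 / (Complex y t - \<i> * of_real x)) = y / (y\<^sup>2 + (t - x)\<^sup>2)"
  "Im (1 / (Complex y t - \<i> * of_real x)) = (x - t) / ((x - t)\<^sup>2 + y\<^sup>2)"
  by (simp_all add: Re_divide Im_divide power2_eq_square algebra_simps)

text \<open>Since u \<ge> 0, the transform F has positive real part and F^q is holomorphic.
  Integrated along a vertical line, \<open>powr_cos_inequality\<close> bounds the integral of |F|^q
  by that of (Re F)^q, because the integral of F^q vanishes when the line is pushed to infinity. The
  remaining Poisson integral is handled by Jensen's inequality, with a bound that does not depend on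
  y.\<close>

lemma riesz_bound_nonneg:
  fixes u :: "real \<Rightarrow> real" and q :: real
  assumes q: "1 < q" "q < 2" and u0: "\<And>x. 0 \<le> u x" and iu: "integrable leb_I u"
    and iq: "integrable leb_I (\<lambda>x. u x powr q)"
  obtains C where "\<And>y. 0 < y \<Longrightarrow> integral {-1..1} (\<lambda>t. norm (cauchy_transform (\<lambda>x. of_real (u x)) (Complex y t)) powr q) \<le> C"
proof -
  define F where "F = cauchy_transform (\<lambda>x. of_real (u x))"
  define U where "U = (\<integral>x. u x \<partial>leb_I)"
  have iuc: "integrable leb_I (\<lambda>x. complex_of_real (u x))" using iu by simp
  have Uc: "(\<integral>x. norm (complex_of_real (u x)) \<partial>leb_I) = U" using u0 by (simp add: U_def)
  have U0: "0 \<le> U" unfolding U_def using u0 by simp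
  have F1: "norm (F w) \<le> 1 / Re w * U" if "0 < Re w" for w
    using cauchy_transform_bounds(1)[OF iuc that] Uc by (simp add: F_def)
  have F2: "norm (F w) \<le> 2 / norm w * U" if "2 \<le> norm w" for w
    using cauchy_transform_bounds(2)[OF iuc that] Uc by (simp add: F_def)
  show thesis
  proof (cases "U = 0")
    \<comment> \<open>Here F is 0 and Re F is not positive, so the complex power is avoided.\<close>
    case True
    have "integral {-1..1} (\<lambda>t. norm (F (Complex y t)) powr q) \<le> 0" if "0 < y" for y
    proof -
      have "F (Complex y t) = 0" for t using F1[of "Complex y t"] that True by simp
      then show ?thesis by simp
    qed
    then show thesis using that[of 0] by (simp add: F_def)
  next
    case False
    then have Upos: "0 < U" using U0 by simp
    let ?H = "{w. 0 < Re w}"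
    have holF: "F holomorphic_on ?H"
      using cauchy_transform_differentiable[OF iuc]
      by (auto simp: holomorphic_on_def F_def intro: field_differentiable_at_within)
    have openH: "open ?H" by (simp add: open_halfspace_Re_gt)
    have Reint: "integrable leb_I (\<lambda>x. u x * (y / (y\<^sup>2 + (t - x)\<^sup>2)))"
      and ReF: "Re (F (Complex y t)) = (\<integral>x. u x * (y / (y\<^sup>2 + (t - x)\<^sup>2)) \<partial>leb_I)" if y: "0 < y" for y t
    proof -
      have i: "integrable leb_I (\<lambda>x. complex_of_real (u x) * (1 / (Complex y t - \<i> * of_real x)))"
      proof (rule cauchy_kernel_integrable[OF iuc cauchy_kernel_measurable])
        show "norm (1 / (Complex y t - \<i> * of_real x)) \<le> 1 / y" for x
          using y cauchy_kernel_bound[of "Complex y t" x] by (simp add: norm_divide frac_le)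
      qed
      have re: "Re (complex_of_real (u x) * (1 / (Complex y t - \<i> * of_real x))) = u x * (y / (y\<^sup>2 + (t - x)\<^sup>2))" for x
        unfolding Re_Im_cauchy_kernel[symmetric] by (simp add: Re_divide)
      show "integrable leb_I (\<lambda>x. u x * (y / (y\<^sup>2 + (t - x)\<^sup>2)))"
        using integrable_Re[OF i] unfolding re .
      show "Re (F (Complex y t)) = (\<integral>x. u x * (y / (y\<^sup>2 + (t - x)\<^sup>2)) \<partial>leb_I)"
        using integral_Re[OF i] unfolding re by (simp add: F_def cauchy_transform_def)
    qed
    have RePos: "0 < Re (F w)" if w: "0 < Re w" for w
    proof -
      define y where "y = Re w" define t where "t = Im w"
      have wc: "w = Complex y t" by (simp add: y_def t_def)
      have y: "0 < y" using w by (simp add: y_def)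
      let ?c = "y / (y\<^sup>2 + (\<bar>t\<bar> + 1)\<^sup>2)"
      have "0 < ?c * U" using y Upos by (intro mult_pos_pos divide_pos_pos) (auto intro: add_pos_nonneg)
      also have "?c * U = (\<integral>x. u x * ?c \<partial>leb_I)" by (simp add: U_def)
      also have "\<dots> \<le> (\<integral>x. u x * (y / (y\<^sup>2 + (t - x)\<^sup>2)) \<partial>leb_I)"
      proof (rule integral_mono[OF _ Reint[OF y]])
        show "integrable leb_I (\<lambda>x. u x * ?c)" using iu by simp
        fix x assume "x \<in> space leb_I"
        then have "\<bar>t - x\<bar> \<le> \<bar>t\<bar> + 1" by (auto simp: space_restrict_space)
        then have "(t - x)\<^sup>2 \<le> (\<bar>t\<bar> + 1)\<^sup>2" by (metis abs_ge_zero power2_abs power_mono)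
        then show "u x * ?c \<le> u x * (y / (y\<^sup>2 + (t - x)\<^sup>2))"
          using y u0[of x] by (intro mult_left_mono divide_left_mono mult_pos_pos) (auto intro: add_pos_nonneg)
      qed
      finally show ?thesis using ReF[OF y, of t] wc by simp
    qed
    have nonR: "F w \<notin> \<real>\<^sub>\<le>\<^sub>0" if "0 < Re w" for w
      using RePos[OF that] by (auto simp: complex_nonpos_Reals_iff)
    have Fnz: "F w \<noteq> 0" if "0 < Re w" for w using RePos[OF that] by auto
    have holq: "(\<lambda>w. F w powr of_real q) holomorphic_on ?H"
      using nonR by (intro holomorphic_intros holF) auto
    obtain A B where A: "0 \<le> A" and B: "0 \<le> B"
      and AB: "\<And>z. 0 < Re z \<Longrightarrow> norm z powr q \<le> A * Re z powr q - B * Re (z powr of_real q)"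
      using powr_cos_inequality[OF q] by blast
    define Q where "Q = (\<integral>x. u x powr q \<partial>leb_I)"
    \<comment> \<open>The factor pi^(q - 1) comes from Jensen's inequality against a kernel of mass
      at most pi, the factor pi Q from integrating the same kernel over t.\<close>
    let ?C = "pi powr (q - 1) * (pi * Q)"
    have bound: "integral {-1..1} (\<lambda>t. norm (F (Complex y t)) powr q) \<le> A * ?C" if y: "0 < y" for y
    proof -
      let ?G = "\<lambda>t. F (Complex y t)"
      have contC: "continuous_on S (\<lambda>t. Complex a t)" for S a
        by (simp add: Complex_eq) (intro continuous_intros)
      have contG: "continuous_on S ?G" for S
        by (rule continuous_on_compose2[OF holomorphic_on_imp_continuous_on[OF holF] contC]) (use y in auto)
      have cont_a: "continuous_on S (\<lambda>t. norm (?G t) powr q)" for S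
        using Fnz y by (intro continuous_intros contG) auto
      have cont_b: "continuous_on S (\<lambda>t. Re (?G t) powr q)" for S
        using RePos[of "Complex y _"] y by (intro continuous_intros contG) (auto simp: less_imp_neq[symmetric])
      have cont_c: "continuous_on S (\<lambda>t. ?G t powr of_real q)" for S
        by (rule continuous_on_compose2[OF holomorphic_on_imp_continuous_on[OF holq] contC]) (use y in auto)
      \<comment> \<open>The rectangle [y, y + n] x [-n, n]: on its horizontal sides and on its far
        side |F|^q is at most (2 U / n)^q. These sides contribute at most 4 n times this bound,
        which tends to 0 since q > 1.\<close>
      have est: "integral {-1..1} (\<lambda>t. norm (?G t) powr q) \<le> A * ?C + B * (4 * (2 * U) powr q * real n powr (1 - q))"
        if n: "2 \<le> n" for n :: nat
      proof -
        let ?N = "real n"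
        have N: "2 \<le> ?N" using n by simp
        let ?b = "(2 / ?N * U) powr q"
        have small: "norm (F w powr of_real q) \<le> ?b" if "0 < Re w" "?N \<le> norm w" for w
        proof -
          have "norm (F w) \<le> 2 / norm w * U" using that N by (intro F2) auto
          also have "\<dots> \<le> 2 / ?N * U" using that N U0 by (intro mult_right_mono frac_le) auto
          finally show ?thesis using Fnz[OF that(1)] q by (simp add: norm_powr_of_real powr_mono2)
        qed
        have d: "norm (integral {-?N..?N} (\<lambda>t. F (Complex y t) powr of_real q)
             - integral {-?N..?N} (\<lambda>t. F (Complex (y + ?N) t) powr of_real q)) \<le> 2 * ((y + ?N) - y) * ?b"
        proof (rule vertical_integrals_diff_bound)
          show "continuous_on {z. y \<le> Re z \<and> Re z \<le> y + ?N \<and> \<bar>Im z\<bar> \<le> ?N} (\<lambda>w. F w powr of_real q)"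
            by (rule continuous_on_subset[OF holomorphic_on_imp_continuous_on[OF holq]]) (use y in auto)
          show "(\<lambda>w. F w powr of_real q) field_differentiable at z" if "y < Re z" for z
            using holomorphic_on_imp_differentiable_at[OF holq openH] that y by auto
          show "norm (F z powr of_real q) \<le> ?b" if "y \<le> Re z" "\<bar>Im z\<bar> = ?N" for z
            using small[of z] that y abs_Im_le_cmod[of z] by auto
        qed (use N in auto)
        have far: "norm (integral {-?N..?N} (\<lambda>t. F (Complex (y + ?N) t) powr of_real q)) \<le> ?b * (?N - (- ?N))"
        proof (rule integral_bound)
          show "continuous_on {-?N..?N} (\<lambda>t. F (Complex (y + ?N) t) powr of_real q)"
            by (rule continuous_on_compose2[OF holomorphic_on_imp_continuous_on[OF holq] contC]) (use y N in auto)
          show "norm (F (Complex (y + ?N) t) powr of_real q) \<le> ?b" for t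
            using small[of "Complex (y + ?N) t"] y N abs_Re_le_cmod[of "Complex (y + ?N) t"] by auto
        qed (use N in auto)
        have "norm (integral {-?N..?N} (\<lambda>t. ?G t powr of_real q)) \<le> 2 * ?N * ?b + ?b * (2 * ?N)"
          using norm_triangle_mono[OF d far] by (simp add: norm_triangle_sub algebra_simps)
        also have "\<dots> = 4 * (2 * U) powr q * (?N / ?N powr q)"
          using N U0 by (simp add: powr_divide powr_mult)
        also have "?N / ?N powr q = ?N powr (1 - q)" using N by (simp add: powr_diff)
        finally have Ic: "norm (integral {-?N..?N} (\<lambda>t. ?G t powr of_real q)) \<le> 4 * (2 * U) powr q * ?N powr (1 - q)" .
        define p where "p = (\<lambda>x t. y / (y\<^sup>2 + (t - x)\<^sup>2))"
        have Reint': "integrable leb_I (\<lambda>x. u x * p x t)" and ReF': "Re (?G t) = (\<integral>x. u x * p x t \<partial>leb_I)" for t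
          unfolding p_def by (rule Reint[OF y], rule ReF[OF y])
        have pm: "(\<lambda>x. p x t) \<in> borel_measurable leb_I" for t
          unfolding p_def by (rule borel_measurable_leb_I) measurable
        have pabs: "p x absolutely_integrable_on {a..b}" "integral {a..b} (p x) \<le> pi" if "a \<le> b" for a b x
          unfolding p_def using poisson_kernel_integral_le[OF y that] by auto
        have psym: "p x t = p t x" for x t by (simp add: p_def power2_commute)
        have p0: "0 \<le> p x t" for x t using y by (simp add: p_def)
        have pb: "p x t \<le> 1 / y" for x t
        proof -
          have "y / (y\<^sup>2 + (t - x)\<^sup>2) \<le> y / y\<^sup>2" using y by (intro divide_left_mono mult_pos_pos) (auto intro: add_pos_nonneg)
          then show ?thesis using y by (simp add: p_def power2_eq_square)
        qed
        have ptw: "Re (?G t) powr q \<le> pi powr (q - 1) * (\<integral>x. u x powr q * p x t \<partial>leb_I)" for t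
        proof -
          define c where "c = Re (?G t) / pi"
          have c: "0 < c" using RePos[of "Complex y t"] y by (simp add: c_def)
          have ip: "integrable leb_I (\<lambda>x. p x t)"
            by (rule leb_I.integrable_const_bound[where B="1/y"])
               (use p0 pb pm in auto)
          have mp: "(\<lambda>x. p x t) \<in> borel_measurable leb_I" using ip by simp
          have iqp: "integrable leb_I (\<lambda>x. u x powr q * p x t)"
          proof (rule Bochner_Integration.integrable_bound[OF integrable_mult_right[OF iq, of "1/y"]])
            show "(\<lambda>x. u x powr q * p x t) \<in> borel_measurable leb_I"
              using iq mp by (intro borel_measurable_times) auto
            have "norm (u x powr q * p x t) \<le> norm (1 / y * u x powr q)" for x
              using mult_right_mono[OF pb[of x t], of "u x powr q"] p0[of x t] y
              by (simp add: abs_mult mult.commute)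
            then show "AE x in leb_I. norm (u x powr q * p x t) \<le> norm (1 / y * u x powr q)" by simp
          qed
          have kap: "(\<integral>x. p x t \<partial>leb_I) \<le> pi"
            using pabs[of "-1" 1 t] integral_leb_I_eq_HK(2)[of "p t"] by (simp add: psym[of _ t])
          \<comment> \<open>The mass of the kernel enters with the negative coefficient -(q - 1)
            c^q, so the upper bound pi for the mass yields a lower bound.\<close>
          have "pi * c powr q \<le> q * pi * c powr q - (q - 1) * c powr q * (\<integral>x. p x t \<partial>leb_I)"
          proof -
            have "0 \<le> (q - 1) * c powr q" using q by simp
            from mult_left_mono[OF kap this] show ?thesis by (simp add: algebra_simps)
          qed
          also have "\<dots> = (\<integral>x. (c powr q + q * c powr (q - 1) * (u x - c)) * p x t \<partial>leb_I)"
          proof -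
            have cc: "c powr (q - 1) * c = c powr q" using c by (simp add: powr_diff)
            have "(c powr q + q * c powr (q - 1) * (u x - c)) * p x t
               = q * c powr (q - 1) * (u x * p x t) - (q - 1) * c powr q * p x t" for x
              unfolding cc[symmetric] by (simp add: algebra_simps)
            then have "(\<integral>x. (c powr q + q * c powr (q - 1) * (u x - c)) * p x t \<partial>leb_I)
               = (\<integral>x. q * c powr (q - 1) * (u x * p x t) - (q - 1) * c powr q * p x t \<partial>leb_I)" by (simp only:)
            also have "\<dots> = q * c powr (q - 1) * (\<integral>x. u x * p x t \<partial>leb_I) - (q - 1) * c powr q * (\<integral>x. p x t \<partial>leb_I)"
              by (subst Bochner_Integration.integral_diff)
                 (intro integrable_mult_right Reint' ip, intro integrable_mult_right ip, simp only: integral_mult_right_zero)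
            also have "(\<integral>x. u x * p x t \<partial>leb_I) = pi * c" using ReF'[of t] by (simp add: c_def)
            also have "q * c powr (q - 1) * (pi * c) = q * pi * c powr q" unfolding cc[symmetric] by simp
            finally show ?thesis ..
          qed
          also have "\<dots> \<le> (\<integral>x. u x powr q * p x t \<partial>leb_I)"
          proof (rule integral_mono[OF _ iqp])
            have "integrable leb_I (\<lambda>x. (c powr q - q * c powr (q - 1) * c) * p x t + q * c powr (q - 1) * (u x * p x t))"
              by (intro Bochner_Integration.integrable_add integrable_mult_right Reint' ip)
            then show "integrable leb_I (\<lambda>x. (c powr q + q * c powr (q - 1) * (u x - c)) * p x t)"
              by (simp add: algebra_simps)
            show "(c powr q + q * c powr (q - 1) * (u x - c)) * p x t \<le> u x powr q * p x t" for x
              by (rule mult_right_mono[OF powr_above_tangent[OF q(1) c u0] p0])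
          qed
          finally have "pi * c powr q \<le> (\<integral>x. u x powr q * p x t \<partial>leb_I)" .
          then have "pi powr (q - 1) * (pi * c powr q) \<le> pi powr (q - 1) * (\<integral>x. u x powr q * p x t \<partial>leb_I)"
            by (intro mult_left_mono) auto
          moreover have "pi powr (q - 1) * (pi * c powr q) = Re (?G t) powr q"
          proof -
            have "pi powr (q - 1) * pi = pi powr q" by (simp add: powr_diff)
            moreover have "pi powr q * c powr q = (pi * c) powr q" by (simp add: powr_mult)
            ultimately show ?thesis by (simp add: c_def mult.assoc[symmetric])
          qed
          ultimately show ?thesis by simp
        qed
        let ?M = "lebesgue_on {-?N..?N}"
        have fin: "finite_measure ?M"
          by (rule finite_measureI) (simp add: space_restrict_space emeasure_restrict_space)
        have mI: "(\<lambda>x. x) \<in> borel_measurable ?M"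
          using id_borel_measurable_lebesgue_on[of "{-?N..?N}"] by (simp add: id_def)
        have pint: "integrable ?M (p x)" and pI: "(\<integral>t. p x t \<partial>?M) \<le> pi" for x
        proof -
          have a: "p x absolutely_integrable_on {-?N..?N}"
            using pabs(1)[of "-?N" ?N x] N by simp
          then show "integrable ?M (p x)"
            by (subst integrable_restrict_space) (auto simp: set_integrable_def)
          have "(\<integral>t. p x t \<partial>?M) = integral {-?N..?N} (p x)"
            using set_lebesgue_integral_eq_integral(2)[OF a]
            by (simp add: integral_restrict_space set_lebesgue_integral_def)
          then show "(\<integral>t. p x t \<partial>?M) \<le> pi" using pabs(2)[of "-?N" ?N x] N by simp
        qed
        have S1: "sigma_finite_measure leb_I" by (rule leb_I.sigma_finite_measure_axioms)
        have S2: "sigma_finite_measure ?M" using fin by (rule finite_measure.axioms)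
        have m1: "(\<lambda>z. fst z) \<in> borel_measurable (leb_I \<Otimes>\<^sub>M ?M)"
          using measurable_compose[OF measurable_fst ident_measurable_leb_I] .
        have m2: "(\<lambda>z. snd z) \<in> borel_measurable (leb_I \<Otimes>\<^sub>M ?M)"
          using measurable_compose[OF measurable_snd mI] .
        have pm2: "(\<lambda>(x, t). p x t) \<in> borel_measurable (leb_I \<Otimes>\<^sub>M ?M)"
          using m1 m2 unfolding case_prod_beta p_def by measurable
        have pnorm: "(\<integral>t. norm (p x t) \<partial>?M) \<le> pi" for x using pI[of x] p0[of x] by simp
        note Fub = Fubini_kernel[OF S1 S2 iq pm2 pint pnorm]
        have "integral {-?N..?N} (\<lambda>t. Re (?G t) powr q) \<le> pi powr (q - 1) * (pi * Q)"
        proof -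
          have a: "(\<lambda>t. Re (?G t) powr q) absolutely_integrable_on {-?N..?N}"
            by (rule absolutely_integrable_continuous_real[OF cont_b])
          then have ai: "integrable ?M (\<lambda>t. Re (?G t) powr q)"
            by (subst integrable_restrict_space) (auto simp: set_integrable_def)
          have "integral {-?N..?N} (\<lambda>t. Re (?G t) powr q) = (\<integral>t. Re (?G t) powr q \<partial>?M)"
            using set_lebesgue_integral_eq_integral(2)[OF a]
            by (simp add: integral_restrict_space set_lebesgue_integral_def)
          also have "\<dots> \<le> (\<integral>t. pi powr (q - 1) * (\<integral>x. u x powr q * p x t \<partial>leb_I) \<partial>?M)"
            by (rule integral_mono[OF ai]) (use Fub(2) ptw in auto)
          also have "\<dots> = pi powr (q - 1) * (\<integral>x. u x powr q * (\<integral>t. p x t \<partial>?M) \<partial>leb_I)"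
            by (simp only: integral_mult_right_zero Fub(1))
          also have "(\<integral>x. u x powr q * (\<integral>t. p x t \<partial>?M) \<partial>leb_I) \<le> (\<integral>x. u x powr q * pi \<partial>leb_I)"
          proof (rule integral_mono')
            show "integrable leb_I (\<lambda>x. u x powr q * pi)" using iq by simp
          qed (use pI in \<open>auto intro!: mult_left_mono\<close>)
          finally show ?thesis by (simp add: Q_def mult.commute)
        qed
        note Re_bound = this
        have "integral {-1..1} (\<lambda>t. norm (?G t) powr q) \<le> integral {-?N..?N} (\<lambda>t. norm (?G t) powr q)"
          using N by (intro integral_subset_le integrable_continuous_interval cont_a) auto
        also have "\<dots> \<le> integral {-?N..?N} (\<lambda>t. A * Re (?G t) powr q - B * Re (?G t powr of_real q))"
          by (intro integral_le integrable_continuous_interval cont_a continuous_intros cont_b cont_c AB RePos)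
             (use y in auto)
        also have "\<dots> = A * integral {-?N..?N} (\<lambda>t. Re (?G t) powr q) - B * integral {-?N..?N} (\<lambda>t. Re (?G t powr of_real q))"
          by (subst integral_diff)
             (intro integrable_continuous_interval continuous_intros cont_b, intro integrable_continuous_interval continuous_intros cont_c,
              simp only: integral_mult_right)
        also have "integral {-?N..?N} (\<lambda>t. Re (?G t powr of_real q)) = Re (integral {-?N..?N} (\<lambda>t. ?G t powr of_real q))"
          by (rule integral_linear[OF integrable_continuous_interval[OF cont_c] bounded_linear_Re, unfolded o_def])
        also have "A * integral {-?N..?N} (\<lambda>t. Re (?G t) powr q) - B * \<dots> \<le> A * ?C + B * (4 * (2 * U) powr q * ?N powr (1 - q))"
        proof -
          have "A * integral {-?N..?N} (\<lambda>t. Re (?G t) powr q) \<le> A * ?C" using A Re_bound by (rule mult_left_mono[rotated])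
          moreover have "- Re (integral {-?N..?N} (\<lambda>t. ?G t powr of_real q)) \<le> 4 * (2 * U) powr q * ?N powr (1 - q)"
            using Ic abs_Re_le_cmod[of "integral {-?N..?N} (\<lambda>t. ?G t powr of_real q)"] by linarith
          then have "B * - Re (integral {-?N..?N} (\<lambda>t. ?G t powr of_real q)) \<le> B * (4 * (2 * U) powr q * ?N powr (1 - q))"
            using B by (rule mult_left_mono)
          ultimately show ?thesis by linarith
        qed
        finally show ?thesis .
      qed
      have "(\<lambda>n. A * ?C + B * (4 * (2 * U) powr q * real n powr (1 - q))) \<longlonglongrightarrow> A * ?C + B * (4 * (2 * U) powr q * 0)"
        using q by (intro tendsto_intros tendsto_neg_powr filterlim_real_sequentially) auto
      then have "(\<lambda>n. A * ?C + B * (4 * (2 * U) powr q * real n powr (1 - q))) \<longlonglongrightarrow> A * ?C" by simp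
      then show ?thesis by (rule LIMSEQ_le_const) (use est in blast)
    qed
    then show thesis using that[of "A * ?C"] by (simp add: F_def)
  qed
qed

section \<open>Conjugate Poisson integrals and truncations\<close>

text \<open>A second regularisation of the principal value. Unlike \<open>trunc_hilbert\<close> it
  is the imaginary part of a holomorphic function when u is real, and so inherits L^q bounds that
  are uniform in y.\<close>

definition conj_poisson :: "real \<Rightarrow> (real \<Rightarrow> complex) \<Rightarrow> real \<Rightarrow> complex" where
  "conj_poisson y u t = (\<integral>x. u x * of_real ((x - t) / ((x - t)\<^sup>2 + y\<^sup>2)) \<partial>leb_I)"

lemma conj_kernel_bound:
  fixes s y :: real
  assumes "0 < y"
  shows "\<bar>s / (s\<^sup>2 + y\<^sup>2)\<bar> \<le> 1 / y"
proof -
  have "2 * (\<bar>s\<bar> * y) \<le> s\<^sup>2 + y\<^sup>2"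
    using sum_squares_bound[of "\<bar>s\<bar>" y] by (simp add: mult.assoc)
  moreover have "0 \<le> \<bar>s\<bar> * y" using assms by simp
  ultimately have "\<bar>s\<bar> * y \<le> s\<^sup>2 + y\<^sup>2" by linarith
  then show ?thesis using assms by (simp add: abs_mult divide_simps add_pos_pos add_nonneg_pos)
qed

lemma conj_kernel_measurable [measurable]: "(\<lambda>x. (x - t) / ((x - t)\<^sup>2 + y\<^sup>2)) \<in> borel_measurable leb_I"
  by (rule borel_measurable_leb_I) measurable

lemma conj_poisson_integrable:
  assumes "integrable leb_I u" "0 < y"
  shows "integrable leb_I (\<lambda>x. u x * complex_of_real ((x - t) / ((x - t)\<^sup>2 + y\<^sup>2)))"
  by (rule cauchy_kernel_integrable[OF assms(1), where C="1 / y"])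
     (use conj_kernel_bound[OF assms(2)] in \<open>auto simp del: of_real_divide of_real_diff\<close>)

text \<open>The kernel is odd in x - t, hence the minus sign. For y > 0 it is bounded, so the
  interchange of integrals is unproblematic.\<close>

lemma conj_poisson_Fubini:
  assumes u: "integrable leb_I u" and y: "0 < y" and h: "h \<in> borel_measurable leb_I" "\<And>t. norm (h t) \<le> B"
  shows "(\<integral>t. conj_poisson y u t * h t \<partial>leb_I) = - (\<integral>x. u x * conj_poisson y h x \<partial>leb_I)"
    and "integrable leb_I (\<lambda>t. conj_poisson y u t * h t)"
proof -
  let ?k = "\<lambda>x t. complex_of_real ((x - t) / ((x - t)\<^sup>2 + y\<^sup>2)) * h t"
  have S: "sigma_finite_measure leb_I" by (rule leb_I.sigma_finite_measure_axioms)
  have m1: "(\<lambda>z. fst z) \<in> borel_measurable (leb_I \<Otimes>\<^sub>M leb_I)"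
    using measurable_compose[OF measurable_fst ident_measurable_leb_I] .
  have m2: "(\<lambda>z. snd z) \<in> borel_measurable (leb_I \<Otimes>\<^sub>M leb_I)"
    using measurable_compose[OF measurable_snd ident_measurable_leb_I] .
  have m3: "(\<lambda>z. h (snd z)) \<in> borel_measurable (leb_I \<Otimes>\<^sub>M leb_I)"
    using measurable_compose[OF measurable_snd h(1)] .
  have km: "(\<lambda>(x, t). ?k x t) \<in> borel_measurable (leb_I \<Otimes>\<^sub>M leb_I)"
    using m1 m2 m3 unfolding case_prod_beta by measurable
  have kb: "norm (?k x t) \<le> 1 / y * B" for x t
    unfolding norm_mult using conj_kernel_bound[OF y, of "x - t"] h(2)[of t] y
    by (intro mult_mono) (auto simp del: of_real_divide of_real_diff)
  have mk: "?k x \<in> borel_measurable leb_I" for x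
  proof -
    have "(\<lambda>t. complex_of_real ((x - t) / ((x - t)\<^sup>2 + y\<^sup>2))) \<in> borel_measurable leb_I"
      by (rule borel_measurable_leb_I) measurable
    then show ?thesis using h(1) by (rule borel_measurable_times)
  qed
  have ik: "integrable leb_I (?k x)" for x
    by (rule leb_I.integrable_const_bound[where B="1 / y * B"]) (use kb mk in auto)
  have mass: "measure leb_I (space leb_I) = 2"
    by (simp add: space_restrict_space measure_restrict_space)
  have nk: "(\<integral>t. norm (?k x t) \<partial>leb_I) \<le> 2 * (1 / y * B)" for x
  proof -
    have "(\<integral>t. norm (?k x t) \<partial>leb_I) \<le> (\<integral>t. 1 / y * B \<partial>leb_I)"
      by (rule integral_mono[OF integrable_norm[OF ik]]) (use kb in auto)
    also have "\<dots> = 2 * (1 / y * B)" using mass by simp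
    finally show ?thesis .
  qed
  note F = Fubini_kernel[OF S S u km ik nk]
  have eq: "conj_poisson y u t * h t = (\<integral>x. u x * ?k x t \<partial>leb_I)" for t
    unfolding conj_poisson_def by (simp only: mult.assoc[symmetric] integral_mult_left_zero)
  show "integrable leb_I (\<lambda>t. conj_poisson y u t * h t)" using F(2) by (simp only: eq)
  have inner: "(\<integral>t. ?k x t \<partial>leb_I) = - conj_poisson y h x" for x
  proof -
    have "?k x t = - (h t * complex_of_real ((t - x) / ((t - x)\<^sup>2 + y\<^sup>2)))" for t
    proof -
      have "(x - t) / ((x - t)\<^sup>2 + y\<^sup>2) = - ((t - x) / ((t - x)\<^sup>2 + y\<^sup>2))"
        by (simp add: power2_commute[of x t] minus_divide_left)
      then show ?thesis by (simp only: of_real_minus) simp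
    qed
    then show ?thesis unfolding conj_poisson_def by (simp only: Bochner_Integration.integral_minus)
  qed
  show "(\<integral>t. conj_poisson y u t * h t \<partial>leb_I) = - (\<integral>x. u x * conj_poisson y h x \<partial>leb_I)"
    using F(1) unfolding eq inner by simp
qed

text \<open>The conjugate Poisson integral is an average of truncated Hilbert transforms, because
  $s^2/(1+s^2)$ is the distribution function with density $2r/(1+r^2)^2$.\<close>

definition abel_density :: "real \<Rightarrow> real" where
  "abel_density r = (if 0 < r then 2 * r / (1 + r\<^sup>2)\<^sup>2 else 0)"

lemma abel_density_measurable [measurable]: "abel_density \<in> borel_measurable borel"
  unfolding abel_density_def[abs_def] by measurable

lemma abel_density_nonneg [simp]: "0 \<le> abel_density r"
  by (simp add: abel_density_def)

lemma abel_density_deriv: "((\<lambda>r. r\<^sup>2 / (1 + r\<^sup>2)) has_real_derivative 2 * r / (1 + r\<^sup>2)\<^sup>2) (at r)" for r :: real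
proof -
  have p: "1 + r\<^sup>2 \<noteq> 0" using zero_le_power2[of r] by linarith
  have "((\<lambda>r. r\<^sup>2 / (1 + r\<^sup>2)) has_real_derivative (2 * r * (1 + r\<^sup>2) - r\<^sup>2 * (2 * r)) / ((1 + r\<^sup>2) * (1 + r\<^sup>2))) (at r)"
    using p by (auto intro!: derivative_eq_intros)
  moreover have "(2 * r * (1 + r\<^sup>2) - r\<^sup>2 * (2 * r)) / ((1 + r\<^sup>2) * (1 + r\<^sup>2)) = 2 * r / (1 + r\<^sup>2)\<^sup>2"
    by (simp add: power2_eq_square algebra_simps)
  ultimately show ?thesis by simp
qed

lemma abel_density_integral_Icc:
  assumes "0 \<le> s"
  shows "has_bochner_integral lborel (\<lambda>r. abel_density r * indicator {0..s} r) (s\<^sup>2 / (1 + s\<^sup>2))"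
proof -
  have "has_bochner_integral lborel (\<lambda>r. (2 * r / (1 + r\<^sup>2)\<^sup>2) * indicator {0..s} r) (s\<^sup>2 / (1 + s\<^sup>2) - 0\<^sup>2 / (1 + 0\<^sup>2))"
    by (rule has_bochner_integral_FTC_Icc_nonneg)
       (use assms abel_density_deriv in \<open>auto intro: DERIV_subset\<close>)
  moreover have "(2 * r / (1 + r\<^sup>2)\<^sup>2) * indicator {0..s} r = abel_density r * indicator {0..s} r" for r
    by (auto simp: abel_density_def indicator_def)
  ultimately show ?thesis by simp
qed

lemma abel_density_integral: "has_bochner_integral lborel abel_density 1"
proof -
  have "(\<integral>\<^sup>+r. ennreal (2 * r / (1 + r\<^sup>2)\<^sup>2) * indicator {0..} r \<partial>lborel) = ennreal (1 - 0\<^sup>2 / (1 + 0\<^sup>2))"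
  proof (rule nn_integral_FTC_atLeast)
    show "((\<lambda>r::real. r\<^sup>2 / (1 + r\<^sup>2)) \<longlongrightarrow> 1) at_top" by real_asymp
  qed (use abel_density_deriv in auto)
  moreover have "ennreal (2 * r / (1 + r\<^sup>2)\<^sup>2) * indicator {0..} r = ennreal (abel_density r)" for r
    by (auto simp: abel_density_def indicator_def)
  ultimately have "(\<integral>\<^sup>+r. ennreal (abel_density r) \<partial>lborel) = ennreal 1" by simp
  then show ?thesis by (intro has_bochner_integral_nn_integral) auto
qed

lemma conj_poisson_eq_average:
  assumes u: "integrable leb_I u" and y: "0 < y"
  shows "conj_poisson y u t = (\<integral>r. of_real (abel_density r) * trunc_hilbert (y * r) u t \<partial>lborel)"
    and "integrable lborel (\<lambda>r. of_real (abel_density r) * trunc_hilbert (y * r) u t)"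
proof -
  let ?k = "\<lambda>x r. if y * r \<le> \<bar>x - t\<bar> then complex_of_real (abel_density r) / of_real (x - t) else 0"
  have S: "sigma_finite_measure leb_I" by (rule leb_I.sigma_finite_measure_axioms)
  have m1: "(\<lambda>z. fst z) \<in> borel_measurable (leb_I \<Otimes>\<^sub>M lborel)"
    using measurable_compose[OF measurable_fst ident_measurable_leb_I] .
  have m2: "(\<lambda>z. snd z) \<in> borel_measurable (leb_I \<Otimes>\<^sub>M lborel)"
    using measurable_compose[OF measurable_snd, of "\<lambda>x. x" lborel borel leb_I] by simp
  have m3: "(\<lambda>z. abel_density (snd z)) \<in> borel_measurable (leb_I \<Otimes>\<^sub>M lborel)"
    using measurable_compose[OF m2 abel_density_measurable] .
  have km: "(\<lambda>(x, r). ?k x r) \<in> borel_measurable (leb_I \<Otimes>\<^sub>M lborel)"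
    using m1 m2 m3 unfolding case_prod_beta by measurable
  have hb: "has_bochner_integral lborel (?k x) (of_real ((x - t) / ((x - t)\<^sup>2 + y\<^sup>2)))"
    "has_bochner_integral lborel (\<lambda>r. norm (?k x r)) \<bar>(x - t) / ((x - t)\<^sup>2 + y\<^sup>2)\<bar>" for x
  proof -
    \<comment> \<open>The conjugate kernel is 1 / (x - t) times s^2 / (1 + s^2), the second factor
      being the mass of \<open>abel_density\<close> on [0, s]; and r \<le> s is the cut-off
      condition y r \<le> |x - t|.\<close>
    define s where "s = \<bar>x - t\<bar> / y"
    have s: "0 \<le> s" using y by (simp add: s_def)
    have s2: "s\<^sup>2 / (1 + s\<^sup>2) = (x - t)\<^sup>2 / ((x - t)\<^sup>2 + y\<^sup>2)"
      using y by (simp add: s_def power_divide divide_simps) (simp add: add.commute)?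
    have cond: "y * r \<le> \<bar>x - t\<bar> \<longleftrightarrow> r \<le> s" for r using y by (simp add: s_def pos_le_divide_eq mult.commute)
    have e1: "?k x r = complex_of_real (abel_density r * indicator {0..s} r) / of_real (x - t)" for r
      unfolding cond by (auto simp: abel_density_def indicator_def)
    have v1: "complex_of_real (s\<^sup>2 / (1 + s\<^sup>2)) / of_real (x - t) = of_real ((x - t) / ((x - t)\<^sup>2 + y\<^sup>2))"
      unfolding s2 by (simp only: of_real_divide[symmetric]) (simp add: power2_eq_square)
    have "has_bochner_integral lborel (\<lambda>r. complex_of_real (abel_density r * indicator {0..s} r) / of_real (x - t))
        (complex_of_real (s\<^sup>2 / (1 + s\<^sup>2)) / of_real (x - t))"
      by (intro has_bochner_integral_divide_zero has_bochner_integral_of_real abel_density_integral_Icc s)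
    then show "has_bochner_integral lborel (?k x) (of_real ((x - t) / ((x - t)\<^sup>2 + y\<^sup>2)))"
      unfolding v1 e1 .
    have e2: "norm (?k x r) = abel_density r * indicator {0..s} r / \<bar>x - t\<bar>" for r
      unfolding e1 norm_divide norm_of_real by (simp add: abs_mult)
    have v2: "(s\<^sup>2 / (1 + s\<^sup>2)) / \<bar>x - t\<bar> = \<bar>(x - t) / ((x - t)\<^sup>2 + y\<^sup>2)\<bar>"
      unfolding s2 by (simp add: power2_eq_square abs_mult[symmetric] divide_simps)
    have "has_bochner_integral lborel (\<lambda>r. abel_density r * indicator {0..s} r / \<bar>x - t\<bar>) ((s\<^sup>2 / (1 + s\<^sup>2)) / \<bar>x - t\<bar>)"
      by (intro has_bochner_integral_divide_zero abel_density_integral_Icc s)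
    then show "has_bochner_integral lborel (\<lambda>r. norm (?k x r)) \<bar>(x - t) / ((x - t)\<^sup>2 + y\<^sup>2)\<bar>"
      unfolding v2 e2 .
  qed
  have ik: "integrable lborel (?k x)" for x using integrable.intros[OF hb(1)] .
  have nk: "(\<integral>r. norm (?k x r) \<partial>lborel) \<le> 1 / y" for x
    unfolding has_bochner_integral_integral_eq[OF hb(2)] by (rule conj_kernel_bound[OF y])
  have kI: "(\<integral>r. ?k x r \<partial>lborel) = of_real ((x - t) / ((x - t)\<^sup>2 + y\<^sup>2))" for x
    by (rule has_bochner_integral_integral_eq[OF hb(1)])
  note F = Fubini_kernel[OF S lborel.sigma_finite_measure_axioms u km ik nk]
  have eq: "of_real (abel_density r) * trunc_hilbert (y * r) u t = (\<integral>x. u x * ?k x r \<partial>leb_I)" for r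
    unfolding trunc_hilbert_def integral_mult_right_zero[symmetric]
    by (rule Bochner_Integration.integral_cong) auto
  show "conj_poisson y u t = (\<integral>r. of_real (abel_density r) * trunc_hilbert (y * r) u t \<partial>lborel)"
    using F(1) unfolding eq kI conj_poisson_def by simp
  show "integrable lborel (\<lambda>r. of_real (abel_density r) * trunc_hilbert (y * r) u t)"
    using F(2) unfolding eq .
qed

text \<open>The weights in the average form a probability density, so a bound valid for all cut-offs
  survives.\<close>

lemma conj_poisson_bound:
  assumes u: "integrable leb_I u" and y: "0 < y" and b: "\<And>\<epsilon>. 0 < \<epsilon> \<Longrightarrow> norm (trunc_hilbert \<epsilon> u t) \<le> M"
  shows "norm (conj_poisson y u t) \<le> M"
proof -
  have M: "0 \<le> M" using order_trans[OF norm_ge_zero b[of 1]] by simp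
  have d: "integrable lborel abel_density" "(\<integral>r. abel_density r \<partial>lborel) = 1"
    using abel_density_integral by (auto simp: has_bochner_integral_iff)
  have "norm (conj_poisson y u t) \<le> (\<integral>r. norm (complex_of_real (abel_density r) * trunc_hilbert (y * r) u t) \<partial>lborel)"
    unfolding conj_poisson_eq_average(1)[OF u y] by (rule integral_norm_bound)
  also have "\<dots> \<le> (\<integral>r. abel_density r * M \<partial>lborel)"
  proof (rule integral_mono)
    show "integrable lborel (\<lambda>r. norm (complex_of_real (abel_density r) * trunc_hilbert (y * r) u t))"
      by (rule integrable_norm[OF conj_poisson_eq_average(2)[OF u y]])
    show "integrable lborel (\<lambda>r. abel_density r * M)" using d by simp
    show "norm (complex_of_real (abel_density r) * trunc_hilbert (y * r) u t) \<le> abel_density r * M" for r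
    proof (cases "0 < r")
      case True
      then show ?thesis using b[of "y * r"] y by (simp add: norm_mult mult_left_mono)
    qed (simp add: abel_density_def)
  qed
  also have "\<dots> = M" using d by simp
  finally show ?thesis .
qed

lemma trunc_hilbert_bound:
  assumes u: "integrable leb_I u" and e: "0 < \<epsilon>"
  shows "norm (trunc_hilbert \<epsilon> u t) \<le> (\<integral>x. norm (u x) \<partial>leb_I) / \<epsilon>"
proof -
  have "norm (trunc_hilbert \<epsilon> u t) \<le> (\<integral>x. norm (if \<epsilon> \<le> \<bar>x - t\<bar> then u x / of_real (x - t) else 0) \<partial>leb_I)"
    unfolding trunc_hilbert_def by (rule integral_norm_bound)
  also have "\<dots> \<le> (\<integral>x. norm (u x) / \<epsilon> \<partial>leb_I)"
  proof (rule integral_mono)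
    show "integrable leb_I (\<lambda>x. norm (if \<epsilon> \<le> \<bar>x - t\<bar> then u x / complex_of_real (x - t) else 0))"
      by (rule integrable_norm[OF trunc_kernel_integrable[OF u e]])
    show "integrable leb_I (\<lambda>x. norm (u x) / \<epsilon>)" using u by simp
    show "norm (if \<epsilon> \<le> \<bar>x - t\<bar> then u x / complex_of_real (x - t) else 0) \<le> norm (u x) / \<epsilon>" for x
      using e by (auto simp: norm_divide simp flip: of_real_diff intro!: frac_le)
  qed
  finally show ?thesis by simp
qed

text \<open>In the average over cut-offs y r each fixed r > 0 contributes the limit L. Small
  cut-offs are bounded because the limit exists, large ones by \<open>trunc_hilbert_bound\<close>;
  this gives the majorant M.\<close>

lemma conj_poisson_tendsto_pv:
  assumes u: "integrable leb_I u" and pv: "has_pv u t L"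
  shows "(\<lambda>n. conj_poisson (1 / Suc n) u t) \<longlonglongrightarrow> L"
proof -
  let ?T = "\<lambda>\<epsilon>. trunc_hilbert \<epsilon> u t"
  have d: "integrable lborel abel_density" "(\<integral>r. abel_density r \<partial>lborel) = 1"
    using abel_density_integral by (auto simp: has_bochner_integral_iff)
  have "\<forall>\<^sub>F \<epsilon> in at_right 0. norm (?T \<epsilon> - L) < 1"
    using pv unfolding has_pv_def by (auto simp: tendsto_iff dist_norm)
  then obtain \<delta> where \<delta>: "0 < \<delta>" "\<And>\<epsilon>. 0 < \<epsilon> \<Longrightarrow> \<epsilon> < \<delta> \<Longrightarrow> norm (?T \<epsilon> - L) < 1"
    by (auto simp: eventually_at_right_field)
  let ?U = "\<integral>x. norm (u x) \<partial>leb_I"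
  define M where "M = norm L + 1 + ?U / \<delta>"
  have U: "0 \<le> ?U" by simp
  have bM: "norm (?T \<epsilon>) \<le> M" if e: "0 < \<epsilon>" for \<epsilon>
  proof (cases "\<epsilon> < \<delta>")
    case True
    then have "norm (?T \<epsilon>) \<le> norm L + 1" using \<delta>(2)[OF e True] norm_triangle_sub[of "?T \<epsilon>" L] by simp
    then show ?thesis using U \<delta>(1) by (simp add: M_def add_increasing2)
  next
    case False
    have "norm (?T \<epsilon>) \<le> ?U / \<epsilon>" by (rule trunc_hilbert_bound[OF u e])
    also have "\<dots> \<le> ?U / \<delta>" using False \<delta>(1) U by (intro frac_le) auto
    finally show ?thesis unfolding M_def using norm_ge_zero[of L] by linarith
  qed
  have "(\<lambda>n. \<integral>r. of_real (abel_density r) * ?T (1 / Suc n * r) \<partial>lborel) \<longlonglongrightarrow> (\<integral>r. of_real (abel_density r) * L \<partial>lborel)"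
  proof (rule integral_dominated_convergence[where w="\<lambda>r. abel_density r * M"])
    show "(\<lambda>r. complex_of_real (abel_density r) * L) \<in> borel_measurable lborel"
      using d(1) by (intro borel_measurable_integrable integrable_mult_left) simp
    show "(\<lambda>r. complex_of_real (abel_density r) * ?T (1 / Suc n * r)) \<in> borel_measurable lborel" for n
      using conj_poisson_eq_average(2)[OF u, of "1 / Suc n" t] by (intro borel_measurable_integrable) simp
    show "integrable lborel (\<lambda>r. abel_density r * M)" using d by simp
    show "AE r in lborel. norm (complex_of_real (abel_density r) * ?T (1 / Suc n * r)) \<le> abel_density r * M" for n
    proof (rule AE_I2)
      fix r
      show "norm (complex_of_real (abel_density r) * ?T (1 / Suc n * r)) \<le> abel_density r * M"
      proof (cases "0 < r")
        case True
        then have "norm (?T (1 / Suc n * r)) \<le> M" by (intro bM) simp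
        from mult_left_mono[OF this abel_density_nonneg] show ?thesis by (simp only: norm_mult norm_of_real abs_of_nonneg abel_density_nonneg)
      qed (simp add: abel_density_def)
    qed
    show "AE r in lborel. (\<lambda>n. complex_of_real (abel_density r) * ?T (1 / Suc n * r)) \<longlonglongrightarrow> complex_of_real (abel_density r) * L"
    proof (rule AE_I2)
      fix r :: real
      show "(\<lambda>n. complex_of_real (abel_density r) * ?T (1 / Suc n * r)) \<longlonglongrightarrow> complex_of_real (abel_density r) * L"
      proof (cases "0 < r")
        case True
        have "filterlim (\<lambda>n. 1 / real (Suc n) * r) (at_right 0) sequentially"
          unfolding filterlim_at
        proof
          show "(\<lambda>n. 1 / real (Suc n) * r) \<longlonglongrightarrow> 0"
            using tendsto_mult_left_zero[OF LIMSEQ_inverse_real_of_nat, of r] by (simp add: inverse_eq_divide)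
        qed (use True in simp)
        then have "(\<lambda>n. ?T (1 / Suc n * r)) \<longlonglongrightarrow> L"
          using pv unfolding has_pv_def by (rule filterlim_compose[rotated])
        then show ?thesis by (rule tendsto_mult_left)
      qed (simp add: abel_density_def)
    qed
  qed
  moreover have "(\<integral>r. complex_of_real (abel_density r) * L \<partial>lborel) = L"
    using d by simp
  moreover have "conj_poisson (1 / Suc n) u t = (\<integral>r. of_real (abel_density r) * ?T (1 / Suc n * r) \<partial>lborel)" for n
    by (rule conj_poisson_eq_average(1)[OF u]) simp
  ultimately show ?thesis by (simp only:)
qed

section \<open>Bounds in L^q and passage to the limit\<close>

lemma powr_sum_le:
  fixes a b q :: real
  assumes "0 \<le> a" "0 \<le> b" "0 < q"
  shows "(a + b) powr q \<le> 2 powr q * (a powr q + b powr q)"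
proof -
  have "(a + b) powr q \<le> (2 * max a b) powr q" using assms by (intro powr_mono2) auto
  also have "\<dots> = 2 powr q * max a b powr q" using assms by (simp add: powr_mult)
  also have "max a b powr q \<le> a powr q + b powr q" by (auto simp: max_def)
  finally show ?thesis by simp
qed

lemma powr_sum4_le:
  fixes a b c d q :: real
  assumes "0 \<le> a" "0 \<le> b" "0 \<le> c" "0 \<le> d" "0 < q"
  shows "(a + b + (c + d)) powr q \<le> 4 powr q * (a powr q + b powr q + (c powr q + d powr q))"
proof -
  have "(a + b + (c + d)) powr q \<le> 2 powr q * ((a + b) powr q + (c + d) powr q)"
    using assms by (intro powr_sum_le) auto
  also have "\<dots> \<le> 2 powr q * (2 powr q * (a powr q + b powr q) + 2 powr q * (c powr q + d powr q))"
    using assms by (intro mult_left_mono add_mono powr_sum_le) auto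
  also have "\<dots> = (2 * 2) powr q * (a powr q + b powr q + (c powr q + d powr q))"
    unfolding powr_mult by (simp add: algebra_simps)
  finally show ?thesis by simp
qed

lemma integrable_of_powr:
  fixes u :: "real \<Rightarrow> 'a::{banach, second_countable_topology}"
  assumes "1 \<le> q" "u \<in> borel_measurable leb_I" "integrable leb_I (\<lambda>x. norm (u x) powr q)"
  shows "integrable leb_I u"
proof (rule Bochner_Integration.integrable_bound[where f="\<lambda>x. 1 + norm (u x) powr q"])
  show "integrable leb_I (\<lambda>x. 1 + norm (u x) powr q)" using assms(3) by simp
  have "norm (u x) \<le> 1 + norm (u x) powr q" for x
  proof (cases "norm (u x) \<le> 1")
    case False
    then have "norm (u x) powr 1 \<le> norm (u x) powr q" using assms(1) by (intro powr_mono) auto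
    then show ?thesis using False by simp
  qed (simp add: add_increasing2)
  then show "AE x in leb_I. norm (u x) \<le> norm (1 + norm (u x) powr q)"
    by (intro AE_I2) (auto intro: order_trans)
qed (use assms in auto)

lemma integrable_conj_poisson:
  assumes "integrable leb_I u" "0 < y"
  shows "integrable leb_I (conj_poisson y u)"
  using conj_poisson_Fubini(2)[OF assms, of "\<lambda>_. 1" 1] by simp

lemma conj_poisson_Lq_nonneg:
  fixes u :: "real \<Rightarrow> real" and q :: real
  assumes q: "1 < q" "q < 2" and u0: "\<And>x. 0 \<le> u x" and iu: "integrable leb_I u"
    and iq: "integrable leb_I (\<lambda>x. u x powr q)"
  obtains C where "\<And>y. 0 < y \<Longrightarrow> integrable leb_I (\<lambda>t. norm (conj_poisson y (\<lambda>x. of_real (u x)) t) powr q)"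
    "\<And>y. 0 < y \<Longrightarrow> (\<integral>t. norm (conj_poisson y (\<lambda>x. of_real (u x)) t) powr q \<partial>leb_I) \<le> C"
proof -
  define F where "F = cauchy_transform (\<lambda>x. of_real (u x))"
  have iuc: "integrable leb_I (\<lambda>x. complex_of_real (u x))" using iu by simp
  obtain C where C: "\<And>y. 0 < y \<Longrightarrow> integral {-1..1} (\<lambda>t. norm (F (Complex y t)) powr q) \<le> C"
    using riesz_bound_nonneg[OF q u0 iu iq] unfolding F_def by blast
  have "integrable leb_I (\<lambda>t. norm (conj_poisson y (\<lambda>x. of_real (u x)) t) powr q) \<and>
      (\<integral>t. norm (conj_poisson y (\<lambda>x. of_real (u x)) t) powr q \<partial>leb_I) \<le> C" if y: "0 < y" for y
  proof -
    have le: "norm (conj_poisson y (\<lambda>x. of_real (u x)) t) \<le> norm (F (Complex y t))" for t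
    proof -
      have i: "integrable leb_I (\<lambda>x. complex_of_real (u x) * (1 / (Complex y t - \<i> * of_real x)))"
      proof (rule cauchy_kernel_integrable[OF iuc cauchy_kernel_measurable])
        show "norm (1 / (Complex y t - \<i> * of_real x)) \<le> 1 / y" for x
          using y cauchy_kernel_bound[of "Complex y t" x] by (simp add: norm_divide frac_le)
      qed
      have im: "Im (complex_of_real (u x) * (1 / (Complex y t - \<i> * of_real x))) = u x * ((x - t) / ((x - t)\<^sup>2 + y\<^sup>2))" for x
      proof -
        have "Im (complex_of_real a * z) = a * Im z" for a z by simp
        then show ?thesis by (simp only: Re_Im_cauchy_kernel(2))
      qed
      have "conj_poisson y (\<lambda>x. of_real (u x)) t = of_real (\<integral>x. u x * ((x - t) / ((x - t)\<^sup>2 + y\<^sup>2)) \<partial>leb_I)"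
        unfolding conj_poisson_def by (simp only: of_real_mult[symmetric] integral_complex_of_real)
      also have "(\<integral>x. u x * ((x - t) / ((x - t)\<^sup>2 + y\<^sup>2)) \<partial>leb_I) = Im (F (Complex y t))"
        using integral_Im[OF i] unfolding im by (simp add: F_def cauchy_transform_def)
      finally show ?thesis using abs_Im_le_cmod by simp
    qed
    have "F holomorphic_on {w. 0 < Re w}"
      using cauchy_transform_differentiable[OF iuc]
      by (auto simp: holomorphic_on_def F_def intro: field_differentiable_at_within)
    then have "continuous_on {-1..1} (\<lambda>t. F (Complex y t))"
      by (rule continuous_on_compose2[OF holomorphic_on_imp_continuous_on])
         (use y in \<open>auto simp: Complex_eq intro!: continuous_intros\<close>)
    then have "continuous_on {-1..1} (\<lambda>t. norm (F (Complex y t)) powr q)"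
      using q by (intro continuous_on_powr' continuous_on_norm continuous_on_const) auto
    then have a: "(\<lambda>t. norm (F (Complex y t)) powr q) absolutely_integrable_on {-1..1}"
      by (rule absolutely_integrable_continuous_real)
    note iF = integral_leb_I_eq_HK[OF a]
    have mc: "conj_poisson y (\<lambda>x. of_real (u x)) \<in> borel_measurable leb_I"
      using integrable_conj_poisson[OF iuc y] by simp
    have le': "norm (conj_poisson y (\<lambda>x. of_real (u x)) t) powr q \<le> norm (F (Complex y t)) powr q" for t
      using le[of t] q by (intro powr_mono2) auto
    have i: "integrable leb_I (\<lambda>t. norm (conj_poisson y (\<lambda>x. of_real (u x)) t) powr q)"
      by (rule Bochner_Integration.integrable_bound[OF iF(1)]) (use mc le' in auto)
    have "(\<integral>t. norm (conj_poisson y (\<lambda>x. of_real (u x)) t) powr q \<partial>leb_I) \<le> (\<integral>t. norm (F (Complex y t)) powr q \<partial>leb_I)"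
      by (rule integral_mono[OF i iF(1)]) (rule le')
    with i C[OF y] iF(2) show ?thesis by simp
  qed
  then show thesis using that by blast
qed

text \<open>Riesz's argument needs a nonnegative function; u is split into the positive and negative
  parts of its real and imaginary parts.\<close>

lemma conj_poisson_Lq:
  fixes u :: "real \<Rightarrow> complex" and q :: real
  assumes q: "1 < q" "q < 2" and um: "u \<in> borel_measurable leb_I"
    and iq: "integrable leb_I (\<lambda>x. norm (u x) powr q)"
  obtains C where "\<And>y. 0 < y \<Longrightarrow> integrable leb_I (\<lambda>t. norm (conj_poisson y u t) powr q)"
    "\<And>y. 0 < y \<Longrightarrow> (\<integral>t. norm (conj_poisson y u t) powr q \<partial>leb_I) \<le> C"
proof -
  define v where "v = (\<lambda>i x. if i = (0::nat) then max (Re (u x)) 0 else if i = 1 then max (- Re (u x)) 0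
     else if i = 2 then max (Im (u x)) 0 else max (- Im (u x)) 0)"
  have v0: "0 \<le> v i x" for i x by (simp add: v_def)
  have vm: "v i \<in> borel_measurable leb_I" for i unfolding v_def using um by measurable
  have vle: "v i x \<le> norm (u x)" for i x
    using abs_Re_le_cmod[of "u x"] abs_Im_le_cmod[of "u x"] by (auto simp: v_def)
  have viq: "integrable leb_I (\<lambda>x. v i x powr q)" for i
  proof (rule Bochner_Integration.integrable_bound[OF iq])
    show "(\<lambda>x. v i x powr q) \<in> borel_measurable leb_I" using vm by measurable
    show "AE x in leb_I. norm (v i x powr q) \<le> norm (norm (u x) powr q)"
      using v0 vle q by (intro AE_I2) (auto intro!: powr_mono2)
  qed
  have vi: "integrable leb_I (v i)" for i
    using integrable_of_powr[of q "v i"] q vm viq v0 by simp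
  have "\<exists>C. \<forall>y>0. integrable leb_I (\<lambda>t. norm (conj_poisson y (\<lambda>x. of_real (v i x)) t) powr q) \<and>
      (\<integral>t. norm (conj_poisson y (\<lambda>x. of_real (v i x)) t) powr q \<partial>leb_I) \<le> C" for i
    using conj_poisson_Lq_nonneg[OF q v0 vi viq] by metis
  then obtain C where C: "\<And>i y. 0 < y \<Longrightarrow> integrable leb_I (\<lambda>t. norm (conj_poisson y (\<lambda>x. of_real (v i x)) t) powr q)"
      "\<And>i y. 0 < y \<Longrightarrow> (\<integral>t. norm (conj_poisson y (\<lambda>x. of_real (v i x)) t) powr q \<partial>leb_I) \<le> C i"
    by metis
  have iu: "integrable leb_I u" using q by (intro integrable_of_powr[OF _ um iq]) simp
  have "integrable leb_I (\<lambda>t. norm (conj_poisson y u t) powr q) \<and>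
      (\<integral>t. norm (conj_poisson y u t) powr q \<partial>leb_I) \<le> 4 powr q * (C 0 + C 1 + (C 2 + C 3))" if y: "0 < y" for y
  proof -
    let ?c = "\<lambda>i t. conj_poisson y (\<lambda>x. of_real (v i x)) t"
    let ?b = "\<lambda>t. 4 powr q * (norm (?c 0 t) powr q + norm (?c 1 t) powr q + (norm (?c 2 t) powr q + norm (?c 3 t) powr q))"
    have lin: "conj_poisson y u t = ?c 0 t - ?c 1 t + \<i> * (?c 2 t - ?c 3 t)" for t
    proof -
      let ?k = "\<lambda>x. complex_of_real ((x - t) / ((x - t)\<^sup>2 + y\<^sup>2))"
      have ik: "integrable leb_I (\<lambda>x. of_real (v i x) * ?k x)" for i
        using conj_poisson_integrable[of "\<lambda>x. of_real (v i x)" y t] vi y by simp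
      have ux: "u x = of_real (v 0 x) - of_real (v 1 x) + \<i> * (of_real (v 2 x) - of_real (v 3 x))" for x
        by (auto simp: v_def complex_eq_iff max_def)
      have "conj_poisson y u t = (\<integral>x. of_real (v 0 x) * ?k x - of_real (v 1 x) * ?k x
          + \<i> * (of_real (v 2 x) * ?k x - of_real (v 3 x) * ?k x) \<partial>leb_I)"
        unfolding conj_poisson_def
        by (rule Bochner_Integration.integral_cong[OF refl]) (subst ux, simp only: ring_distribs left_diff_distrib right_diff_distrib mult.assoc)
      also have "\<dots> = ?c 0 t - ?c 1 t + \<i> * (?c 2 t - ?c 3 t)"
        unfolding conj_poisson_def
        by (simp only: Bochner_Integration.integral_add Bochner_Integration.integral_diff ik integral_mult_right_zero
            Bochner_Integration.integrable_diff integrable_mult_right)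
      finally show ?thesis .
    qed
    have le: "norm (conj_poisson y u t) powr q \<le> ?b t" for t
    proof -
      have "norm (conj_poisson y u t) \<le> norm (?c 0 t) + norm (?c 1 t) + (norm (?c 2 t) + norm (?c 3 t))"
        unfolding lin
        using norm_triangle_ineq[of "?c 0 t - ?c 1 t" "\<i> * (?c 2 t - ?c 3 t)"]
          norm_triangle_ineq4[of "?c 0 t" "?c 1 t"] norm_triangle_ineq4[of "?c 2 t" "?c 3 t"]
        by (simp add: norm_mult)
      then have "norm (conj_poisson y u t) powr q \<le> (norm (?c 0 t) + norm (?c 1 t) + (norm (?c 2 t) + norm (?c 3 t))) powr q"
        using q by (intro powr_mono2) auto
      also have "\<dots> \<le> ?b t" using q by (intro powr_sum4_le) auto
      finally show ?thesis .
    qed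
    have ib: "integrable leb_I ?b"
      by (intro integrable_mult_right Bochner_Integration.integrable_add C(1) y)
    have i: "integrable leb_I (\<lambda>t. norm (conj_poisson y u t) powr q)"
    proof (rule Bochner_Integration.integrable_bound[OF ib])
      show "(\<lambda>t. norm (conj_poisson y u t) powr q) \<in> borel_measurable leb_I"
        using integrable_conj_poisson[OF iu y] by measurable
      show "AE t in leb_I. norm (norm (conj_poisson y u t) powr q) \<le> norm (?b t)"
        using le by (intro AE_I2) (auto intro: order_trans)
    qed
    have "(\<integral>t. norm (conj_poisson y u t) powr q \<partial>leb_I) \<le> (\<integral>t. ?b t \<partial>leb_I)"
      by (rule integral_mono[OF i ib]) (rule le)
    also have "\<dots> = 4 powr q * ((\<integral>t. norm (?c 0 t) powr q \<partial>leb_I) + (\<integral>t. norm (?c 1 t) powr q \<partial>leb_I)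
        + ((\<integral>t. norm (?c 2 t) powr q \<partial>leb_I) + (\<integral>t. norm (?c 3 t) powr q \<partial>leb_I)))"
      by (simp only: integral_mult_right_zero Bochner_Integration.integral_add C(1) y Bochner_Integration.integrable_add)
    also have "\<dots> \<le> 4 powr q * (C 0 + C 1 + (C 2 + C 3))"
      by (intro mult_left_mono add_mono C(2) y) auto
    finally show ?thesis using i by blast
  qed
  then show thesis using that by blast
qed

text \<open>Boundedness in $L^q$ with $q > 1$ replaces domination: on the set where the difference $d$
  exceeds $K$ one has $d \<le> d^q / K^{q-1}$.\<close>

lemma Lq_bounded_convergence:
  fixes g :: "nat \<Rightarrow> real \<Rightarrow> complex" and q :: real
  assumes q: "1 < q" and gm: "\<And>n. g n \<in> borel_measurable leb_I" and fm: "f \<in> borel_measurable leb_I"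
    and lim: "AE x in leb_I. (\<lambda>n. g n x) \<longlonglongrightarrow> f x"
    and iq: "\<And>n. integrable leb_I (\<lambda>x. norm (g n x) powr q)" and bq: "\<And>n. (\<integral>x. norm (g n x) powr q \<partial>leb_I) \<le> C"
    and fq: "integrable leb_I (\<lambda>x. norm (f x) powr q)"
  shows "(\<lambda>n. \<integral>x. g n x \<partial>leb_I) \<longlonglongrightarrow> (\<integral>x. f x \<partial>leb_I)"
proof -
  let ?d = "\<lambda>n x. norm (g n x - f x)"
  define C' where "C' = 2 powr q * (C + (\<integral>x. norm (f x) powr q \<partial>leb_I))"
  have gi: "integrable leb_I (g n)" for n using q by (intro integrable_of_powr[OF _ gm iq]) simp
  have fi: "integrable leb_I f" using q by (intro integrable_of_powr[OF _ fm fq]) simp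
  have dm: "?d n \<in> borel_measurable leb_I" for n using gm fm by measurable
  have dq_le: "?d n x powr q \<le> 2 powr q * (norm (g n x) powr q + norm (f x) powr q)" for n x
  proof -
    have "?d n x powr q \<le> (norm (g n x) + norm (f x)) powr q"
      using q by (intro powr_mono2 norm_triangle_ineq4) auto
    also have "\<dots> \<le> 2 powr q * (norm (g n x) powr q + norm (f x) powr q)" using q by (intro powr_sum_le) auto
    finally show ?thesis .
  qed
  have ib: "integrable leb_I (\<lambda>x. 2 powr q * (norm (g n x) powr q + norm (f x) powr q))" for n
    by (intro integrable_mult_right Bochner_Integration.integrable_add iq fq)
  have dq: "integrable leb_I (\<lambda>x. ?d n x powr q)" for n
  proof (rule Bochner_Integration.integrable_bound[OF ib[of n]])
    show "(\<lambda>x. ?d n x powr q) \<in> borel_measurable leb_I" using dm[of n] by measurable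
    show "AE x in leb_I. norm (?d n x powr q) \<le> norm (2 powr q * (norm (g n x) powr q + norm (f x) powr q))"
      using dq_le by (intro AE_I2) (auto intro: order_trans)
  qed
  have dq_int: "(\<integral>x. ?d n x powr q \<partial>leb_I) \<le> C'" for n
  proof -
    have "(\<integral>x. ?d n x powr q \<partial>leb_I) \<le> (\<integral>x. 2 powr q * (norm (g n x) powr q + norm (f x) powr q) \<partial>leb_I)"
      by (rule integral_mono[OF dq ib]) (rule dq_le)
    also have "\<dots> = 2 powr q * ((\<integral>x. norm (g n x) powr q \<partial>leb_I) + (\<integral>x. norm (f x) powr q \<partial>leb_I))"
      by (simp only: integral_mult_right_zero Bochner_Integration.integral_add iq fq)
    also have "\<dots> \<le> C'" unfolding C'_def by (intro mult_left_mono add_right_mono bq) auto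
    finally show ?thesis .
  qed
  have "(\<lambda>n. \<integral>x. ?d n x \<partial>leb_I) \<longlonglongrightarrow> 0"
  proof (rule LIMSEQ_I)
    fix e :: real assume e: "0 < e"
    have "((\<lambda>K. C' * K powr (1 - q)) \<longlongrightarrow> C' * 0) at_top"
      using q by (intro tendsto_intros tendsto_neg_powr filterlim_ident) auto
    then have "\<forall>\<^sub>F K in at_top. C' * K powr (1 - q) < e / 2 \<and> 0 < K"
      using e by (intro eventually_conj order_tendstoD(2)[of _ 0] eventually_gt_at_top) auto
    \<comment> \<open>The threshold makes the part above K smaller than e / 2 for all n at once; the
      part cut off at K has the constant majorant K.\<close>
    then obtain K where K: "C' * K powr (1 - q) < e / 2" "0 < K"
      using eventually_happens'[OF trivial_limit_at_top_linorder] by blast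
    have ptw: "?d n x \<le> min (?d n x) K + K powr (1 - q) * ?d n x powr q" for n x
    proof (cases "?d n x \<le> K")
      case False
      then have d: "K < ?d n x" "0 < ?d n x" using K by auto
      have "?d n x = ?d n x powr (1 - q) * ?d n x powr q" using d by (simp flip: powr_add)
      also have "\<dots> \<le> K powr (1 - q) * ?d n x powr q"
        using d K q by (intro mult_right_mono powr_mono2') auto
      finally have "?d n x \<le> K powr (1 - q) * ?d n x powr q" .
      moreover have "0 \<le> min (?d n x) K" using K by simp
      ultimately show ?thesis by linarith
    qed simp
    have im: "integrable leb_I (\<lambda>x. min (?d n x) K)" for n
      by (rule leb_I.integrable_const_bound[where B=K]) (use K dm[of n] in auto)
    have "(\<lambda>n. \<integral>x. min (?d n x) K \<partial>leb_I) \<longlonglongrightarrow> (\<integral>x. 0 \<partial>leb_I)"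
    proof (rule integral_dominated_convergence[where w="\<lambda>_. K"])
      show "AE x in leb_I. (\<lambda>n. min (?d n x) K) \<longlonglongrightarrow> 0"
        using lim
      proof eventually_elim
        case (elim x)
        have "(\<lambda>n. ?d n x) \<longlonglongrightarrow> 0" using elim by (simp add: LIM_zero tendsto_norm_zero)
        then have "(\<lambda>n. min (?d n x) K) \<longlonglongrightarrow> min 0 K" by (intro tendsto_min tendsto_const)
        then show ?case using K by simp
      qed
      show "(\<lambda>x. min (?d n x) K) \<in> borel_measurable leb_I" for n using im[of n] by simp
    qed (use K in auto)
    then have "\<forall>\<^sub>F n in sequentially. (\<integral>x. min (?d n x) K \<partial>leb_I) < e / 2"
      using e by (intro order_tendstoD(2)[of _ 0]) auto
    then obtain n0 where n0: "\<And>n. n0 \<le> n \<Longrightarrow> (\<integral>x. min (?d n x) K \<partial>leb_I) < e / 2"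
      by (auto simp: eventually_sequentially)
    show "\<exists>n0. \<forall>n\<ge>n0. norm ((\<integral>x. ?d n x \<partial>leb_I) - 0) < e"
    proof (intro exI allI impI)
      fix n assume n: "n0 \<le> n"
      have "(\<integral>x. ?d n x \<partial>leb_I) \<le> (\<integral>x. min (?d n x) K + K powr (1 - q) * ?d n x powr q \<partial>leb_I)"
        by (rule integral_mono) (use gi fi im dq ptw in \<open>auto intro!: Bochner_Integration.integrable_add integrable_norm\<close>)
      also have "\<dots> = (\<integral>x. min (?d n x) K \<partial>leb_I) + K powr (1 - q) * (\<integral>x. ?d n x powr q \<partial>leb_I)"
        by (simp only: Bochner_Integration.integral_add im integrable_mult_right dq integral_mult_right_zero)
      also have "\<dots> \<le> (\<integral>x. min (?d n x) K \<partial>leb_I) + K powr (1 - q) * C'"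
        using dq_int[of n] by (intro add_left_mono mult_left_mono) auto
      also have "\<dots> < e" using n0[OF n] K(1) by (simp add: mult.commute)
      finally show "norm ((\<integral>x. ?d n x \<partial>leb_I) - 0) < e" by simp
    qed
  qed
  moreover have "norm ((\<integral>x. g n x \<partial>leb_I) - (\<integral>x. f x \<partial>leb_I)) \<le> (\<integral>x. ?d n x \<partial>leb_I)" for n
    unfolding Bochner_Integration.integral_diff[OF gi fi, symmetric] by (rule integral_norm_bound)
  then have "\<forall>\<^sub>F n in sequentially. norm ((\<integral>x. g n x \<partial>leb_I) - (\<integral>x. f x \<partial>leb_I)) \<le> (\<integral>x. ?d n x \<partial>leb_I)"
    by (rule always_eventually[OF allI])
  ultimately have "(\<lambda>n. (\<integral>x. g n x \<partial>leb_I) - (\<integral>x. f x \<partial>leb_I)) \<longlonglongrightarrow> 0"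
    by (rule Lim_null_comparison[rotated])
  then show ?thesis by (rule LIM_zero_cancel)
qed

section \<open>Transposition of principal values and uniqueness\<close>

text \<open>Skew-symmetry is exact for conjugate Poisson integrals, so both sides are regularised
  and y tends to 0. On the side of v no majorant is available and the uniform L^q bound takes its
  place; on the side of h the truncations are uniformly bounded, and M |v| dominates.\<close>

lemma pv_transposition:
  fixes v V h H :: "real \<Rightarrow> complex" and q :: real
  assumes q: "1 < q" "q < 2" and vm: "v \<in> borel_measurable leb_I"
    and vq: "integrable leb_I (\<lambda>x. norm (v x) powr q)"
    and V: "AE t in leb_I. has_pv v t (V t)"
    and Vm: "V \<in> borel_measurable leb_I" and Vq: "integrable leb_I (\<lambda>x. norm (V x) powr q)"
    and hm: "h \<in> borel_measurable leb_I" and hb: "\<And>t. norm (h t) \<le> B"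
    and H: "AE t in leb_I. has_pv h t (H t)"
    and hM: "\<And>\<epsilon> t. 0 < \<epsilon> \<Longrightarrow> t \<in> {-1<..<1} \<Longrightarrow> norm (trunc_hilbert \<epsilon> h t) \<le> M"
    and Hm: "H \<in> borel_measurable leb_I"
  shows "(\<integral>x. V x * h x \<partial>leb_I) = - (\<integral>x. v x * H x \<partial>leb_I)"
proof -
  have vi: "integrable leb_I v" using q by (intro integrable_of_powr[OF _ vm vq]) simp
  have hi: "integrable leb_I h"
    by (rule leb_I.integrable_const_bound[where B=B]) (use hm hb in auto)
  let ?y = "\<lambda>n. 1 / real (Suc n)"
  obtain C where C: "\<And>y. 0 < y \<Longrightarrow> integrable leb_I (\<lambda>t. norm (conj_poisson y v t) powr q)"
    "\<And>y. 0 < y \<Longrightarrow> (\<integral>t. norm (conj_poisson y v t) powr q \<partial>leb_I) \<le> C"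
    using conj_poisson_Lq[OF q vm vq] by blast
  have prod_le: "norm (w * h t) powr q \<le> B powr q * norm w powr q" for w t
  proof -
    have "norm (w * h t) powr q \<le> (B * norm w) powr q"
      using mult_right_mono[OF hb[of t], of "norm w"] q
      by (intro powr_mono2) (auto simp: norm_mult mult.commute)
    also have "\<dots> = B powr q * norm w powr q" by (rule powr_mult)
    finally show ?thesis .
  qed
  have prod_int: "integrable leb_I (\<lambda>t. norm (w t * h t) powr q)"
    if "w \<in> borel_measurable leb_I" "integrable leb_I (\<lambda>t. norm (w t) powr q)" for w :: "real \<Rightarrow> complex"
  proof (rule Bochner_Integration.integrable_bound[OF integrable_mult_right[OF that(2), of "B powr q"]])
    show "(\<lambda>t. norm (w t * h t) powr q) \<in> borel_measurable leb_I" using that(1) hm by measurable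
    show "AE t in leb_I. norm (norm (w t * h t) powr q) \<le> norm (B powr q * norm (w t) powr q)"
      using prod_le by (intro AE_I2) simp
  qed
  have cm: "conj_poisson (?y n) v \<in> borel_measurable leb_I" for n
    using integrable_conj_poisson[OF vi, of "?y n"] by simp
  have L1: "(\<lambda>n. \<integral>t. conj_poisson (?y n) v t * h t \<partial>leb_I) \<longlonglongrightarrow> (\<integral>t. V t * h t \<partial>leb_I)"
  proof (rule Lq_bounded_convergence[OF q(1), where C="B powr q * C"])
    show "AE t in leb_I. (\<lambda>n. conj_poisson (?y n) v t * h t) \<longlonglongrightarrow> V t * h t"
      using V by eventually_elim (intro tendsto_mult_right conj_poisson_tendsto_pv vi)
    show "integrable leb_I (\<lambda>t. norm (conj_poisson (?y n) v t * h t) powr q)" for n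
      by (rule prod_int[OF cm]) (use C(1) in simp)
    show "(\<integral>t. norm (conj_poisson (?y n) v t * h t) powr q \<partial>leb_I) \<le> B powr q * C" for n
    proof -
      have "(\<integral>t. norm (conj_poisson (?y n) v t * h t) powr q \<partial>leb_I) \<le> (\<integral>t. B powr q * norm (conj_poisson (?y n) v t) powr q \<partial>leb_I)"
        by (rule integral_mono[OF prod_int[OF cm] integrable_mult_right]) (use C(1) prod_le in auto)
      also have "\<dots> = B powr q * (\<integral>t. norm (conj_poisson (?y n) v t) powr q \<partial>leb_I)" by simp
      also have "\<dots> \<le> B powr q * C" by (intro mult_left_mono C(2)) auto
      finally show ?thesis .
    qed
    show "integrable leb_I (\<lambda>t. norm (V t * h t) powr q)" by (rule prod_int[OF Vm Vq])
  qed (use cm hm Vm in \<open>auto intro: borel_measurable_times\<close>)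
  have L2: "(\<lambda>n. \<integral>x. v x * conj_poisson (?y n) h x \<partial>leb_I) \<longlonglongrightarrow> (\<integral>x. v x * H x \<partial>leb_I)"
  proof (rule integral_dominated_convergence[where w="\<lambda>x. M * norm (v x)"])
    show "AE x in leb_I. (\<lambda>n. v x * conj_poisson (?y n) h x) \<longlonglongrightarrow> v x * H x"
      using H by eventually_elim (intro tendsto_mult_left conj_poisson_tendsto_pv hi)
    show "AE x in leb_I. norm (v x * conj_poisson (?y n) h x) \<le> M * norm (v x)" for n
      using AE_leb_I_in
    proof eventually_elim
      case (elim x)
      have "norm (conj_poisson (?y n) h x) \<le> M"
        by (rule conj_poisson_bound[OF hi]) (use elim in \<open>auto intro!: hM\<close>)
      from mult_right_mono[OF this norm_ge_zero[of "v x"]] show ?case by (simp only: norm_mult mult.commute)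
    qed
    show "(\<lambda>x. v x * conj_poisson (?y n) h x) \<in> borel_measurable leb_I" for n
      using vm integrable_conj_poisson[OF hi, of "?y n"] by (intro borel_measurable_times) auto
  qed (use vi vm Hm in \<open>auto intro: borel_measurable_times\<close>)
  have "(\<lambda>n. \<integral>t. conj_poisson (?y n) v t * h t \<partial>leb_I) \<longlonglongrightarrow> - (\<integral>x. v x * H x \<partial>leb_I)"
    using tendsto_minus[OF L2] conj_poisson_Fubini(1)[OF vi _ hm hb, of "?y _"] by simp
  from LIMSEQ_unique[OF L1 this] show ?thesis .
qed

lemma integrable_leb_I_reflect:
  fixes f :: "real \<Rightarrow> real"
  assumes "integrable leb_I f" shows "integrable leb_I (\<lambda>x. f (- x))"
proof -
  have i: "integrable leb_I g \<longleftrightarrow> g absolutely_integrable_on {-1<..<1}" for g :: "real \<Rightarrow> real"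
    by (subst integrable_restrict_space) (auto simp: set_integrable_def)
  have "(\<lambda>x. f (- x)) absolutely_integrable_on {-1<..<1}"
    using has_absolute_integral_reflect_real[of "{-1<..<1}" "{-1<..<1}" f] assms i[of f] by auto
  then show ?thesis by (simp add: i)
qed

section \<open>Integrability and weighted bounds for the eigenfunctions\<close>

lemma norm_hilbert_eigenfun: "norm (hilbert_eigenfun \<gamma> x) = 1 / \<bar>sqrt (1 - x\<^sup>2)\<bar>"
  by (simp add: hilbert_eigenfun_def norm_divide)

text \<open>The modulus grows like the power -1/2 of the distance to the endpoints, so its q-th
  power is integrable for q < 2. The two summands of the majorant account for one endpoint
  each.\<close>

lemma hilbert_eigenfun_Lq:
  assumes q: "1 < q" "q < 2"
  shows "integrable leb_I (\<lambda>x. norm (hilbert_eigenfun \<gamma> x) powr q)"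
proof (rule Bochner_Integration.integrable_bound)
  have e: "integrable leb_I (\<lambda>x. (1 - x) powr (-(q/2)))"
    by (rule integrable_powr_endpoint) (use q in auto)
  show "integrable leb_I (\<lambda>x. (1 - x) powr (-(q/2)) + (1 - (- x)) powr (-(q/2)))"
    by (rule Bochner_Integration.integrable_add[OF e integrable_leb_I_reflect[OF e]])
  show "(\<lambda>x. norm (hilbert_eigenfun \<gamma> x) powr q) \<in> borel_measurable leb_I"
    using integrable_hilbert_eigenfun by measurable
  show "AE x in leb_I. norm (norm (hilbert_eigenfun \<gamma> x) powr q) \<le> norm ((1 - x) powr (-(q/2)) + (1 - (- x)) powr (-(q/2)))"
    using AE_leb_I_in
  proof eventually_elim
    case (elim x)
    have pos: "0 < 1 - x" "0 < 1 + x" using elim by auto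
    have f: "1 - x\<^sup>2 = (1 - x) * (1 + x)" by (simp add: power2_eq_square algebra_simps)
    have p: "0 < 1 - x\<^sup>2" unfolding f using pos by simp
    have "(1 - x\<^sup>2) powr (-(1/2)) = 1 / sqrt (1 - x\<^sup>2)"
      unfolding powr_minus_divide powr_half_sqrt[OF less_imp_le[OF p]] ..
    then have "norm (hilbert_eigenfun \<gamma> x) = (1 - x\<^sup>2) powr (-(1/2))"
      using p by (simp only: norm_hilbert_eigenfun abs_of_pos real_sqrt_gt_zero)
    then have "norm (hilbert_eigenfun \<gamma> x) powr q = (1 - x\<^sup>2) powr (-(q/2))" by (simp only: powr_powr) simp
    also have "\<dots> \<le> (1 - x) powr (-(q/2)) + (1 + x) powr (-(q/2))"
    proof (cases "x \<ge> 0")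
      case True
      then have "1 - x \<le> 1 - x\<^sup>2" using pos mult_left_le[of x x] by (simp add: power2_eq_square)
      then have "(1 - x\<^sup>2) powr (-(q/2)) \<le> (1 - x) powr (-(q/2))"
        using pos q by (intro powr_mono2') auto
      then show ?thesis by (simp add: add_increasing2)
    next
      case False
      then have "x * x \<le> - x" using pos mult_right_mono_neg[of "-1" x x] by simp
      then have "1 + x \<le> 1 - x\<^sup>2" by (simp add: power2_eq_square)
      then have "(1 - x\<^sup>2) powr (-(q/2)) \<le> (1 + x) powr (-(q/2))"
        using pos q by (intro powr_mono2') auto
      then show ?thesis by (simp add: add_increasing)
    qed
    finally show ?case by simp
  qed
qed

lemma ln_le_sqrt: "0 < x \<Longrightarrow> ln x \<le> 2 * sqrt x" for x :: real
  using ln_le_minus_one[of "sqrt x"] by (simp add: ln_sqrt)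

text \<open>If both t - \<epsilon> and t + \<epsilon> lie inside the interval, the explicit
  logarithms apply; otherwise \<epsilon> is at least the distance s to the endpoints and the crude
  bound of order 1 / s is cancelled by the weight.\<close>

lemma weighted_trunc_hilbert_eigenfun_0_bound:
  obtains C where "\<And>\<epsilon> t. 0 < \<epsilon> \<Longrightarrow> -1 < t \<Longrightarrow> t < 1 \<Longrightarrow> (1 - t\<^sup>2) * norm (trunc_hilbert \<epsilon> (hilbert_eigenfun 0) t) \<le> C"
proof -
  define I0 where "I0 = (\<integral>x. norm (hilbert_eigenfun 0 x) \<partial>leb_I)"
  have I0: "0 \<le> I0" by (simp add: I0_def)
  have "(1 - t\<^sup>2) * norm (trunc_hilbert \<epsilon> (hilbert_eigenfun 0) t) \<le> 4 + 2 * I0"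
    if e: "0 < \<epsilon>" and t: "-1 < t" "t < 1" for \<epsilon> t
  proof -
    \<comment> \<open>The weight is at most 2 s. Since the logarithms are estimated by ln (2 / s)
      \<le> 2 sqrt (2 / s), half of the weight compensates them and the other half the factor 1 /
      sqrt (1 - t^2).\<close>
    define s where "s = 1 - \<bar>t\<bar>"
    have s: "0 < s" "s \<le> 1" using t by (auto simp: s_def)
    have "1 - t\<^sup>2 = s * (1 + \<bar>t\<bar>)" by (simp add: s_def power2_eq_square algebra_simps)
    moreover have "s * (1 + \<bar>t\<bar>) \<le> s * 2" using s t by (intro mult_left_mono) auto
    moreover have "0 < s * (1 + \<bar>t\<bar>)" using s by (simp add: add_pos_nonneg)
    ultimately have t2: "0 < 1 - t\<^sup>2" "1 - t\<^sup>2 \<le> s * 2" by simp_all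
    show ?thesis
    proof (cases "\<epsilon> < s")
      case True
      define w where "w = sqrt (1 - t\<^sup>2)"
      have w: "0 < w" "w * w = 1 - t\<^sup>2" using t2 by (simp_all add: w_def)
      have ws: "w \<le> sqrt (2 * s)" using t2 by (simp add: w_def mult.commute)
      have te: "-1 < t - \<epsilon>" "t + \<epsilon> < 1" using True by (auto simp: s_def)
      let ?D = "arc_kernel t"
      have D: "s \<le> ?D x" "?D x \<le> 2" if "\<bar>x\<bar> \<le> 1" for x
        using arc_kernel_bounds[of t x] that t by (auto simp: s_def)
      have lnD: "ln s \<le> ln (?D x)" "ln (?D x) \<le> ln 2" if "\<bar>x\<bar> \<le> 1" for x
        using D[OF that] s by auto
      have "\<bar>ln (?D (t + \<epsilon>)) - ln (?D (t - \<epsilon>))\<bar> \<le> ln 2 - ln s"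
        using lnD[of "t + \<epsilon>"] lnD[of "t - \<epsilon>"] te e by (auto simp: abs_le_iff)
      also have "\<dots> = ln (2 / s)" using s by (simp add: ln_div)
      also have "\<dots> \<le> 2 * sqrt (2 / s)" using s by (intro ln_le_sqrt) simp
      finally have l: "\<bar>ln (?D (t + \<epsilon>)) - ln (?D (t - \<epsilon>))\<bar> \<le> 2 * sqrt (2 / s)" .
      have "norm (trunc_hilbert \<epsilon> (hilbert_eigenfun 0) t) = \<bar>ln (?D (t + \<epsilon>)) - ln (?D (t - \<epsilon>))\<bar> / w"
        unfolding trunc_hilbert_eigenfun_0[OF t e te] w_def[symmetric]
        using w(1) by (simp only: norm_of_real abs_divide abs_of_pos)
      then have "(1 - t\<^sup>2) * norm (trunc_hilbert \<epsilon> (hilbert_eigenfun 0) t)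
          = w * w * (\<bar>ln (?D (t + \<epsilon>)) - ln (?D (t - \<epsilon>))\<bar> / w)"
        by (simp only: w(2))
      also have "\<dots> = w * \<bar>ln (?D (t + \<epsilon>)) - ln (?D (t - \<epsilon>))\<bar>" using w(1) by simp
      also have "\<dots> \<le> sqrt (2 * s) * (2 * sqrt (2 / s))"
        using ws l s w(1) by (intro mult_mono) auto
      also have "\<dots> = 2 * sqrt ((2 * s) * (2 / s))"
        unfolding real_sqrt_mult[of "2 * s" "2 / s"] by (simp only: mult_ac)
      also have "(2 * s) * (2 / s) = 2\<^sup>2" using s by (simp add: power2_eq_square)
      also have "2 * sqrt (2\<^sup>2) \<le> 4 + 2 * I0" using I0 by simp
      finally show ?thesis .
    next
      case False
      have "norm (trunc_hilbert \<epsilon> (hilbert_eigenfun 0) t) \<le> I0 / \<epsilon>"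
        unfolding I0_def by (rule trunc_hilbert_bound[OF integrable_hilbert_eigenfun e])
      also have "\<dots> \<le> I0 / s" using False s I0 by (intro divide_left_mono mult_pos_pos e) auto
      finally have "(1 - t\<^sup>2) * norm (trunc_hilbert \<epsilon> (hilbert_eigenfun 0) t) \<le> (s * 2) * (I0 / s)"
        using t2 s by (intro mult_mono) auto
      also have "\<dots> = 2 * I0" using s by simp
      finally show ?thesis by simp
    qed
  qed
  then show thesis using that by blast
qed

text \<open>The difference from a multiple of f_0 is estimated by its absolute integral, |f_\<gamma>
  (t)| times a constant, which the weight turns into sqrt (1 - t^2) times that constant.\<close>

lemma weighted_trunc_hilbert_eigenfun_bound:
  obtains C where "\<And>\<epsilon> t. 0 < \<epsilon> \<Longrightarrow> -1 < t \<Longrightarrow> t < 1 \<Longrightarrow> (1 - t\<^sup>2) * norm (trunc_hilbert \<epsilon> (hilbert_eigenfun \<gamma>) t) \<le> C"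
proof -
  obtain C0 where C0: "\<And>\<epsilon> t. 0 < \<epsilon> \<Longrightarrow> -1 < t \<Longrightarrow> t < 1 \<Longrightarrow> (1 - t\<^sup>2) * norm (trunc_hilbert \<epsilon> (hilbert_eigenfun 0) t) \<le> C0"
    using weighted_trunc_hilbert_eigenfun_0_bound by blast
  define S where "S = integral UNIV (\<lambda>r. norm (sinh_kernel \<gamma> r))"
  have "(1 - t\<^sup>2) * norm (trunc_hilbert \<epsilon> (hilbert_eigenfun \<gamma>) t) \<le> S + C0"
    if e: "0 < \<epsilon>" and t: "-1 < t" "t < 1" for \<epsilon> t
  proof -
    let ?c = "cis (2 * \<gamma> * artanh t)"
    let ?d = "\<lambda>x. hilbert_eigenfun \<gamma> x - ?c * hilbert_eigenfun 0 x"
    note d = hilbert_eigenfun_difference_integral[OF t, of \<gamma>]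
    have t2: "0 < 1 - t\<^sup>2" using t by (simp add: abs_square_less_1 abs_less_iff)
    have di: "integrable leb_I ?d"
      by (intro Bochner_Integration.integrable_diff integrable_mult_right integrable_hilbert_eigenfun)
    have S0: "0 \<le> S"
    proof -
      have "0 \<le> (\<integral>x. norm (?d x / of_real (x - t)) \<partial>leb_I)" by simp
      then have "0 \<le> norm (hilbert_eigenfun \<gamma> t) * S" unfolding d(3) S_def .
      then show ?thesis using t2 by (simp add: norm_hilbert_eigenfun zero_le_divide_iff)
    qed
    have "trunc_hilbert \<epsilon> (\<lambda>x. ?d x + ?c * hilbert_eigenfun 0 x) t = trunc_hilbert \<epsilon> ?d t + trunc_hilbert \<epsilon> (\<lambda>x. ?c * hilbert_eigenfun 0 x) t"
      by (rule trunc_hilbert_add[OF di _ e]) (intro integrable_mult_right integrable_hilbert_eigenfun)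
    then have split: "trunc_hilbert \<epsilon> (hilbert_eigenfun \<gamma>) t = trunc_hilbert \<epsilon> ?d t + ?c * trunc_hilbert \<epsilon> (hilbert_eigenfun 0) t"
      unfolding trunc_hilbert_cmult by simp
    have "norm (trunc_hilbert \<epsilon> ?d t) \<le> (\<integral>x. norm (if \<epsilon> \<le> \<bar>x - t\<bar> then ?d x / of_real (x - t) else 0) \<partial>leb_I)"
      unfolding trunc_hilbert_def by (rule integral_norm_bound)
    also have "\<dots> \<le> (\<integral>x. norm (?d x / of_real (x - t)) \<partial>leb_I)"
      by (rule integral_mono[OF integrable_norm[OF trunc_kernel_integrable[OF di e]] integrable_norm[OF d(1)]]) auto
    also have "\<dots> = norm (hilbert_eigenfun \<gamma> t) * S" unfolding S_def by (rule d(3))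
    finally have "norm (trunc_hilbert \<epsilon> ?d t) \<le> norm (hilbert_eigenfun \<gamma> t) * S" .
    then have "(1 - t\<^sup>2) * norm (trunc_hilbert \<epsilon> ?d t) \<le> (1 - t\<^sup>2) * (norm (hilbert_eigenfun \<gamma> t) * S)"
      using t2 by (intro mult_left_mono) auto
    also have "\<dots> = sqrt (1 - t\<^sup>2) * S"
    proof -
      have "(w * w) * (1 / \<bar>w\<bar> * S) = w * S" if "0 < w" for w :: real using that by simp
      from this[of "sqrt (1 - t\<^sup>2)"] show ?thesis using t2 by (simp add: norm_hilbert_eigenfun)
    qed
    also have "\<dots> \<le> 1 * S" using S0 by (intro mult_right_mono) auto
    finally have 1: "(1 - t\<^sup>2) * norm (trunc_hilbert \<epsilon> ?d t) \<le> S" by simp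
    have "norm (trunc_hilbert \<epsilon> (hilbert_eigenfun \<gamma>) t) \<le> norm (trunc_hilbert \<epsilon> ?d t) + norm (trunc_hilbert \<epsilon> (hilbert_eigenfun 0) t)"
      unfolding split using norm_triangle_ineq[of "trunc_hilbert \<epsilon> ?d t" "?c * trunc_hilbert \<epsilon> (hilbert_eigenfun 0) t"]
      by (simp add: norm_mult)
    then have "(1 - t\<^sup>2) * norm (trunc_hilbert \<epsilon> (hilbert_eigenfun \<gamma>) t)
       \<le> (1 - t\<^sup>2) * (norm (trunc_hilbert \<epsilon> ?d t) + norm (trunc_hilbert \<epsilon> (hilbert_eigenfun 0) t))"
      using t2 by (intro mult_left_mono) auto
    then show ?thesis using 1 C0[OF e t] by (simp only: distrib_left)
  qed
  then show thesis using that by blast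
qed

text \<open>The quantitative form of \<open>has_pv_poly_factor\<close>, uniform in the
  cut-off.\<close>

lemma trunc_hilbert_poly_factor_bound:
  assumes f: "integrable leb_I f"
    and PQ: "\<And>x. P x - P t = (x - t) * Q x" and Qm: "Q \<in> borel_measurable leb_I"
    and Qb: "\<And>x. -1 < x \<Longrightarrow> x < 1 \<Longrightarrow> \<bar>Q x\<bar> \<le> B" and B: "0 \<le> B" and e: "0 < \<epsilon>"
  shows "norm (trunc_hilbert \<epsilon> (\<lambda>x. of_real (P x) * f x) t)
     \<le> \<bar>P t\<bar> * norm (trunc_hilbert \<epsilon> f t) + B * (\<integral>x. norm (f x) \<partial>leb_I)"
proof -
  let ?q = "\<lambda>x. if \<epsilon> \<le> \<bar>x - t\<bar> then complex_of_real (Q x) else 0"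
  have qm: "?q \<in> borel_measurable leb_I" using Qm by measurable
  have nq: "norm (?q x) \<le> B" if "x \<in> {-1<..<1}" for x using Qb[of x] B that by auto
  have iq: "integrable leb_I (\<lambda>x. f x * ?q x)"
  proof (rule Bochner_Integration.integrable_bound[OF integrable_mult_right[OF f, of "of_real B"]])
    show "(\<lambda>x. f x * ?q x) \<in> borel_measurable leb_I" using f qm by (intro borel_measurable_times) auto
    show "AE x in leb_I. norm (f x * ?q x) \<le> norm (of_real B * f x)"
      using AE_leb_I_in
    proof eventually_elim
      case (elim x)
      then have "norm (?q x) \<le> B" by (intro nq) auto
      from mult_left_mono[OF this, of "norm (f x)"] show ?case using B by (simp only: norm_mult norm_of_real abs_of_nonneg norm_ge_zero mult.commute)
    qed
  qed
  have "(if \<epsilon> \<le> \<bar>x - t\<bar> then of_real (P x) * f x / of_real (x - t) else 0)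
     = of_real (P t) * (if \<epsilon> \<le> \<bar>x - t\<bar> then f x / of_real (x - t) else 0) + f x * ?q x" for x
  proof (cases "\<epsilon> \<le> \<bar>x - t\<bar>")
    case True
    then have nz: "complex_of_real (x - t) \<noteq> 0" using e by auto
    have "P x = P t + (x - t) * Q x" using PQ[of x] by simp
    then have "complex_of_real (P x) = of_real (P t) + of_real (x - t) * of_real (Q x)" by (simp only: of_real_add of_real_mult)
    then have "of_real (P x) * f x / of_real (x - t) = of_real (P t) * (f x / of_real (x - t)) + f x * of_real (Q x)"
      using nz by (simp only: distrib_right add_divide_distrib) (simp add: field_simps del: of_real_diff)
    then show ?thesis using True by simp
  qed simp
  then have "trunc_hilbert \<epsilon> (\<lambda>x. of_real (P x) * f x) t = of_real (P t) * trunc_hilbert \<epsilon> f t + (\<integral>x. f x * ?q x \<partial>leb_I)"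
    unfolding trunc_hilbert_def
    by (simp only: Bochner_Integration.integral_add integrable_mult_right trunc_kernel_integrable[OF f e] iq integral_mult_right_zero)
  also have "norm \<dots> \<le> norm (of_real (P t) * trunc_hilbert \<epsilon> f t) + norm (\<integral>x. f x * ?q x \<partial>leb_I)"
    by (rule norm_triangle_ineq)
  also have "norm (\<integral>x. f x * ?q x \<partial>leb_I) \<le> B * (\<integral>x. norm (f x) \<partial>leb_I)"
    by (rule integral_bound_kernel[OF f qm nq B])
  finally show ?thesis by (simp add: norm_mult)
qed

section \<open>Determinacy by moments\<close>

text \<open>The sign of a is an almost everywhere limit of continuous functions. Clipped to [-1, 1]
  these keep their limit, have a majorant against a, and test the integral of |a|.\<close>

lemma AE_zero_of_continuous_orthogonal:
  fixes a :: "real \<Rightarrow> real"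
  assumes a: "integrable leb_I a"
    and orth: "\<And>f. continuous_on UNIV f \<Longrightarrow> (\<integral>x. a x * f x \<partial>leb_I) = 0"
  shows "AE x in leb_I. a x = 0"
proof -
  define s where "s = (\<lambda>x. if x \<in> {-1<..<1} then sgn (a x) else 0)"
  have "(\<lambda>x. sgn (a x)) \<in> borel_measurable leb_I"
    using measurable_compose[OF borel_measurable_integrable[OF a] borel_measurable_sgn] .
  then have "s \<in> borel_measurable lebesgue"
    unfolding s_def by (subst borel_measurable_if) auto
  then have "s measurable_on UNIV" by (rule lebesgue_measurable_imp_measurable_on) simp
  then obtain Z g where Z: "negligible Z" and g: "\<And>n. continuous_on UNIV (g n)"
    and lim: "\<And>x. x \<notin> Z \<Longrightarrow> (\<lambda>n. g n x) \<longlonglongrightarrow> s x"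
    by (auto simp: measurable_on_def)
  let ?h = "\<lambda>n x. max (-1) (min 1 (g n x))"
  have ch: "continuous_on UNIV (?h n)" for n by (intro continuous_intros g)
  have hm: "?h n \<in> borel_measurable leb_I" for n
    by (rule borel_measurable_leb_I) (rule borel_measurable_continuous_onI[OF ch])
  have aeZ: "AE x in leb_I. x \<notin> Z"
  proof -
    have "AE x in lebesgue. x \<notin> Z" using Z by (intro AE_not_in) (simp add: negligible_iff_null_sets)
    then show ?thesis by (subst AE_restrict_space_iff) auto
  qed
  have "(\<lambda>n. \<integral>x. a x * ?h n x \<partial>leb_I) \<longlonglongrightarrow> (\<integral>x. \<bar>a x\<bar> \<partial>leb_I)"
  proof (rule integral_dominated_convergence[where w="\<lambda>x. \<bar>a x\<bar>"])
    show "AE x in leb_I. (\<lambda>n. a x * ?h n x) \<longlonglongrightarrow> \<bar>a x\<bar>"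
      using aeZ AE_leb_I_in
    proof eventually_elim
      case (elim x)
      have "(\<lambda>n. ?h n x) \<longlonglongrightarrow> max (-1) (min 1 (s x))"
        by (intro tendsto_intros lim) (use elim in auto)
      then have "(\<lambda>n. a x * ?h n x) \<longlonglongrightarrow> a x * max (-1) (min 1 (s x))" by (rule tendsto_mult_left)
      moreover have "a x * max (-1) (min 1 (s x)) = \<bar>a x\<bar>" using elim by (auto simp: s_def sgn_if)
      ultimately show ?case by simp
    qed
    show "AE x in leb_I. norm (a x * ?h n x) \<le> \<bar>a x\<bar>" for n
      by (intro AE_I2) (auto simp: abs_mult intro!: mult_left_le)
  qed (use a hm in auto)
  then have "(\<lambda>n. 0) \<longlonglongrightarrow> (\<integral>x. \<bar>a x\<bar> \<partial>leb_I)"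
    by (simp only: orth[OF ch])
  then have "(\<integral>x. \<bar>a x\<bar> \<partial>leb_I) = 0"
    by (rule LIMSEQ_unique[OF _ tendsto_const])
  then show ?thesis using a integral_nonneg_eq_0_iff_AE[of leb_I "\<lambda>x. \<bar>a x\<bar>"] by simp
qed

lemma AE_zero_of_real_moments_zero:
  fixes a :: "real \<Rightarrow> real"
  assumes a: "integrable leb_I a" and mom: "\<And>n. (\<integral>x. a x * x ^ n \<partial>leb_I) = 0"
  shows "AE x in leb_I. a x = 0"
proof (rule AE_zero_of_continuous_orthogonal[OF a])
  have ib: "integrable leb_I (\<lambda>x. a x * f x)"
    if "f \<in> borel_measurable leb_I" "\<And>x. -1 < x \<Longrightarrow> x < 1 \<Longrightarrow> \<bar>f x\<bar> \<le> B" for f B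
  proof (rule Bochner_Integration.integrable_bound[OF integrable_mult_right[OF a, of "\<bar>B\<bar>"]])
    show "AE x in leb_I. norm (a x * f x) \<le> norm (\<bar>B\<bar> * a x)"
      using AE_leb_I_in
    proof eventually_elim
      case (elim x)
      then have "\<bar>f x\<bar> \<le> \<bar>B\<bar>" using that(2)[of x] by simp
      from mult_left_mono[OF this, of "\<bar>a x\<bar>"] show ?case by (simp add: abs_mult mult.commute)
    qed
  qed (use a that(1) in auto)
  fix f :: "real \<Rightarrow> real" assume f: "continuous_on UNIV f"
  let ?A = "\<integral>x. \<bar>a x\<bar> \<partial>leb_I"
  have "\<bar>\<integral>x. a x * f x \<partial>leb_I\<bar> \<le> e" if e: "0 < e" for e
  proof -
    define \<delta> where "\<delta> = e / (?A + 1)"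
    have A: "0 \<le> ?A" by simp
    have A1: "0 < ?A + 1" using A by linarith
    have \<delta>: "0 < \<delta>" unfolding \<delta>_def using e A1 by (rule divide_pos_pos)
    obtain p where p: "real_polynomial_function p" "\<And>x. x \<in> {-1..1} \<Longrightarrow> \<bar>f x - p x\<bar> < \<delta>"
      using Stone_Weierstrass_real_polynomial_function[of "{-1..1::real}" f \<delta>] f \<delta>
      by (auto intro: continuous_on_subset)
    obtain b n where pb: "p = (\<lambda>x. \<Sum>i\<le>n. b i * x ^ i)"
      using p(1) unfolding real_polynomial_function_iff_sum by blast
    have mi: "integrable leb_I (\<lambda>x. a x * x ^ i)" for i
      by (rule ib[where B=1]) (auto intro!: borel_measurable_leb_I simp: power_abs power_le_one)
    have "(\<integral>x. a x * p x \<partial>leb_I) = (\<integral>x. (\<Sum>i\<le>n. b i * (a x * x ^ i)) \<partial>leb_I)"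
      unfolding pb by (simp add: sum_distrib_left mult_ac)
    also have "\<dots> = (\<Sum>i\<le>n. b i * (\<integral>x. a x * x ^ i \<partial>leb_I))"
      by (subst Bochner_Integration.integral_sum) (auto intro: mi)
    finally have p0: "(\<integral>x. a x * p x \<partial>leb_I) = 0" using mom by simp
    have fm: "f \<in> borel_measurable leb_I"
      by (rule borel_measurable_leb_I) (rule borel_measurable_continuous_onI[OF f])
    have pm: "p \<in> borel_measurable leb_I" unfolding pb by (rule borel_measurable_leb_I) measurable
    have id: "integrable leb_I (\<lambda>x. a x * (f x - p x))"
      by (rule ib[where B=\<delta>]) (use fm pm p(2) in \<open>auto intro: less_imp_le\<close>)
    have ip: "integrable leb_I (\<lambda>x. a x * p x)"
      unfolding pb by (simp add: sum_distrib_left mult.left_commute[of "a _"]) (intro Bochner_Integration.integrable_sum integrable_mult_right mi)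
    have "(\<integral>x. a x * f x \<partial>leb_I) = (\<integral>x. a x * (f x - p x) + a x * p x \<partial>leb_I)"
      by (simp add: algebra_simps)
    also have "\<dots> = (\<integral>x. a x * (f x - p x) \<partial>leb_I)"
      using id ip p0 by simp
    also have "\<bar>\<dots>\<bar> \<le> (\<integral>x. \<bar>a x * (f x - p x)\<bar> \<partial>leb_I)"
      by (rule integral_abs_bound)
    also have "\<dots> \<le> (\<integral>x. \<delta> * \<bar>a x\<bar> \<partial>leb_I)"
    proof (rule integral_mono_AE)
      show "AE x in leb_I. \<bar>a x * (f x - p x)\<bar> \<le> \<delta> * \<bar>a x\<bar>"
        using AE_leb_I_in
      proof eventually_elim
        case (elim x)
        then have "\<bar>f x - p x\<bar> \<le> \<delta>" using p(2)[of x] by simp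
        from mult_left_mono[OF this, of "\<bar>a x\<bar>"] show ?case by (simp add: abs_mult mult.commute)
      qed
    qed (use id a in auto)
    also have "\<dots> = \<delta> * ?A" by simp
    also have "\<dots> \<le> \<delta> * (?A + 1)" using \<delta> by simp
    also have "\<dots> = e" using A1 by (simp add: \<delta>_def)
    finally show ?thesis .
  qed
  then have "\<bar>\<integral>x. a x * f x \<partial>leb_I\<bar> \<le> 0" by (rule field_le_epsilon[of _ 0, simplified])
  then show "(\<integral>x. a x * f x \<partial>leb_I) = 0" by simp
qed

lemma AE_zero_of_moments_zero:
  fixes v :: "real \<Rightarrow> complex"
  assumes v: "integrable leb_I v" and mom: "\<And>n. (\<integral>x. v x * of_real (x ^ n) \<partial>leb_I) = 0"
  shows "AE x in leb_I. v x = 0"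
proof -
  have i: "integrable leb_I (\<lambda>x. v x * complex_of_real (x ^ n))" for n
  proof (rule Bochner_Integration.integrable_bound[OF v])
    show "(\<lambda>x. v x * complex_of_real (x ^ n)) \<in> borel_measurable leb_I"
      using v by (intro borel_measurable_times) (auto intro!: borel_measurable_leb_I)
    show "AE x in leb_I. norm (v x * complex_of_real (x ^ n)) \<le> norm (v x)"
      using AE_leb_I_in by eventually_elim (auto simp: norm_mult norm_power abs_le_iff intro!: mult_left_le power_le_one)
  qed
  have re: "Re (v x * complex_of_real (x ^ n)) = Re (v x) * x ^ n" "Im (v x * complex_of_real (x ^ n)) = Im (v x) * x ^ n" for x n
    by simp_all
  have "AE x in leb_I. Re (v x) = 0"
    by (rule AE_zero_of_real_moments_zero) (use v integral_Re[OF i] mom in \<open>simp_all only: re, simp_all\<close>)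
  moreover have "AE x in leb_I. Im (v x) = 0"
    by (rule AE_zero_of_real_moments_zero) (use v integral_Im[OF i] mom in \<open>simp_all only: re, simp_all\<close>)
  ultimately show ?thesis by eventually_elim (simp add: complex_eq_iff)
qed

section \<open>One-dimensionality of the kernel\<close>

lemma trunc_hilbert_cong:
  assumes "\<And>x. -1 < x \<Longrightarrow> x < 1 \<Longrightarrow> u x = w x"
  shows "trunc_hilbert \<epsilon> u t = trunc_hilbert \<epsilon> w t"
  unfolding trunc_hilbert_def
  by (rule Bochner_Integration.integral_cong) (auto simp: space_restrict_space assms)

text \<open>The divided difference of (1 - x^2) x^n, written as a polynomial so that it is also
  defined at x = t.\<close>

definition diff_quot :: "nat \<Rightarrow> real \<Rightarrow> real \<Rightarrow> real" where
  "diff_quot n t x = (\<Sum>i<n. t ^ (n - Suc i) * x ^ i) - (\<Sum>i<n + 2. t ^ (n + 2 - Suc i) * x ^ i)"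

lemma diff_quot: "(1 - x\<^sup>2) * x ^ n - (1 - t\<^sup>2) * t ^ n = (x - t) * diff_quot n t x"
proof -
  have "(1 - x\<^sup>2) * x ^ n - (1 - t\<^sup>2) * t ^ n = (x ^ n - t ^ n) - (x ^ (n + 2) - t ^ (n + 2))"
    by (simp add: algebra_simps power_add power2_eq_square)
  also have "\<dots> = (x - t) * diff_quot n t x"
    unfolding power_diff_sumr2 diff_quot_def by (simp only: right_diff_distrib)
  finally show ?thesis .
qed

lemma diff_quot_bound:
  assumes "\<bar>t\<bar> \<le> 1" "\<bar>x\<bar> \<le> 1" shows "\<bar>diff_quot n t x\<bar> \<le> real (2 * n + 2)"
proof -
  have *: "\<bar>\<Sum>i<k. t ^ (k - Suc i) * x ^ i\<bar> \<le> real k" for k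
  proof -
    have "\<bar>\<Sum>i<k. t ^ (k - Suc i) * x ^ i\<bar> \<le> (\<Sum>i<k. \<bar>t ^ (k - Suc i) * x ^ i\<bar>)" by (rule sum_abs)
    also have "\<dots> \<le> (\<Sum>i<k. 1)"
      using assms by (intro sum_mono) (auto simp: abs_mult power_abs intro!: mult_le_one power_le_one)
    finally show ?thesis by simp
  qed
  have "\<bar>diff_quot n t x\<bar> \<le> \<bar>\<Sum>i<n. t ^ (n - Suc i) * x ^ i\<bar> + \<bar>\<Sum>i<n + 2. t ^ (n + 2 - Suc i) * x ^ i\<bar>"
    unfolding diff_quot_def by (rule abs_triangle_ineq4)
  also have "\<dots> \<le> real n + real (n + 2)" by (intro add_mono *)
  finally show ?thesis by simp
qed

lemma diff_quot_measurable: "(\<lambda>x. diff_quot n t x) \<in> borel_measurable leb_I"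
  unfolding diff_quot_def by (rule borel_measurable_leb_I) measurable

lemma integrable_bounded_mult:
  fixes f k :: "real \<Rightarrow> complex"
  assumes f: "integrable leb_I f" and k: "k \<in> borel_measurable leb_I"
    and b: "\<And>x. -1 < x \<Longrightarrow> x < 1 \<Longrightarrow> norm (k x) \<le> B"
  shows "integrable leb_I (\<lambda>x. k x * f x)"
proof (rule Bochner_Integration.integrable_bound[OF integrable_mult_right[OF f, of "of_real \<bar>B\<bar>"]])
  show "(\<lambda>x. k x * f x) \<in> borel_measurable leb_I" using f k by (intro borel_measurable_times) auto
  show "AE x in leb_I. norm (k x * f x) \<le> norm (of_real \<bar>B\<bar> * f x)"
    using AE_leb_I_in
  proof eventually_elim
    case (elim x)
    then have "norm (k x) \<le> \<bar>B\<bar>" using b[of x] by simp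
    then show ?case by (simp add: norm_mult mult_right_mono)
  qed
qed

lemma integrable_power_mult:
  fixes f :: "real \<Rightarrow> complex"
  assumes "integrable leb_I f" shows "integrable leb_I (\<lambda>x. of_real (x ^ i) * f x)"
  by (rule integrable_bounded_mult[OF assms, where B=1])
     (auto intro!: borel_measurable_leb_I power_le_one simp: norm_power)

lemma has_pv_diff_quot:
  assumes f: "integrable leb_I f" and pv: "has_pv f t L" and t: "-1 < t" "t < 1"
  shows "has_pv (\<lambda>x. of_real ((1 - x\<^sup>2) * x ^ n) * f x) t
    (of_real ((1 - t\<^sup>2) * t ^ n) * L + (\<integral>x. of_real (diff_quot n t x) * f x \<partial>leb_I))"
proof (rule has_pv_poly_factor[OF pv diff_quot f integrable_bounded_mult[OF f, where B="real (2 * n + 2)"]])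
  show "(\<lambda>x. complex_of_real (diff_quot n t x)) \<in> borel_measurable leb_I"
    using diff_quot_measurable[of n t] by measurable
  show "norm (complex_of_real (diff_quot n t x)) \<le> real (2 * n + 2)" if "-1 < x" "x < 1" for x
    unfolding norm_of_real by (rule diff_quot_bound) (use that t in auto)
qed

text \<open>As a function of t this is a polynomial of degree at most n + 1; the coefficient of t^(n
  + 1), from i = 0 in the second sum, is minus the integral of f.\<close>

lemma integral_diff_quot:
  fixes f :: "real \<Rightarrow> complex"
  assumes f: "integrable leb_I f"
  shows "(\<integral>x. of_real (diff_quot n t x) * f x \<partial>leb_I)
    = (\<Sum>i<n. of_real (t ^ (n - Suc i)) * (\<integral>x. of_real (x ^ i) * f x \<partial>leb_I))
      - (\<Sum>i<n + 2. of_real (t ^ (n + 2 - Suc i)) * (\<integral>x. of_real (x ^ i) * f x \<partial>leb_I))"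
proof -
  have sums: "integrable leb_I (\<lambda>x. \<Sum>i<k. of_real (t ^ (k - Suc i)) * (of_real (x ^ i) * f x))"
    "(\<integral>x. (\<Sum>i<k. of_real (t ^ (k - Suc i)) * (of_real (x ^ i) * f x)) \<partial>leb_I)
     = (\<Sum>i<k. of_real (t ^ (k - Suc i)) * (\<integral>x. of_real (x ^ i) * f x \<partial>leb_I))" for k
  proof -
    show "integrable leb_I (\<lambda>x. \<Sum>i<k. of_real (t ^ (k - Suc i)) * (of_real (x ^ i) * f x))"
      by (intro Bochner_Integration.integrable_sum integrable_mult_right integrable_power_mult[OF f])
    show "(\<integral>x. (\<Sum>i<k. of_real (t ^ (k - Suc i)) * (of_real (x ^ i) * f x)) \<partial>leb_I)
     = (\<Sum>i<k. of_real (t ^ (k - Suc i)) * (\<integral>x. of_real (x ^ i) * f x \<partial>leb_I))"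
      by (subst Bochner_Integration.integral_sum)
         (intro integrable_mult_right integrable_power_mult[OF f], simp only: integral_mult_right_zero)
  qed
  have "of_real (diff_quot n t x) * f x = (\<Sum>i<n. of_real (t ^ (n - Suc i)) * (of_real (x ^ i) * f x))
      - (\<Sum>i<n + 2. of_real (t ^ (n + 2 - Suc i)) * (of_real (x ^ i) * f x))" for x
    unfolding diff_quot_def of_real_diff of_real_sum left_diff_distrib sum_distrib_right of_real_mult mult.assoc ..
  then show ?thesis
    by (simp only: Bochner_Integration.integral_diff sums)
qed

text \<open>The parameter -\<gamma> is chosen because f_(-\<gamma>) has the opposite eigenvalue: by
  skew-symmetry the terms containing v h cancel and a polynomial is left. The weight 1 - x^2 makes
  the test function and its truncated transforms bounded, as \<open>pv_transposition\<close>
  demands.\<close>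

lemma hilbert_eigenfun_kernel_unique:
  fixes v :: "real \<Rightarrow> complex" and q :: real
  assumes q: "1 < q" "q < 2" and vm: "v \<in> borel_measurable leb_I"
    and vq: "integrable leb_I (\<lambda>x. norm (v x) powr q)"
    and pv: "AE t in leb_I. has_pv v t (\<i> * of_real (pi * tanh (pi * \<gamma>)) * v t)"
    and zero: "(\<integral>x. v x \<partial>leb_I) = 0"
  shows "AE x in leb_I. v x = 0"
proof -
  define T where "T = \<i> * complex_of_real (pi * tanh (pi * \<gamma>))"
  define f where "f = hilbert_eigenfun (-\<gamma>)"
  have vi: "integrable leb_I v" using q by (intro integrable_of_powr[OF _ vm vq]) simp
  have fi: "integrable leb_I f" unfolding f_def by (rule integrable_hilbert_eigenfun)
  have fm: "f \<in> borel_measurable leb_I" using fi by simp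
  have fpv: "has_pv f t (- T * f t)" if "-1 < t" "t < 1" for t
    using has_pv_hilbert_eigenfun[OF that, of "-\<gamma>"] by (simp add: f_def T_def)
  define M where "M i = (\<integral>x. of_real (x ^ i) * f x \<partial>leb_I)" for i
  define m where "m i = (\<integral>x. v x * of_real (x ^ i) \<partial>leb_I)" for i
  have M0: "M 0 \<noteq> 0"
    using integral_hilbert_eigenfun[of "-\<gamma>"] by (simp add: M_def f_def)
  obtain C where C: "\<And>\<epsilon> t. 0 < \<epsilon> \<Longrightarrow> -1 < t \<Longrightarrow> t < 1 \<Longrightarrow> (1 - t\<^sup>2) * norm (trunc_hilbert \<epsilon> f t) \<le> C"
    unfolding f_def using weighted_trunc_hilbert_eigenfun_bound[of "-\<gamma>"] by blast
  have rec: "(\<Sum>i<n. m (n - Suc i) * M i) - (\<Sum>i<n + 2. m (n + 2 - Suc i) * M i) = 0" for n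
  proof -
    define P where "P x = (1 - x\<^sup>2) * x ^ n" for x :: real
    \<comment> \<open>The bound on h is required at every real point, while f is unbounded outside
      the interval as well.\<close>
    define h where "h x = (if x \<in> {-1<..<1} then of_real (P x) * f x else 0)" for x
    define R where "R t = (\<Sum>i<n. of_real (t ^ (n - Suc i)) * M i) - (\<Sum>i<n + 2. of_real (t ^ (n + 2 - Suc i)) * M i)" for t :: real
    define H where "H t = of_real (P t) * (- T * f t) + R t" for t
    have P1: "\<bar>P t\<bar> \<le> 1 - t\<^sup>2" if "-1 < t" "t < 1" for t
    proof -
      have "0 \<le> 1 - t\<^sup>2" using that by (simp add: abs_square_le_1 abs_le_iff)
      moreover have "\<bar>t ^ n\<bar> \<le> 1" using that by (simp add: power_abs power_le_one)
      ultimately show ?thesis unfolding P_def abs_mult by (simp add: mult_left_le)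
    qed
    have Pm: "(\<lambda>x. complex_of_real (P x)) \<in> borel_measurable leb_I"
      unfolding P_def by (rule borel_measurable_leb_I) measurable
    have hm: "h \<in> borel_measurable leb_I"
    proof (subst measurable_cong[where g="\<lambda>x. of_real (P x) * f x"])
      show "(\<lambda>x. of_real (P x) * f x) \<in> borel_measurable leb_I" by (rule borel_measurable_times[OF Pm fm])
    qed (auto simp: h_def space_restrict_space)
    have hb: "norm (h x) \<le> 1" for x
    proof (cases "x \<in> {-1<..<1}")
      case True
      have p: "0 < 1 - x\<^sup>2" using True by (simp add: abs_square_less_1 abs_less_iff)
      have "norm (h x) = \<bar>P x\<bar> * (1 / \<bar>sqrt (1 - x\<^sup>2)\<bar>)"
        using True by (simp add: h_def norm_mult f_def norm_hilbert_eigenfun)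
      also have "\<dots> \<le> (1 - x\<^sup>2) * (1 / \<bar>sqrt (1 - x\<^sup>2)\<bar>)" using P1[of x] True by (intro mult_right_mono) auto
      also have "\<dots> = sqrt (1 - x\<^sup>2)" using p by (simp add: real_div_sqrt)
      also have "\<dots> \<le> 1" by simp
      finally show ?thesis .
    qed (auto simp: h_def)
    have th: "trunc_hilbert \<epsilon> h t = trunc_hilbert \<epsilon> (\<lambda>x. of_real ((1 - x\<^sup>2) * x ^ n) * f x) t" for \<epsilon> t
      by (rule trunc_hilbert_cong) (simp add: h_def P_def)
    have Hpv: "has_pv h t (H t)" if t: "-1 < t" "t < 1" for t
      using has_pv_diff_quot[OF fi fpv[OF t] t, of n]
      unfolding has_pv_def th H_def R_def P_def M_def integral_diff_quot[OF fi] .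
    have Rm: "R \<in> borel_measurable leb_I"
      unfolding R_def by (rule borel_measurable_leb_I) measurable
    have Hm: "H \<in> borel_measurable leb_I"
      unfolding H_def by (intro borel_measurable_add borel_measurable_times Pm fm Rm) auto
    have hM: "norm (trunc_hilbert \<epsilon> h t) \<le> C + real (2 * n + 2) * (\<integral>x. norm (f x) \<partial>leb_I)"
      if e: "0 < \<epsilon>" and t': "t \<in> {-1<..<1}" for \<epsilon> t
    proof -
      have t: "-1 < t" "t < 1" using t' by auto
      have "norm (trunc_hilbert \<epsilon> h t) \<le> \<bar>(1 - t\<^sup>2) * t ^ n\<bar> * norm (trunc_hilbert \<epsilon> f t) + real (2 * n + 2) * (\<integral>x. norm (f x) \<partial>leb_I)"
        unfolding th
        by (rule trunc_hilbert_poly_factor_bound[OF fi diff_quot _ _ _ e])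
           (use diff_quot_bound t diff_quot_measurable in auto)
      moreover have "\<bar>(1 - t\<^sup>2) * t ^ n\<bar> * norm (trunc_hilbert \<epsilon> f t) \<le> (1 - t\<^sup>2) * norm (trunc_hilbert \<epsilon> f t)"
        using P1[OF t] by (intro mult_right_mono) (auto simp: P_def)
      ultimately show ?thesis using C[OF e t] by linarith
    qed
    have Vm: "(\<lambda>t. T * v t) \<in> borel_measurable leb_I" using vm by measurable
    have Vq: "integrable leb_I (\<lambda>x. norm (T * v x) powr q)"
      using vq by (simp add: norm_mult powr_mult)
    have "(\<integral>x. (T * v x) * h x \<partial>leb_I) = - (\<integral>x. v x * H x \<partial>leb_I)"
    proof (rule pv_transposition[OF q vm vq _ Vm Vq hm hb _ hM Hm])
      show "AE t in leb_I. has_pv v t (T * v t)" using pv by (simp add: T_def)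
      show "AE t in leb_I. has_pv h t (H t)" using AE_leb_I_in by eventually_elim (auto intro: Hpv)
    qed
    moreover have "(\<integral>x. v x * H x \<partial>leb_I) = (\<integral>x. (v x * R x) - T * (v x * h x) \<partial>leb_I)"
      by (rule Bochner_Integration.integral_cong) (auto simp: H_def h_def space_restrict_space algebra_simps)
    moreover have vh: "integrable leb_I (\<lambda>x. v x * h x)"
      using integrable_bounded_mult[OF vi hm, of 1] hb by (simp add: mult.commute)
    have vxi: "integrable leb_I (\<lambda>x. v x * of_real (x ^ i))" for i
      using integrable_power_mult[OF vi, of i] by (simp add: mult.commute)
    have vRs: "integrable leb_I (\<lambda>x. \<Sum>i<k. (v x * of_real (x ^ (k - Suc i))) * M i)"
      "(\<integral>x. (\<Sum>i<k. (v x * of_real (x ^ (k - Suc i))) * M i) \<partial>leb_I) = (\<Sum>i<k. m (k - Suc i) * M i)" for k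
    proof -
      show "integrable leb_I (\<lambda>x. \<Sum>i<k. (v x * of_real (x ^ (k - Suc i))) * M i)"
        by (intro Bochner_Integration.integrable_sum integrable_mult_left vxi)
      show "(\<integral>x. (\<Sum>i<k. (v x * of_real (x ^ (k - Suc i))) * M i) \<partial>leb_I) = (\<Sum>i<k. m (k - Suc i) * M i)"
        unfolding m_def
        by (subst Bochner_Integration.integral_sum) (intro integrable_mult_left vxi, simp only: integral_mult_left_zero)
    qed
    have vR: "v x * R x = (\<Sum>i<n. (v x * of_real (x ^ (n - Suc i))) * M i) - (\<Sum>i<n + 2. (v x * of_real (x ^ (n + 2 - Suc i))) * M i)" for x
      unfolding R_def right_diff_distrib sum_distrib_left mult.assoc ..
    have vRi: "integrable leb_I (\<lambda>x. v x * R x)"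
      unfolding vR by (rule Bochner_Integration.integrable_diff[OF vRs(1) vRs(1)])
    have "(\<integral>x. (v x * R x) - T * (v x * h x) \<partial>leb_I) = (\<integral>x. v x * R x \<partial>leb_I) - T * (\<integral>x. v x * h x \<partial>leb_I)"
      by (simp only: Bochner_Integration.integral_diff[OF vRi integrable_mult_right[OF vh]] integral_mult_right_zero)
    moreover have "(\<integral>x. (T * v x) * h x \<partial>leb_I) = T * (\<integral>x. v x * h x \<partial>leb_I)"
      by (simp only: mult.assoc integral_mult_right_zero)
    \<comment> \<open>Transposition reads T J = -(integral of v R) + T J, where J is the integral of
      v h.\<close>
    ultimately have "(\<integral>x. v x * R x \<partial>leb_I) = 0" by simp
    then show ?thesis
      unfolding vR Bochner_Integration.integral_diff[OF vRs(1) vRs(1)] vRs(2) .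
  qed
  have "m k = 0" for k
  proof (induction k rule: less_induct)
    case (less k)
    show ?case
    proof (cases k)
      case 0
      then show ?thesis using zero by (simp add: m_def)
    next
      case (Suc n)
      have "(\<Sum>i<n. m (n - Suc i) * M i) = 0" using less Suc by (intro sum.neutral) auto
      then have "(\<Sum>i<n + 2. m (n + 2 - Suc i) * M i) = 0" using rec[of n] by (simp only: diff_0 neg_equal_0_iff_equal)
      moreover have "{..<n + 2} = {..<Suc (Suc n)}" by simp
      ultimately have "(\<Sum>i<Suc (Suc n). m (n + 2 - Suc i) * M i) = 0" by (simp only:)
      \<comment> \<open>Splitting off i = 0 isolates the moment of order n + 1 with the nonzero
        factor M 0; all other terms contain moments of lower order, which vanish by
        induction.\<close>
      then have "m (n + 2 - Suc 0) * M 0 + (\<Sum>i<Suc n. m (n + 2 - Suc (Suc i)) * M (Suc i)) = 0"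
        unfolding sum.lessThan_Suc_shift[of _ "Suc n"] .
      moreover have "(\<Sum>i<Suc n. m (n + 2 - Suc (Suc i)) * M (Suc i)) = 0"
        using less Suc by (intro sum.neutral) auto
      ultimately have "m (n + 1) * M 0 = 0" by simp
      then show ?thesis using M0 Suc by simp
    qed
  qed
  then show ?thesis using AE_zero_of_moments_zero[OF vi] by (simp add: m_def)
qed

section \<open>Rearrangement invariant spaces\<close>

abbreviation level_measure :: "(real \<Rightarrow> complex) \<Rightarrow> real \<Rightarrow> ennreal" where
  "level_measure f s \<equiv> emeasure leb_I {x \<in> space leb_I. s < norm (f x)}"

lemma level_set_sets: "f \<in> L0 \<Longrightarrow> {x \<in> space leb_I. s < norm (f x)} \<in> sets leb_I"
  by measurable

definition ind :: "real \<Rightarrow> real \<Rightarrow> real \<Rightarrow> complex" where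
  "ind a b x = (if a < x \<and> x < b then 1 else 0)"

lemma ind_L0: "ind a b \<in> L0"
  unfolding ind_def[abs_def] by (rule borel_measurable_leb_I) measurable

lemma emeasure_leb_I_interval:
  assumes "-1 \<le> a" "a \<le> b" "b \<le> 1"
  shows "emeasure leb_I {a<..<b} = ennreal (b - a)"
  using assms by (subst emeasure_restrict_space) auto

lemma level_measure_scaled_ind:
  assumes "-1 \<le> a" "a \<le> b" "b \<le> 1" "0 < s" "0 \<le> r"
  shows "level_measure (\<lambda>x. of_real s * ind a b x) r = (if r < s then ennreal (b - a) else 0)"
proof -
  have "{x \<in> space leb_I. r < norm (of_real s * ind a b x)} = (if r < s then {a<..<b} else {})"
    using assms by (auto simp: ind_def space_restrict_space norm_mult split: if_splits)
  then show ?thesis using emeasure_leb_I_interval[OF assms(1-3)] by simp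
qed

lemma emeasure_leb_I_reflect:
  assumes "A \<in> sets leb_I" shows "emeasure leb_I (uminus ` A) = emeasure leb_I A"
proof -
  have A: "A \<subseteq> {-1<..<1}" using sets.sets_into_space[OF assms] by (simp add: space_restrict_space)
  then have B: "uminus ` A \<subseteq> {-1<..<1}" by auto
  have "emeasure leb_I (uminus ` A) = emeasure lebesgue (uminus ` A)"
    using B by (intro emeasure_restrict_space) auto
  also have "\<dots> = emeasure lebesgue A"
    using emeasure_lebesgue_affine[of "-1" "0::real" A] by simp
  also have "\<dots> = emeasure leb_I A"
    using A by (intro emeasure_restrict_space[symmetric]) auto
  finally show ?thesis .
qed

lemma reflect_measurable:
  assumes "f \<in> L0" shows "(\<lambda>x. f (- x)) \<in> L0"
proof (rule measurable_compose[OF _ assms])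
  show "uminus \<in> leb_I \<rightarrow>\<^sub>M leb_I"
  proof (rule measurable_restrict_space3)
    have "(\<lambda>x::real. (-1) *\<^sub>R x) \<in> lebesgue \<rightarrow>\<^sub>M lebesgue" by (rule lebesgue_measurable_scaling)
    then show "uminus \<in> lebesgue \<rightarrow>\<^sub>M (lebesgue :: real measure)" by simp
  qed auto
qed

lemma level_measure_reflect:
  assumes "f \<in> L0" shows "level_measure (\<lambda>x. f (- x)) s = level_measure f s"
proof -
  have "{x \<in> space leb_I. s < norm (f (- x))} = uminus ` {x \<in> space leb_I. s < norm (f x)}"
    by (force simp: space_restrict_space image_iff intro: exI[of _ "- _"])
  then show ?thesis using emeasure_leb_I_reflect[OF level_set_sets[OF assms]] by simp
qed

context ri_space
begin

lemma in_L0: "f \<in> X \<Longrightarrow> f \<in> L0" using sub_L0 by blast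

text \<open>The decreasing rearrangement is a generalised inverse of the distribution function, so
  comparing distribution functions is sufficient, and no infimum has to be evaluated.\<close>

lemma rearr_level:
  assumes "g \<in> L0" "f \<in> X" "\<And>s. 0 \<le> s \<Longrightarrow> level_measure g s \<le> level_measure f s"
  shows "g \<in> X" "N g \<le> N f"
proof -
  have "decr_rearr g t \<le> decr_rearr f t" for t
    unfolding decr_rearr_def by (rule Inf_superset_mono) (use assms(3) order_trans in blast)
  then show "g \<in> X" "N g \<le> N f" using rearr[OF assms(1,2)] by auto
qed

lemma dominated:
  assumes "g \<in> L0" "f \<in> X" "AE x in leb_I. norm (g x) \<le> norm (f x)"
  shows "g \<in> X" "N g \<le> N f"
proof -
  have "level_measure g s \<le> level_measure f s" for s
  proof (rule emeasure_mono_AE)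
    show "AE x in leb_I. x \<in> {x \<in> space leb_I. s < norm (g x)} \<longrightarrow> x \<in> {x \<in> space leb_I. s < norm (f x)}"
      using assms(3) by eventually_elim auto
  qed (rule level_set_sets[OF in_L0[OF assms(2)]])
  then show "g \<in> X" "N g \<le> N f" using rearr_level[OF assms(1,2)] by auto
qed

lemma reflect:
  assumes "f \<in> X" shows "(\<lambda>x. f (- x)) \<in> X" "N (\<lambda>x. f (- x)) \<le> N f"
  using rearr_level[OF reflect_measurable[OF in_L0[OF assms]] assms] level_measure_reflect[OF in_L0[OF assms]] by auto

text \<open>Chebyshev's inequality in X: |f| dominates s times the indicator of its level set, and
  rearrangement invariance replaces that set by an interval of no larger measure.\<close>

lemma ind_le_level:
  assumes f: "f \<in> X" and s: "0 < s" and ab: "-1 \<le> a" "a \<le> b" "b \<le> 1"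
    and le: "ennreal (b - a) \<le> level_measure f s"
  shows "ind a b \<in> X" "s * N (ind a b) \<le> N f"
proof -
  let ?g = "\<lambda>x. of_real s * ind a b x"
  have gL: "?g \<in> L0" using ind_L0 by measurable
  have "level_measure ?g r \<le> level_measure f r" if r: "0 \<le> r" for r
  proof -
    have "level_measure f s \<le> level_measure f r" if "r < s"
      by (rule emeasure_mono) (use that level_set_sets[OF in_L0[OF f]] in auto)
    then show ?thesis
      unfolding level_measure_scaled_ind[OF ab s r] using le by (auto intro: order_trans)
  qed
  from rearr_level[OF gL f this] have g: "?g \<in> X" "N ?g \<le> N f" by auto
  have "(\<lambda>x. of_real (1 / s) * ?g x) \<in> X" by (rule scale_mem[OF g(1)])
  moreover have "(\<lambda>x. of_real (1 / s) * ?g x) = ind a b" using s by (simp add: fun_eq_iff)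
  ultimately show i: "ind a b \<in> X" by simp
  show "s * N (ind a b) \<le> N f" using g(2) norm_scale[OF i, of "of_real s"] s by simp
qed

lemma ind_le_ind:
  assumes X: "ind a b \<in> X" and ab: "-1 \<le> a" "a < b" "b \<le> 1"
    and cd: "-1 \<le> c" "c \<le> d" "d \<le> 1" and le: "d - c \<le> b - a"
  shows "ind c d \<in> X" "N (ind c d) \<le> N (ind a b)"
proof -
  have "level_measure (ind c d) r \<le> level_measure (ind a b) r" if "0 \<le> r" for r
    using level_measure_scaled_ind[of c d 1 r] level_measure_scaled_ind[of a b 1 r] ab cd le that
    by (auto intro: ennreal_leI)
  then show "ind c d \<in> X" "N (ind c d) \<le> N (ind a b)" using rearr_level[OF ind_L0 X] by auto
qed

lemma ind_extend:
  assumes X: "ind 0 m \<in> X" and m: "0 < m" "m \<le> m'" "m' \<le> 2 * m" "m' \<le> 1"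
  shows "ind 0 m' \<in> X"
proof -
  have 2: "ind (m' - m) m' \<in> X" using ind_le_ind(1)[OF X] m by simp
  show ?thesis
  proof (rule dominated(1)[OF ind_L0 add_mem[OF X 2]])
    show "AE x in leb_I. norm (ind 0 m' x) \<le> norm (ind 0 m x + ind (m' - m) m' x)"
      \<comment> \<open>For m' = 2 m the two open intervals leave out the point m.\<close>
      using AE_leb_I_neq[of m]
    proof eventually_elim
      case (elim x)
      show ?case
      proof (cases "x < m")
        case True
        then show ?thesis by (auto simp: ind_def)
      next
        case False
        then have "m' - m < x" using elim m by linarith
        then show ?thesis using False elim by (auto simp: ind_def)
      qed
    qed
  qed
qed

text \<open>Some level set of a nonzero element has positive measure; the interval that it yields is
  doubled until it fills (0, 1).\<close>

lemma ind_0_1: "ind 0 1 \<in> X"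
proof -
  obtain f where f: "f \<in> X" "\<not> (AE x in leb_I. f x = 0)" using nonzero by blast
  have "\<exists>n. level_measure f (1 / real (Suc n)) \<noteq> 0"
  proof (rule ccontr)
    assume "\<not> (\<exists>n. level_measure f (1 / real (Suc n)) \<noteq> 0)"
    then have "AE x in leb_I. \<not> (1 / real (Suc n) < norm (f x))" for n
      using level_set_sets[OF in_L0[OF f(1)]] by (intro AE_I[where N="{x \<in> space leb_I. 1 / real (Suc n) < norm (f x)}"]) auto
    then have "AE x in leb_I. \<forall>n. \<not> (1 / real (Suc n) < norm (f x))" by (subst AE_all_countable) blast
    then have "AE x in leb_I. f x = 0"
    proof eventually_elim
      case (elim x)
      show ?case
      proof (rule ccontr)
        assume "f x \<noteq> 0"
        then obtain n where "inverse (real (Suc n)) < norm (f x)" using reals_Archimedean[of "norm (f x)"] by auto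
        then show False using elim by (auto simp: inverse_eq_divide)
      qed
    qed
    then show False using f(2) by blast
  qed
  then obtain n where n: "level_measure f (1 / real (Suc n)) \<noteq> 0" by blast
  define s where "s = 1 / real (Suc n)"
  define m where "m = min 1 (measure leb_I {x \<in> space leb_I. s < norm (f x)})"
  have em: "level_measure f s = ennreal (measure leb_I {x \<in> space leb_I. s < norm (f x)})"
    by (rule leb_I.emeasure_eq_measure)
  have "level_measure f s \<noteq> 0" by (rule n[folded s_def])
  then have "0 < measure leb_I {x \<in> space leb_I. s < norm (f x)}"
    unfolding em by (metis ennreal_0 measure_nonneg order_le_less)
  then have m: "0 < m" "m \<le> 1" by (auto simp: m_def)
  have "ind 0 m \<in> X"
    by (rule ind_le_level(1)[OF f(1), of s]) (use m em in \<open>auto simp: s_def m_def intro!: ennreal_leI\<close>)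
  then have "ind 0 (min 1 (2 ^ k * m)) \<in> X" for k
  proof (induction k)
    case 0
    then show ?case using m by (simp add: min_def)
  next
    case (Suc k)
    have p: "0 < 2 ^ k * m" using m by simp
    show ?case
      by (rule ind_extend[OF Suc.IH[OF Suc.prems]]) (use p m in \<open>auto simp: min_def\<close>)
  qed
  moreover obtain k where "1 / m < 2 ^ k" using real_arch_pow[of 2 "1 / m"] by auto
  then have "min 1 (2 ^ k * m) = 1" using m by (simp add: field_simps min_def)
  ultimately show ?thesis by metis
qed

lemma ind_mem: "-1 \<le> a \<Longrightarrow> a \<le> b \<Longrightarrow> b \<le> 1 \<Longrightarrow> b - a \<le> 1 \<Longrightarrow> ind a b \<in> X"
  by (rule ind_le_ind(1)[OF ind_0_1]) auto

lemma const_1_mem: "(\<lambda>x. 1) \<in> X"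
proof (rule dominated(1)[OF _ add_mem[OF ind_0_1 ind_mem[of "-1" 0]]])
  show "AE x in leb_I. norm (1 :: complex) \<le> norm (ind 0 1 x + ind (-1) 0 x)"
    using AE_leb_I_neq[of 0] AE_leb_I_in by eventually_elim (auto simp: ind_def)
qed auto

lemma bounded_mem:
  assumes "g \<in> L0" "AE x in leb_I. norm (g x) \<le> B" shows "g \<in> X"
proof (rule dominated(1)[OF assms(1) scale_mem[OF const_1_mem, of "of_real B"]])
  show "AE x in leb_I. norm (g x) \<le> norm (complex_of_real B * 1)"
    using assms(2) by eventually_elim simp
qed

lemma ae_eq_mem:
  assumes "f \<in> X" "g \<in> L0" "AE x in leb_I. f x = g x" shows "g \<in> X" "N g = N f"
proof -
  have "AE x in leb_I. norm (g x) \<le> norm (f x)" using assms(3) by eventually_elim simp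
  from dominated[OF assms(2,1) this] have g: "g \<in> X" "N g \<le> N f" by auto
  have "AE x in leb_I. norm (f x) \<le> norm (g x)" using assms(3) by eventually_elim simp
  from dominated(2)[OF in_L0[OF assms(1)] g(1) this] g show "g \<in> X" "N g = N f" by auto
qed

lemma diff_mem: "f \<in> X \<Longrightarrow> g \<in> X \<Longrightarrow> (\<lambda>x. f x - g x) \<in> X"
  using add_mem[of f "\<lambda>x. -1 * g x"] scale_mem[of g "-1"] by simp

end

section \<open>Norms of indicator functions\<close>

text \<open>Seen from the other side of 0 the kernel 1 / (x + t) has no singularity and is positive,
  so nonnegative functions admit pointwise lower bounds for their transforms.\<close>

lemma finite_hilbert_right_supported:
  assumes f: "integrable leb_I f" and supp: "\<And>x. x \<le> 0 \<Longrightarrow> f x = 0" and t: "0 < t" "t < 1"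
  shows "finite_hilbert f (- t) = (\<integral>x. f x / of_real (x + t) \<partial>leb_I) / (of_real pi * \<i>)"
    and "integrable leb_I (\<lambda>x. f x / of_real (x + t))"
proof -
  have i: "integrable leb_I (\<lambda>x. f x / of_real (x + t))"
  proof (rule Bochner_Integration.integrable_bound[of _ "\<lambda>x. f x / of_real t"])
    show "integrable leb_I (\<lambda>x. f x / of_real t)" using f by simp
    show "(\<lambda>x. f x / of_real (x + t)) \<in> borel_measurable leb_I"
      using f by (intro borel_measurable_divide) (auto intro!: borel_measurable_leb_I)
    have "norm (f x / of_real (x + t)) \<le> norm (f x / of_real t)" for x
    proof (cases "x \<le> 0")
      case False
      then show ?thesis using t by (simp add: norm_divide frac_le flip: of_real_add)
    qed (simp add: supp)
    then show "AE x in leb_I. norm (f x / of_real (x + t)) \<le> norm (f x / of_real t)" by simp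
  qed
  then show "integrable leb_I (\<lambda>x. f x / of_real (x + t))" .
  have "has_pv f (- t) (\<integral>x. f x / of_real (x - (- t)) \<partial>leb_I)"
    by (rule has_pv_integrable_quotient) (use i in simp)
  then show "finite_hilbert f (- t) = (\<integral>x. f x / of_real (x + t) \<partial>leb_I) / (of_real pi * \<i>)"
    using finite_hilbert_eqI[OF f, of "- t"] t by simp
qed

lemma integral_leb_I_interval:
  fixes f :: "real \<Rightarrow> real"
  assumes f: "continuous_on {a..b} f" and ab: "-1 \<le> a" "b \<le> 1"
  shows "integrable leb_I (\<lambda>x. if x \<in> {a..b} then f x else 0)"
    "(\<integral>x. (if x \<in> {a..b} then f x else 0) \<partial>leb_I) = integral {a..b} f"
proof -
  have sub: "{a..b} \<subseteq> {-1..1}" using ab by auto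
  let ?h = "\<lambda>x. if x \<in> {a..b} then f x else 0"
  have "(\<lambda>x. indicator {-1..1} x *\<^sub>R ?h x) = (\<lambda>x. indicator {a..b} x *\<^sub>R f x)"
    using sub by (auto simp: fun_eq_iff indicator_def)
  then have a: "?h absolutely_integrable_on {-1..1}"
    using absolutely_integrable_continuous_real[OF f] by (simp only: set_integrable_def)
  show "integrable leb_I ?h" by (rule integral_leb_I_eq_HK(1)[OF a])
  show "(\<integral>x. ?h x \<partial>leb_I) = integral {a..b} f"
    unfolding integral_leb_I_eq_HK(2)[OF a] Henstock_Kurzweil_Integration.integral_restrict_Int Int_absorb2[OF sub] ..
qed

text \<open>The properties that the transform inherits from a bounded operator \<lambda> - T, with
  linearity up to null sets only.\<close>

locale ri_hilbert = ri_space +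
  fixes C :: real
  assumes hilbert_mem: "\<And>f. f \<in> X \<Longrightarrow> finite_hilbert f \<in> X"
    and hilbert_bound: "\<And>f. f \<in> X \<Longrightarrow> N (finite_hilbert f) \<le> C * N f"
    and hilbert_add: "\<And>f g. f \<in> X \<Longrightarrow> g \<in> X \<Longrightarrow>
      AE x in leb_I. finite_hilbert (\<lambda>y. f y + g y) x = finite_hilbert f x + finite_hilbert g x"
    and hilbert_scale: "\<And>f c. f \<in> X \<Longrightarrow>
      AE x in leb_I. finite_hilbert (\<lambda>y. c * f y) x = c * finite_hilbert f x"
begin

lemma ind_norm_pos: "0 < m \<Longrightarrow> m \<le> 1 \<Longrightarrow> 0 < N (ind 0 m)"
proof -
  assume m: "0 < m" "m \<le> 1"
  have X: "ind 0 m \<in> X" using m by (intro ind_mem) auto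
  have "N (ind 0 m) \<noteq> 0"
  proof
    assume "N (ind 0 m) = 0"
    then have "AE x in leb_I. ind 0 m x = 0" using norm_eq_0[OF X] by blast
    then have "AE x in leb_I. x \<notin> {0<..<m}" by eventually_elim (auto simp: ind_def)
    then have "emeasure leb_I {0<..<m} = 0"
      by (subst (asm) AE_iff_measurable[of "{0<..<m}"]) (use m in \<open>auto simp: space_restrict_space sets_restrict_space_iff\<close>)
    then show False using emeasure_leb_I_interval[of 0 m] m by simp
  qed
  then show ?thesis using norm_nonneg[OF X] by simp
qed

lemma C_nonneg: "0 \<le> C"
proof -
  have "0 \<le> C * N (ind 0 1)"
    using hilbert_bound[OF ind_0_1] norm_nonneg[OF hilbert_mem[OF ind_0_1]] by linarith
  then show ?thesis using ind_norm_pos[of 1] by (simp add: zero_le_mult_iff)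
qed

text \<open>Applying the transform twice to the indicator of $(0,m)$ gains a logarithm over the
  trivial bound \<open>N (ind 0 (M * m)) \<le> M * N (ind 0 m)\<close>.\<close>

lemma ind_dilate:
  assumes m: "0 < m" and M: "1 < M" and Mm: "M * m \<le> 1"
  shows "ln (1 + M) / (2 * pi\<^sup>2 * M) * N (ind 0 (M * m)) \<le> C\<^sup>2 * N (ind 0 m)"
proof -
  define b where "b = M * m"
  have b: "m < b" "b \<le> 1" "0 < b" using m M Mm by (auto simp: b_def)
  have X1: "ind 0 m \<in> X" and X2: "ind 0 b \<in> X" using m b by (auto intro!: ind_mem)
  have bint: "integrable leb_I f" if "f \<in> L0" "\<And>x. norm (f x) \<le> B" for f :: "real \<Rightarrow> complex" and B
    by (rule leb_I.integrable_const_bound[where B=B]) (use that in auto)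
  \<comment> \<open>A lower bound for the modulus of the transform of \<open>ind 0 m\<close> at -x:
    the integral of 1 / (z + x) over (0, m) is at least m / (m + x). Reflection brings it back to
    (0, 1), where the transform is applied again.\<close>
  define g where "g x = (if 0 < x \<and> x < 1 then complex_of_real (m / (pi * (m + x))) else 0)" for x
  have gL: "g \<in> L0" unfolding g_def[abs_def] by (rule borel_measurable_leb_I) measurable
  have g0: "g x = 0" if "x \<le> 0" for x using that by (simp add: g_def)
  have gn: "norm (g x) = m / (pi * (m + x))" if "0 < x" "x < 1" for x
  proof -
    have "g x = complex_of_real (m / (pi * (m + x)))" using that by (simp add: g_def)
    moreover have "0 < m / (pi * (m + x))" using that m by simp
    ultimately show ?thesis by (simp only: norm_of_real abs_of_pos)
  qed
  have gi: "integrable leb_I g"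
  proof (rule bint[OF gL])
    have "m / (pi * (m + x)) \<le> 1 / pi" if "0 < x" for x
    proof -
      have "m / (pi * (m + x)) \<le> m / (pi * m)" using m that by (intro divide_left_mono) auto
      then show ?thesis using m by simp
    qed
    then show "norm (g x) \<le> 1 / pi" for x using gn[of x] by (cases "0 < x \<and> x < 1") (auto simp: g_def)
  qed
  have step1: "norm (g x) \<le> norm (finite_hilbert (ind 0 m) (- x))" if x: "0 < x" "x < 1" for x
  proof -
    let ?k = "\<lambda>z. if z \<in> {0..m} then 1 / (z + x) else 0"
    have ii: "integrable leb_I (ind 0 m)" by (rule bint[where B=1, OF ind_L0]) (simp add: ind_def)
    have cont: "continuous_on {0..m} (\<lambda>z. 1 / (z + x))" using x by (intro continuous_intros) auto
    have ki: "integrable leb_I ?k" "(\<integral>z. ?k z \<partial>leb_I) = integral {0..m} (\<lambda>z. 1 / (z + x))"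
      using integral_leb_I_interval[OF cont] b by auto
    have "(\<integral>z. ind 0 m z / of_real (z + x) \<partial>leb_I) = (\<integral>z. complex_of_real (?k z) \<partial>leb_I)"
    proof (rule integral_cong_AE)
      show "(\<lambda>z. ind 0 m z / of_real (z + x)) \<in> borel_measurable leb_I"
        using finite_hilbert_right_supported(2)[OF ii _ x] by (simp add: ind_def)
      show "(\<lambda>z. complex_of_real (?k z)) \<in> borel_measurable leb_I" using ki(1) by measurable
      show "AE z in leb_I. ind 0 m z / of_real (z + x) = complex_of_real (?k z)"
        using AE_leb_I_neq[of 0] AE_leb_I_neq[of m] by eventually_elim (auto simp: ind_def)
    qed
    also have "\<dots> = of_real (integral {0..m} (\<lambda>z. 1 / (z + x)))"
      unfolding ki(2)[symmetric] by (rule integral_complex_of_real)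
    finally have h: "finite_hilbert (ind 0 m) (- x) = of_real (integral {0..m} (\<lambda>z. 1 / (z + x))) / (of_real pi * \<i>)"
      using finite_hilbert_right_supported(1)[OF ii _ x] by (simp add: ind_def)
    have "integral {0..m} (\<lambda>z. 1 / (m + x)) \<le> integral {0..m} (\<lambda>z. 1 / (z + x))"
      by (intro integral_le integrable_continuous_interval cont continuous_intros) (use x m in \<open>auto intro!: frac_le\<close>)
    then have l: "m / (m + x) \<le> integral {0..m} (\<lambda>z. 1 / (z + x))" using m by simp
    have "norm (g x) = m / (m + x) / pi" using gn[OF x] by simp
    also have "\<dots> \<le> integral {0..m} (\<lambda>z. 1 / (z + x)) / pi" using l by (intro divide_right_mono) auto
    also have "\<dots> \<le> norm (finite_hilbert (ind 0 m) (- x))" unfolding h norm_divide norm_mult by (simp add: divide_right_mono)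
    finally show ?thesis .
  qed
  have "AE x in leb_I. norm (g x) \<le> norm (finite_hilbert (ind 0 m) (- x))"
    using AE_leb_I_in
  proof eventually_elim
    case (elim x)
    then show ?case using step1[of x] g0[of x] by (cases "0 < x") auto
  qed
  from dominated[OF gL reflect(1)[OF hilbert_mem[OF X1]] this]
  have gX: "g \<in> X" and gN: "N g \<le> C * N (ind 0 m)"
    using reflect(2)[OF hilbert_mem[OF X1]] hilbert_bound[OF X1] by auto
  let ?c = "ln (1 + M) / (2 * pi\<^sup>2 * M)"
  have c0: "0 < ?c" using M by simp
  \<comment> \<open>For z and x below b the denominator z + x is at most 2 b, and the integral of m
    / (m + z) over (0, b) is m ln (1 + M). This is the logarithm gained.\<close>
  have step2: "?c \<le> norm (finite_hilbert g (- x))" if x: "0 < x" "x < b" for x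
  proof -
    have x1: "x < 1" using x b by simp
    have cont: "continuous_on {0..b} (\<lambda>z. m / (pi * (m + z)) / (2 * b))" using m b by (intro continuous_intros) auto
    let ?k = "\<lambda>z. if z \<in> {0..b} then m / (pi * (m + z)) / (2 * b) else 0"
    have ki: "integrable leb_I ?k" "(\<integral>z. ?k z \<partial>leb_I) = integral {0..b} (\<lambda>z. m / (pi * (m + z)) / (2 * b))"
      using integral_leb_I_interval[OF cont] b by auto
    have "((\<lambda>z. m / (pi * (m + z)) / (2 * b)) has_integral
       (m / (pi * (2 * b)) * ln (m + b) - m / (pi * (2 * b)) * ln (m + 0))) {0..b}"
    proof (rule fundamental_theorem_of_calculus)
      fix z assume z: "z \<in> {0..b}"
      have "((\<lambda>z. m / (pi * (2 * b)) * ln (m + z)) has_real_derivative m / (pi * (2 * b)) * (1 / (m + z))) (at z within {0..b})"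
        using m z b by (auto intro!: derivative_eq_intros)
      then show "((\<lambda>z. m / (pi * (2 * b)) * ln (m + z)) has_vector_derivative m / (pi * (m + z)) / (2 * b)) (at z within {0..b})"
        by (simp add: has_real_derivative_iff_has_vector_derivative mult_ac)
    qed (use b in simp)
    then have "integral {0..b} (\<lambda>z. m / (pi * (m + z)) / (2 * b)) = m / (pi * (2 * b)) * (ln (m + b) - ln m)"
      by (simp add: integral_unique right_diff_distrib)
    also have "ln (m + b) - ln m = ln (1 + M)"
    proof -
      have "m + b = m * (1 + M)" by (simp add: b_def algebra_simps)
      then show ?thesis using m M by (simp add: ln_mult)
    qed
    finally have kv: "(\<integral>z. ?k z \<partial>leb_I) = ln (1 + M) / (2 * pi * M)"
      unfolding ki(2) using m by (simp add: b_def)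
    define G where "G z = (if 0 < z \<and> z < 1 then m / (pi * (m + z)) / (z + x) else 0)" for z
    have Gg: "complex_of_real (G z) = g z / of_real (z + x)" for z
      by (auto simp: G_def g_def)
    have iG: "integrable leb_I G"
      using integrable_Re[OF finite_hilbert_right_supported(2)[OF gi g0 x(1) x1]] unfolding Gg[symmetric] by simp
    have "ln (1 + M) / (2 * pi * M) \<le> (\<integral>z. G z \<partial>leb_I)"
      unfolding kv[symmetric]
    proof (rule integral_mono_AE[OF ki(1) iG])
      show "AE z in leb_I. ?k z \<le> G z"
        using AE_leb_I_neq[of 0] AE_leb_I_in
      proof eventually_elim
        case (elim z)
        show ?case
        proof (cases "0 < z \<and> z \<le> b")
          case True
          then have "m / (pi * (m + z)) / (2 * b) \<le> m / (pi * (m + z)) / (z + x)"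
            using m x by (intro divide_left_mono) auto
          then show ?thesis using True elim by (simp add: G_def)
        next
          case False
          have "0 \<le> G z" using m x by (simp add: G_def)
          then show ?thesis using False elim by auto
        qed
      qed
    qed
    then have "ln (1 + M) / (2 * pi * M) / pi \<le> (\<integral>z. G z \<partial>leb_I) / pi" by (intro divide_right_mono) auto
    also have "\<dots> \<le> norm (complex_of_real (\<integral>z. G z \<partial>leb_I) / (of_real pi * \<i>))"
      unfolding norm_divide norm_mult by (simp add: divide_right_mono)
    also have "complex_of_real (\<integral>z. G z \<partial>leb_I) / (of_real pi * \<i>) = finite_hilbert g (- x)"
    proof -
      have "finite_hilbert g (- x) = (\<integral>z. g z / of_real (z + x) \<partial>leb_I) / (of_real pi * \<i>)"
        by (rule finite_hilbert_right_supported(1)[OF gi g0 x(1) x1])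
      also have "(\<integral>z. g z / of_real (z + x) \<partial>leb_I) = (\<integral>z. complex_of_real (G z) \<partial>leb_I)"
        by (simp only: Gg)
      also have "\<dots> = complex_of_real (\<integral>z. G z \<partial>leb_I)" by (rule integral_complex_of_real)
      finally show ?thesis ..
    qed
    finally show ?thesis by (simp add: power2_eq_square mult_ac)
  qed
  have cL: "(\<lambda>x. of_real ?c * ind 0 b x) \<in> L0" using ind_L0 by measurable
  have "AE x in leb_I. norm (of_real ?c * ind 0 b x) \<le> norm (finite_hilbert g (- x))"
    using AE_leb_I_in
  proof eventually_elim
    case (elim x)
    show ?case
    proof (cases "0 < x \<and> x < b")
      case True
      then have "ind 0 b x = 1" by (simp add: ind_def)
      then have "norm (of_real ?c * ind 0 b x) = ?c"
        by (simp only: norm_mult norm_of_real abs_of_pos[OF c0] norm_one mult_1_right)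
      then show ?thesis using step2[of x] True by simp
    qed (auto simp: ind_def)
  qed
  from dominated(2)[OF cL reflect(1)[OF hilbert_mem[OF gX]] this]
  have "N (\<lambda>x. of_real ?c * ind 0 b x) \<le> C * N g"
    using reflect(2)[OF hilbert_mem[OF gX]] hilbert_bound[OF gX] by linarith
  also have "\<dots> \<le> C * (C * N (ind 0 m))" using gN C_nonneg by (rule mult_left_mono)
  finally have "N (\<lambda>x. of_real ?c * ind 0 b x) \<le> C\<^sup>2 * N (ind 0 m)" by (simp only: power2_eq_square mult.assoc)
  moreover have "N (\<lambda>x. of_real ?c * ind 0 b x) = ?c * N (ind 0 b)"
    using norm_scale[OF X2, of "of_real ?c"] by (simp only: norm_of_real abs_of_pos[OF c0])
  ultimately show ?thesis by (simp only: b_def)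
qed

text \<open>The triangle inequality alone gives a lower bound of order m. For one sufficiently large
  M the logarithm in \<open>ind_dilate\<close> beats the constant, and iterating over the scales
  M^(-k) improves the exponent to \<beta> < 1, which is what produces an L^q with q > 1.\<close>

lemma ind_norm_lower:
  obtains c \<beta> where "0 < c" "0 < \<beta>" "\<beta> < 1" "\<And>m. 0 < m \<Longrightarrow> m \<le> 1 \<Longrightarrow> c * m powr \<beta> \<le> N (ind 0 m)"
proof -
  define D where "D = 2 * pi\<^sup>2 * C\<^sup>2"
  have D: "0 \<le> D" by (simp add: D_def)
  \<comment> \<open>Large enough for ln (1 + M) > 2 D; a dilation by M then multiplies the norm by
    at most M / 2.\<close>
  define M where "M = exp (2 * D + 1)"
  have M: "1 < M" using D by (simp add: M_def)
  have lnM: "2 * D < ln (1 + M)"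
  proof -
    have "ln M \<le> ln (1 + M)" using M by simp
    then show ?thesis by (simp add: M_def)
  qed
  \<comment> \<open>The value 1/2 is the gain per dilation; the maximum with 1 / sqrt M keeps
    \<beta> at least 1/2. The exponent is defined so that M^\<beta> = M \<theta>.\<close>
  define \<theta> where "\<theta> = max (1 / 2) (1 / sqrt M)"
  define \<beta> where "\<beta> = 1 + ln \<theta> / ln M"
  have lm: "0 < ln M" using M by simp
  have \<theta>: "0 < \<theta>" "\<theta> < 1" "1 / sqrt M \<le> \<theta>" using M by (auto simp: \<theta>_def)
  have "ln (1 / sqrt M) \<le> ln \<theta>" using \<theta> M by simp
  then have "- (ln M / 2) \<le> ln \<theta>" using M by (simp add: ln_div ln_sqrt)
  then have \<beta>: "0 < \<beta>" "\<beta> < 1" using lm \<theta> by (auto simp: \<beta>_def field_simps)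
  have Mb: "M powr \<beta> = M * \<theta>"
    using M \<theta> lm by (simp add: powr_def \<beta>_def distrib_right exp_add)
  have step: "N (ind 0 (M * m)) \<le> M powr \<beta> * N (ind 0 m)" if m: "0 < m" "M * m \<le> 1" for m
  proof -
    have m1: "m \<le> 1" using m M by (smt (verit) mult_less_cancel_right2)
    have nn: "0 < N (ind 0 m)" "0 < N (ind 0 (M * m))" using m m1 M by (auto intro!: ind_norm_pos)
    have "ln (1 + M) / (2 * pi\<^sup>2 * M) * N (ind 0 (M * m)) \<le> C\<^sup>2 * N (ind 0 m)"
      by (rule ind_dilate[OF m(1) M m(2)])
    then have "ln (1 + M) * N (ind 0 (M * m)) \<le> M * (D * N (ind 0 m))"
      using M by (simp add: D_def field_simps)
    also have "\<dots> \<le> M * (ln (1 + M) / 2 * N (ind 0 m))"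
      using M lnM nn by (intro mult_left_mono mult_right_mono) auto
    finally have "ln (1 + M) * N (ind 0 (M * m)) \<le> ln (1 + M) * (M * (1 / 2) * N (ind 0 m))"
      by (simp add: mult_ac)
    then have "N (ind 0 (M * m)) \<le> M * (1 / 2) * N (ind 0 m)"
      using M by (subst (asm) mult_le_cancel_left_pos) auto
    also have "\<dots> \<le> M * \<theta> * N (ind 0 m)"
      using M nn by (intro mult_left_mono mult_right_mono) (auto simp: \<theta>_def)
    finally show ?thesis by (simp add: Mb)
  qed
  define c where "c = N (ind 0 (1 / M))"
  have c: "0 < c" unfolding c_def using M by (intro ind_norm_pos) auto
  \<comment> \<open>Induction over scales. Whenever M m > 1 the claim follows from monotonicity of
    the norm, since m^\<beta> \<le> 1; otherwise \<open>step\<close> reduces m to M m.\<close>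
  have main: "c * m powr \<beta> \<le> N (ind 0 m)" if "(1 / M) ^ Suc k < m" "m \<le> 1" for k m
    using that
  proof (induction k arbitrary: m)
    case 0
    then have m: "1 / M < m" "m \<le> 1" "0 < 1 / M" using M by auto
    then have m0: "0 < m" by linarith
    have "m powr \<beta> \<le> 1 powr \<beta>" using m m0 \<beta> by (intro powr_mono2) auto
    then have "c * m powr \<beta> \<le> c * 1" using c by (intro mult_left_mono) auto
    also have "\<dots> \<le> N (ind 0 m)"
      unfolding c_def mult_1_right by (rule ind_le_ind(2)[OF ind_mem]) (use m m0 M in auto)
    finally show ?case .
  next
    case (Suc k)
    have "0 < (1 / M) ^ Suc (Suc k)" using M by simp
    then have m0: "0 < m" using Suc.prems by linarith
    show ?case
    proof (cases "M * m \<le> 1")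
      case True
      have "M * (1 / M) ^ Suc (Suc k) < M * m" using Suc.prems M by (intro mult_strict_left_mono) auto
      moreover have "M * (1 / M) ^ Suc (Suc k) = (1 / M) ^ Suc k" using M by simp
      ultimately have "c * (M * m) powr \<beta> \<le> N (ind 0 (M * m))" using True by (intro Suc.IH) auto
      also have "\<dots> \<le> M powr \<beta> * N (ind 0 m)" by (rule step[OF m0 True])
      finally have "M powr \<beta> * (c * m powr \<beta>) \<le> M powr \<beta> * N (ind 0 m)" by (simp add: powr_mult mult_ac)
      moreover have "0 < M powr \<beta>" using M by simp
      ultimately show ?thesis by (simp only: mult_le_cancel_left_pos)
    next
      case False
      then have m: "1 / M < m" "m \<le> 1" "0 < 1 / M" using M Suc.prems by (auto simp: field_simps)
      have "m powr \<beta> \<le> 1 powr \<beta>" using m m0 \<beta> by (intro powr_mono2) auto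
      then have "c * m powr \<beta> \<le> c * 1" using c by (intro mult_left_mono) auto
      also have "\<dots> \<le> N (ind 0 m)"
        unfolding c_def mult_1_right by (rule ind_le_ind(2)[OF ind_mem]) (use m m0 M in auto)
      finally show ?thesis .
    qed
  qed
  have "c * m powr \<beta> \<le> N (ind 0 m)" if m: "0 < m" "m \<le> 1" for m
  proof -
    obtain k where "(1 / M) ^ k < m" using real_arch_pow_inv[OF m(1), of "1 / M"] M by auto
    moreover have "(1 / M) ^ Suc k \<le> (1 / M) ^ k" using M by (intro power_decreasing) auto
    ultimately show ?thesis using main[of k m] m by linarith
  qed
  then show thesis using that c \<beta> by blast
qed

end

section \<open>Neumann series\<close>

context ri_space
begin

lemma minus_norm: "f \<in> X \<Longrightarrow> g \<in> X \<Longrightarrow> N (\<lambda>x. f x - g x) = N (\<lambda>x. g x - f x)"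
  using norm_scale[OF diff_mem[of g f], of "-1"] by simp

lemma diff_triangle:
  assumes "f \<in> X" "g \<in> X" "h \<in> X"
  shows "N (\<lambda>x. f x - h x) \<le> N (\<lambda>x. f x - g x) + N (\<lambda>x. g x - h x)"
  using norm_triangle[OF diff_mem[OF assms(1,2)] diff_mem[OF assms(2,3)]] by simp

lemma norm_ae_cong:
  assumes "f \<in> X" "g \<in> X" "AE x in leb_I. f x = g x" shows "N f = N g"
  using ae_eq_mem(2)[OF assms(1) in_L0[OF assms(2)] assms(3)] by simp

text \<open>Surjectivity survives a small perturbation: a bounded right inverse B turns the equation
  into the fixed point problem u = B (g - \<delta> u), a contraction with factor 1/2. Successive
  iterates are compared almost everywhere, as linearity holds only there.\<close>

lemma perturbed_solution:
  assumes A: "bounded_op X N A" and B: "bounded_op X N B"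
    and AB: "\<And>f. f \<in> X \<Longrightarrow> AE x in leb_I. A (B f) x = f x"
    and K: "\<And>f. f \<in> X \<Longrightarrow> N (B f) \<le> K * N f" "0 \<le> K" and \<delta>: "norm \<delta> * K \<le> 1 / 2"
    and g: "g \<in> X"
  shows "\<exists>u\<in>X. AE x in leb_I. A u x + \<delta> * u x = g x"
proof -
  have Am: "\<And>f. f \<in> X \<Longrightarrow> A f \<in> X" and Bm: "\<And>f. f \<in> X \<Longrightarrow> B f \<in> X"
    and Aadd: "\<And>f g. f \<in> X \<Longrightarrow> g \<in> X \<Longrightarrow> AE x in leb_I. A (\<lambda>y. f y + g y) x = A f x + A g x"
    and Badd: "\<And>f g. f \<in> X \<Longrightarrow> g \<in> X \<Longrightarrow> AE x in leb_I. B (\<lambda>y. f y + g y) x = B f x + B g x"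
    using A B by (auto simp: bounded_op_def)
  obtain CA where CA: "\<And>f. f \<in> X \<Longrightarrow> N (A f) \<le> CA * N f"
    using A unfolding bounded_op_def by blast
  define u where "u = rec_nat (\<lambda>x. 0) (\<lambda>_ w. B (\<lambda>x. g x - \<delta> * w x))"
  have u0: "u 0 = (\<lambda>x. 0)" and uS: "\<And>n. u (Suc n) = B (\<lambda>x. g x - \<delta> * u n x)"
    by (simp_all add: u_def)
  have gm: "(\<lambda>x. g x - \<delta> * w x) \<in> X" if "w \<in> X" for w by (rule diff_mem[OF g scale_mem[OF that]])
  have uX: "u n \<in> X" for n
    by (induction n) (simp_all add: u0 uS zero_mem Bm gm)
  define D where "D = N (\<lambda>x. u 1 x - u 0 x)"
  have D0: "0 \<le> D" unfolding D_def by (rule norm_nonneg[OF diff_mem[OF uX uX]])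
  have step: "N (\<lambda>x. u (Suc (Suc n)) x - u (Suc n) x) \<le> 1 / 2 * N (\<lambda>x. u (Suc n) x - u n x)" for n
  proof -
    let ?r = "\<lambda>x. (- \<delta>) * (u (Suc n) x - u n x)"
    have rX: "?r \<in> X" by (rule scale_mem[OF diff_mem[OF uX uX]])
    have "(\<lambda>x. g x - \<delta> * u (Suc n) x) = (\<lambda>x. (g x - \<delta> * u n x) + ?r x)"
      by (simp add: fun_eq_iff algebra_simps)
    then have "AE x in leb_I. u (Suc (Suc n)) x = u (Suc n) x + B ?r x"
      using Badd[OF gm[OF uX[of n]] rX] by (simp only: uS)
    then have "AE x in leb_I. u (Suc (Suc n)) x - u (Suc n) x = B ?r x"
      by eventually_elim simp
    then have "N (\<lambda>x. u (Suc (Suc n)) x - u (Suc n) x) = N (B ?r)"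
      by (rule norm_ae_cong[OF diff_mem[OF uX uX] Bm[OF rX]])
    also have "\<dots> \<le> K * N ?r" by (rule K(1)[OF rX])
    also have "N ?r = norm \<delta> * N (\<lambda>x. u (Suc n) x - u n x)"
      using norm_scale[OF diff_mem[OF uX uX], of "-\<delta>"] by simp
    also have "K * (norm \<delta> * N (\<lambda>x. u (Suc n) x - u n x)) = (norm \<delta> * K) * N (\<lambda>x. u (Suc n) x - u n x)" by simp
    also have "\<dots> \<le> 1 / 2 * N (\<lambda>x. u (Suc n) x - u n x)"
      using \<delta> norm_nonneg[OF diff_mem[OF uX uX]] by (intro mult_right_mono) auto
    finally show ?thesis .
  qed
  have decay: "N (\<lambda>x. u (Suc n) x - u n x) \<le> D * (1 / 2) ^ n" for n
  proof (induction n)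
    case (Suc n)
    then show ?case using step[of n] by simp
  qed (simp add: D_def)
  \<comment> \<open>The bound is the exact geometric sum; its last factor is what lets the induction
    on k close.\<close>
  have dist: "N (\<lambda>x. u (n + k) x - u n x) \<le> 2 * D * (1 / 2) ^ n * (1 - (1 / 2) ^ k)" for n k
  proof (induction k)
    case 0
    have "N (\<lambda>x. 0) = 0" using norm_eq_0[OF zero_mem] by simp
    then show ?case by simp
  next
    case (Suc k)
    have "N (\<lambda>x. u (n + Suc k) x - u n x) \<le> D * (1 / 2) ^ (n + k) + 2 * D * (1 / 2) ^ n * (1 - (1 / 2) ^ k)"
      using diff_triangle[OF uX[of "n + Suc k"] uX[of "n + k"] uX[of n]] decay[of "n + k"] Suc by simp
    also have "\<dots> = 2 * D * (1 / 2) ^ n * (1 - (1 / 2) ^ Suc k)"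
      by (simp add: power_add algebra_simps)
    finally show ?case .
  qed
  have dist': "N (\<lambda>x. u (n + k) x - u n x) \<le> 2 * D * (1 / 2) ^ n" for n k
  proof -
    have "2 * D * (1 / 2) ^ n * (1 - (1 / 2) ^ k) \<le> 2 * D * (1 / 2) ^ n * 1"
      using D0 by (intro mult_left_mono) auto
    then show ?thesis using dist[of n k] by simp
  qed
  have cauchy: "\<forall>e>0. \<exists>M. \<forall>m\<ge>M. \<forall>n\<ge>M. N (\<lambda>x. u m x - u n x) < e"
  proof (intro allI impI)
    fix e :: real assume e: "0 < e"
    have "(\<lambda>n. 4 * D * (1 / 2) ^ n) \<longlonglongrightarrow> 4 * D * 0"
      by (intro tendsto_intros LIMSEQ_power_zero) simp
    then have "\<forall>\<^sub>F n in sequentially. 4 * D * (1 / 2) ^ n < e"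
      using e by (intro order_tendstoD(2)) auto
    then obtain M where M: "4 * D * (1 / 2) ^ M < e" by (auto simp: eventually_sequentially)
    have "N (\<lambda>x. u m x - u n x) < e" if "M \<le> m" "M \<le> n" for m n
    proof -
      have "N (\<lambda>x. u m x - u n x) \<le> N (\<lambda>x. u m x - u M x) + N (\<lambda>x. u M x - u n x)"
        by (rule diff_triangle[OF uX uX uX])
      also have "N (\<lambda>x. u M x - u n x) = N (\<lambda>x. u n x - u M x)" by (rule minus_norm[OF uX uX])
      also have "N (\<lambda>x. u m x - u M x) + \<dots> \<le> 2 * D * (1 / 2) ^ M + 2 * D * (1 / 2) ^ M"
        using dist'[of M "m - M"] dist'[of M "n - M"] that by (intro add_mono) auto
      also have "\<dots> < e" using M by simp
      finally show ?thesis .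
    qed
    then show "\<exists>M. \<forall>m\<ge>M. \<forall>n\<ge>M. N (\<lambda>x. u m x - u n x) < e" by blast
  qed
  obtain w where w: "w \<in> X" and lim: "(\<lambda>n. N (\<lambda>x. u n x - w x)) \<longlonglongrightarrow> 0"
    using complete[OF uX cauchy] by blast
  let ?R = "\<lambda>x. A w x + \<delta> * w x - g x"
  have RX: "?R \<in> X" by (intro diff_mem add_mem Am scale_mem w g)
  \<comment> \<open>Since A u_(n+1) = g - \<delta> u_n, the residual equals \<delta> (w - u_n) + A
    (w - u_(n+1)), and both terms tend to 0 in norm.\<close>
  have "N ?R \<le> norm \<delta> * N (\<lambda>x. u n x - w x) + CA * N (\<lambda>x. u (Suc n) x - w x)" for n
  proof -
    let ?p = "\<lambda>x. \<delta> * (w x - u n x)" and ?s = "\<lambda>x. w x - u (Suc n) x"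
    have sX: "?s \<in> X" and pX: "?p \<in> X" by (intro diff_mem scale_mem w uX)+
    have "AE x in leb_I. A (\<lambda>y. u (Suc n) y + ?s y) x = A (u (Suc n)) x + A ?s x" by (rule Aadd[OF uX sX])
    then have "AE x in leb_I. A w x = A (u (Suc n)) x + A ?s x" by simp
    moreover have "AE x in leb_I. A (u (Suc n)) x = g x - \<delta> * u n x"
      unfolding uS by (rule AB[OF gm[OF uX]])
    ultimately have "AE x in leb_I. ?R x = ?p x + A ?s x"
      by eventually_elim (simp add: algebra_simps)
    then have "N ?R = N (\<lambda>x. ?p x + A ?s x)" by (rule norm_ae_cong[OF RX add_mem[OF pX Am[OF sX]]])
    also have "\<dots> \<le> N ?p + N (A ?s)" by (rule norm_triangle[OF pX Am[OF sX]])
    also have "\<dots> \<le> norm \<delta> * N (\<lambda>x. w x - u n x) + CA * N ?s"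
      using CA[OF sX] norm_scale[OF diff_mem[OF w uX], of \<delta> n] by simp
    finally show ?thesis unfolding minus_norm[OF w uX] .
  qed
  moreover have "(\<lambda>n. norm \<delta> * N (\<lambda>x. u n x - w x) + CA * N (\<lambda>x. u (Suc n) x - w x)) \<longlonglongrightarrow> norm \<delta> * 0 + CA * 0"
    by (intro tendsto_intros lim LIMSEQ_Suc[OF lim])
  ultimately have "N ?R \<le> 0" by (intro LIMSEQ_le_const[of _ 0]) auto
  then have "N ?R = 0" using norm_nonneg[OF RX] by simp
  then have "AE x in leb_I. ?R x = 0" using norm_eq_0[OF RX] by blast
  then have "AE x in leb_I. A w x + \<delta> * w x = g x" by eventually_elim simp
  then show ?thesis using w by blast
qed

end

section \<open>Embedding into L^q\<close>

lemma measure_leb_I_le_2: "measure leb_I A \<le> 2"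
proof -
  have "measure leb_I A \<le> measure leb_I (space leb_I)" by (rule leb_I.bounded_measure)
  also have "\<dots> = 2" by (simp add: space_restrict_space measure_restrict_space)
  finally show ?thesis .
qed

text \<open>Dyadic levels: |f|^q is at most 1 plus the sum of (2 * 2^k)^q over all k with 2^k < |f|.
  The weak type bound makes the integrated series geometric with ratio 2^(q - p) < 1.\<close>

lemma weak_type_imp_Lq:
  fixes f :: "real \<Rightarrow> complex" and p q :: real
  assumes fm: "f \<in> L0" and q: "0 < q" "q < p"
    and weak: "\<And>s. 0 < s \<Longrightarrow> measure leb_I {x \<in> space leb_I. s < norm (f x)} \<le> K * s powr (- p)"
  shows "integrable leb_I (\<lambda>x. norm (f x) powr q)"
proof (rule integrableI_bounded)
  let ?S = "\<lambda>k::nat. {x \<in> space leb_I. 2 ^ k < norm (f x)}"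
  have S: "?S k \<in> sets leb_I" for k by (rule level_set_sets[OF fm])
  have K0: "0 \<le> K" using order_trans[OF measure_nonneg weak[of 1]] by simp
  define r where "r = 2 powr (q - p)"
  have r: "0 < r" "r < 1" using q powr_less_mono[of "q - p" 0 2] by (auto simp: r_def)
  show "(\<lambda>x. norm (f x) powr q) \<in> borel_measurable leb_I" using fm by measurable
  have ptw: "ennreal (norm (f x) powr q) \<le> 1 + (\<Sum>k. ennreal ((2 * 2 ^ k) powr q) * indicator (?S k) x)"
    if x: "x \<in> space leb_I" for x
  proof (cases "norm (f x) \<le> 1")
    case True
    then have "norm (f x) powr q \<le> 1 powr q" using q by (intro powr_mono2) auto
    then have "ennreal (norm (f x) powr q) \<le> 1" by (simp add: ennreal_le_1)
    then show ?thesis by (rule order_trans) simp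
  next
    case False
    define n where "n = (LEAST n. norm (f x) \<le> 2 ^ n)"
    have "\<exists>n. norm (f x) \<le> 2 ^ n" using real_arch_pow[of 2 "norm (f x)"] by (auto intro: less_imp_le)
    then have n: "norm (f x) \<le> 2 ^ n" unfolding n_def by (rule LeastI_ex)
    obtain k where k: "n = Suc k" using n False by (cases n) auto
    have "\<not> norm (f x) \<le> 2 ^ k" using not_less_Least[of k "\<lambda>n. norm (f x) \<le> 2 ^ n"] k n_def by auto
    then have xS: "x \<in> ?S k" using x by simp
    have "norm (f x) powr q \<le> (2 * 2 ^ k) powr q" using n k q by (intro powr_mono2) auto
    then have "ennreal (norm (f x) powr q) \<le> ennreal ((2 * 2 ^ k) powr q) * indicator (?S k) x"
      using xS by (simp add: ennreal_leI)
    also have "\<dots> \<le> (\<Sum>k. ennreal ((2 * 2 ^ k) powr q) * indicator (?S k) x)"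
    proof -
      have "h k \<le> suminf h" for h :: "nat \<Rightarrow> ennreal" using sum_le_suminf[of h "{k}"] by simp
      then show ?thesis .
    qed
    finally show ?thesis by (rule order_trans) simp
  qed
  have "(\<integral>\<^sup>+x. ennreal (norm (norm (f x) powr q)) \<partial>leb_I) \<le> (\<integral>\<^sup>+x. 1 + (\<Sum>k. ennreal ((2 * 2 ^ k) powr q) * indicator (?S k) x) \<partial>leb_I)"
    by (rule nn_integral_mono) (use ptw in simp)
  also have "\<dots> = (\<integral>\<^sup>+x. 1 \<partial>leb_I) + (\<integral>\<^sup>+x. (\<Sum>k. ennreal ((2 * 2 ^ k) powr q) * indicator (?S k) x) \<partial>leb_I)"
    by (rule nn_integral_add) (use S in \<open>auto intro!: borel_measurable_suminf_order\<close>)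
  also have "(\<integral>\<^sup>+x. (\<Sum>k. ennreal ((2 * 2 ^ k) powr q) * indicator (?S k) x) \<partial>leb_I)
      = (\<Sum>k. \<integral>\<^sup>+x. ennreal ((2 * 2 ^ k) powr q) * indicator (?S k) x \<partial>leb_I)"
    by (rule nn_integral_suminf) (use S in auto)
  also have "\<dots> = (\<Sum>k. ennreal ((2 * 2 ^ k) powr q) * emeasure leb_I (?S k))"
    using S by (simp add: nn_integral_cmult_indicator)
  also have "\<dots> \<le> (\<Sum>k. ennreal (2 powr q * K * r ^ k))"
  proof (rule suminf_le)
    fix k
    have "(2 * 2 ^ k) powr q * measure leb_I (?S k) \<le> (2 * 2 ^ k) powr q * (K * (2 ^ k) powr (- p))"
      using weak[of "2 ^ k"] by (intro mult_left_mono) auto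
    also have "\<dots> = 2 powr q * K * ((2 ^ k) powr q * (2 ^ k) powr (- p))" by (simp add: powr_mult)
    also have "(2 ^ k) powr q * (2 ^ k) powr (- p) = (2 powr real k) powr (q - p)"
      by (simp add: powr_add[symmetric] powr_realpow)
    also have "\<dots> = r ^ k" unfolding r_def by (simp add: powr_powr powr_realpow[symmetric] mult.commute)
    finally show "ennreal ((2 * 2 ^ k) powr q) * emeasure leb_I (?S k) \<le> ennreal (2 powr q * K * r ^ k)"
      unfolding leb_I.emeasure_eq_measure by (subst ennreal_mult[symmetric]) (auto intro: ennreal_leI)
  qed auto
  also have "(\<Sum>k. ennreal (2 powr q * K * r ^ k)) = ennreal (\<Sum>k. 2 powr q * K * r ^ k)"
    by (rule suminf_ennreal2) (use K0 r in \<open>auto intro!: summable_mult summable_geometric\<close>)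
  also have "(\<integral>\<^sup>+x. 1 \<partial>leb_I) + ennreal (\<Sum>k. 2 powr q * K * r ^ k) < \<infinity>"
    using leb_I.emeasure_finite[of "space leb_I"] by (simp add: less_top[symmetric])
  finally show "(\<integral>\<^sup>+x. ennreal (norm (norm (f x) powr q)) \<partial>leb_I) < \<infinity>" by (simp add: add_left_mono)
qed

context ri_hilbert
begin

text \<open>Chebyshev's inequality in X combined with the lower bound c m^\<beta> for indicators
  shows that elements of X are of weak type 1 / \<beta>, and 1 / \<beta> > 1.\<close>

lemma Lq_embed:
  "\<exists>q>1. q < 2 \<and> (\<forall>f\<in>X. integrable leb_I (\<lambda>x. norm (f x) powr q))"
proof -
  obtain c \<beta> where c: "0 < c" and \<beta>: "0 < \<beta>" "\<beta> < 1"
    and low: "\<And>m. 0 < m \<Longrightarrow> m \<le> 1 \<Longrightarrow> c * m powr \<beta> \<le> N (ind 0 m)"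
    using ind_norm_lower by blast
  \<comment> \<open>The midpoint of 1 and 1 / \<beta>, capped at 3/2 to stay below 2.\<close>
  define q where "q = min (3 / 2) ((1 + 1 / \<beta>) / 2)"
  have b1: "1 < 1 / \<beta>" using \<beta> by simp
  have q: "1 < q" "q < 2" "q < 1 / \<beta>" using b1 by (auto simp: q_def min_def)
  have "integrable leb_I (\<lambda>x. norm (f x) powr q)" if f: "f \<in> X" for f
  proof (rule weak_type_imp_Lq[OF in_L0[OF f], of q "1 / \<beta>" "2 * (N f / c) powr (1 / \<beta>)"])
    fix s :: real assume s: "0 < s"
    define \<mu> where "\<mu> = measure leb_I {x \<in> space leb_I. s < norm (f x)}"
    have em: "level_measure f s = ennreal \<mu>" unfolding \<mu>_def by (rule leb_I.emeasure_eq_measure)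
    have \<mu>2: "\<mu> \<le> 2" unfolding \<mu>_def by (rule measure_leb_I_le_2)
    show "\<mu> \<le> 2 * (N f / c) powr (1 / \<beta>) * s powr (- (1 / \<beta>))"
    proof (cases "\<mu> = 0")
      case False
      then have \<mu>0: "0 < \<mu>" by (simp add: \<mu>_def zero_less_measure_iff)
      \<comment> \<open>The norms of indicators are bounded below for lengths up to 1 only; a level
        set has measure at most 2, so replacing \<mu> by m loses at most a factor 2.\<close>
      define m where "m = min 1 \<mu>"
      have m: "0 < m" "m \<le> 1" "\<mu> \<le> 2 * m" "m \<le> \<mu>" using \<mu>0 \<mu>2 by (auto simp: m_def)
      have "s * N (ind 0 m) \<le> N f"
        by (rule ind_le_level(2)[OF f s]) (use m em in \<open>auto intro!: ennreal_leI\<close>)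
      moreover have "s * (c * m powr \<beta>) \<le> s * N (ind 0 m)" using low[OF m(1,2)] s by simp
      ultimately have "s * (c * m powr \<beta>) \<le> N f" by linarith
      then have "m powr \<beta> \<le> N f / c / s" using s c by (simp add: field_simps)
      then have "(m powr \<beta>) powr (1 / \<beta>) \<le> (N f / c / s) powr (1 / \<beta>)" using \<beta> by (intro powr_mono2) auto
      moreover have "(m powr \<beta>) powr (1 / \<beta>) = m" using \<beta> m by (simp add: powr_powr)
      moreover have "(N f / c / s) powr (1 / \<beta>) = (N f / c) powr (1 / \<beta>) * s powr (- (1 / \<beta>))"
        using s c norm_nonneg[OF f] unfolding powr_minus_divide by (simp add: powr_divide powr_mult)
      ultimately show ?thesis using m(3) by linarith
    qed simp
  qed (use q in auto)
  then show ?thesis using q by (intro exI[of _ q]) simp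
qed

lemma mem_integrable:
  assumes "f \<in> X" shows "integrable leb_I f"
proof -
  from Lq_embed obtain q where "1 < q" "\<forall>f\<in>X. integrable leb_I (\<lambda>x. norm (f x) powr q)"
    by (elim exE conjE)
  with assms show ?thesis by (intro integrable_of_powr[OF less_imp_le in_L0]) blast+
qed

text \<open>Wherever the limit fails to exist, \<open>finite_hilbert\<close> takes one and the same arbitrary
  value \<open>a\<close>. Homogeneity forces \<open>a = 0\<close>, and additivity then forces the transform of
  $\sqrt{1-x^2}$, a nonconstant affine function, to vanish there too.\<close>

lemma has_pv_ae:
  assumes u: "u \<in> X"
  shows "AE t in leb_I. has_pv u t (of_real pi * \<i> * finite_hilbert u t)"
proof -
  \<comment> \<open>\<open>Lim\<close> is a definite description; without a limit its predicate is
    constantly false, so the value depends neither on the function nor on the point.\<close>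
  define a where "a = (THE l::complex. False)"
  have ui: "integrable leb_I u" by (rule mem_integrable[OF u])
  have junk: "finite_hilbert w t = a" if "integrable leb_I w" "-1 < t" "t < 1" "\<And>L. \<not> has_pv w t L" for w t
    unfolding finite_hilbert_def t2_space_class.Lim_def a_def finite_hilbert_tendsto_iff[OF that(1-3)]
    using that(4) by simp
  define f where "f = hilbert_eigenfun 0"
  have fi: "integrable leb_I f" unfolding f_def by (rule integrable_hilbert_eigenfun)
  \<comment> \<open>This is sqrt (1 - x^2), bounded and hence in X, with an explicit principal value
    at every point of the interval.\<close>
  define v where "v = (\<lambda>x. of_real ((1 - x\<^sup>2) * x ^ 0) * f x)"
  define M where "M i = (\<integral>x. of_real (x ^ i) * f x \<partial>leb_I)" for i
  have M0: "M 0 \<noteq> 0" using integral_hilbert_eigenfun[of 0] by (simp add: M_def f_def)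
  have vpv: "has_pv v t (- (of_real t * M 0 + M 1))" if t: "-1 < t" "t < 1" for t
  proof -
    have "has_pv f t 0" unfolding f_def by (rule has_pv_hilbert_eigenfun_0[OF t])
    from has_pv_diff_quot[OF fi this t, of 0]
    have "has_pv v t (\<integral>x. of_real (diff_quot 0 t x) * f x \<partial>leb_I)" by (simp add: v_def)
    moreover have "(\<integral>x. of_real (diff_quot 0 t x) * f x \<partial>leb_I) = - (of_real t * M 0 + M 1)"
      unfolding integral_diff_quot[OF fi] M_def by (simp add: numeral_2_eq_2)
    ultimately show ?thesis by simp
  qed
  have vL0: "v \<in> L0"
  proof -
    have "(\<lambda>x. complex_of_real ((1 - x\<^sup>2) * x ^ 0)) \<in> L0" by (rule borel_measurable_leb_I) measurable
    then show ?thesis unfolding v_def using fi by (intro borel_measurable_times) auto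
  qed
  have "AE x in leb_I. norm (v x) \<le> 1"
    using AE_leb_I_in
  proof eventually_elim
    case (elim x)
    have p: "0 < 1 - x\<^sup>2" using elim by (simp add: abs_square_less_1 abs_less_iff)
    have "norm (v x) = \<bar>1 - x\<^sup>2\<bar> * (1 / \<bar>sqrt (1 - x\<^sup>2)\<bar>)"
      unfolding v_def f_def norm_mult norm_hilbert_eigenfun norm_of_real by simp
    also have "\<dots> = sqrt (1 - x\<^sup>2)" using p by (simp add: real_div_sqrt)
    also have "\<dots> \<le> 1" by simp
    finally show ?case .
  qed
  then have vX: "v \<in> X" by (rule bounded_mem[OF vL0])
  have vi: "integrable leb_I v" by (rule mem_integrable[OF vX])
  have "AE t in leb_I. finite_hilbert (\<lambda>y. 2 * u y) t = 2 * finite_hilbert u t" by (rule hilbert_scale[OF u])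
  moreover have "AE t in leb_I. finite_hilbert (\<lambda>y. u y + v y) t = finite_hilbert u t + finite_hilbert v t"
    by (rule hilbert_add[OF u vX])
  ultimately show ?thesis
    using AE_leb_I_in AE_leb_I_neq[of "Re (- M 1 / M 0)"]
  proof eventually_elim
    case (elim t)
    have t: "-1 < t" "t < 1" using elim by auto
    have "\<exists>L. has_pv u t L"
    proof (rule ccontr)
      assume "\<nexists>L. has_pv u t L"
      then have no: "\<not> has_pv u t L" for L by blast
      have no2: "\<not> has_pv (\<lambda>y. 2 * u y) t L" for L
        using has_pv_cmult[of "\<lambda>y. 2 * u y" t L "1/2"] no by auto
      \<comment> \<open>Adding v, which has a principal value at t, cannot create one for u + v. So
        u + v also takes the value a at t, and additivity leaves 0 for the transform of v.\<close>
      have nov: "\<not> has_pv (\<lambda>y. u y + v y) t L" for L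
      proof
        assume h: "has_pv (\<lambda>y. u y + v y) t L"
        have "has_pv (\<lambda>y. (u y + v y) + (-1) * v y) t (L + (-1) * (- (of_real t * M 0 + M 1)))"
          by (rule has_pv_add[OF _ _ h has_pv_cmult[OF vpv[OF t]]]) (use ui vi in auto)
        then show False using no by simp
      qed
      have "finite_hilbert u t = a" by (rule junk[OF ui t no])
      moreover have "finite_hilbert (\<lambda>y. 2 * u y) t = a" by (rule junk[OF _ t no2]) (use ui in simp)
      moreover have "finite_hilbert (\<lambda>y. u y + v y) t = a" by (rule junk[OF _ t nov]) (use ui vi in simp)
      ultimately have "finite_hilbert v t = 0" using elim(1,2) by simp
      moreover define z where "z = of_real t * M 0 + M 1"
      have "finite_hilbert v t = - z / (of_real pi * \<i>)"
        unfolding z_def by (rule finite_hilbert_eqI[OF vi t vpv[OF t]])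
      ultimately have "z = 0" by simp
      then have "of_real t * M 0 + M 1 = 0" by (simp only: z_def)
      \<comment> \<open>The affine function has at most this one zero, because M 0 is nonzero, and
        the point was excluded as a null set.\<close>
      then have "complex_of_real t = - M 1 / M 0" using M0 by (simp add: field_simps eq_neg_iff_add_eq_0)
      then have "t = Re (- M 1 / M 0)" by (metis Re_complex_of_real)
      then show False using elim(4) by simp
    qed
    then obtain L where L: "has_pv u t L" by blast
    have "of_real pi * \<i> * finite_hilbert u t = L" unfolding finite_hilbert_eqI[OF ui t L] by simp
    then show ?case using L by simp
  qed
qed

text \<open>Multiplication by \<open>x\<close> commutes with the transform up to a constant, the integral of the
  function, so a multiple of \<open>x\<close> times the eigenfunction is a particular solution.\<close>

lemma resolvent_equation_solution:
  assumes u: "u \<in> X"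
    and eq: "AE x in leb_I. complex_of_real (tanh (pi * \<gamma>)) * u x - finite_hilbert u x = 1"
  obtains \<kappa> c where "\<kappa> \<noteq> 0" "AE x in leb_I. u x = (\<kappa> * of_real x + c) * hilbert_eigenfun \<gamma> x"
proof -
  from Lq_embed obtain q where q: "1 < q" "q < 2" and Lq: "\<forall>f\<in>X. integrable leb_I (\<lambda>x. norm (f x) powr q)"
    by (elim exE conjE)
  define \<mu> where "\<mu> = complex_of_real (tanh (pi * \<gamma>))"
  define f where "f = hilbert_eigenfun \<gamma>"
  have ui: "integrable leb_I u" by (rule mem_integrable[OF u])
  have fi: "integrable leb_I f" unfolding f_def by (rule integrable_hilbert_eigenfun)
  define K where "K = complex_of_real (pi / cosh (pi * \<gamma>))"
  have K: "K \<noteq> 0" by (simp add: K_def)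
  have fK: "(\<integral>x. f x \<partial>leb_I) = K" unfolding f_def K_def by (rule integral_hilbert_eigenfun)
  \<comment> \<open>From T (x f) = \<mu> x f + K / (pi i) one gets (\<mu> - T) (\<kappa> x f) =
    -\<kappa> K / (pi i), and this is to be 1.\<close>
  define \<kappa> where "\<kappa> = - (of_real pi * \<i>) / K"
  have \<kappa>: "\<kappa> \<noteq> 0" using K by (simp add: \<kappa>_def)
  have xfi: "integrable leb_I (\<lambda>x. of_real x * f x)" using integrable_power_mult[OF fi, of 1] by simp
  \<comment> \<open>The equation fixes u only up to multiples of f. This c matches the integral of
    u, so that the homogeneous solution v has mean zero and must vanish.\<close>
  define c where "c = ((\<integral>x. u x \<partial>leb_I) - \<kappa> * (\<integral>x. of_real x * f x \<partial>leb_I)) / K"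
  define v where "v x = u x + ((- \<kappa>) * (of_real x * f x) + (- c) * f x)" for x
  have vzero: "(\<integral>x. v x \<partial>leb_I) = 0"
  proof -
    have "(\<integral>x. v x \<partial>leb_I) = (\<integral>x. u x \<partial>leb_I) + ((- \<kappa>) * (\<integral>x. of_real x * f x \<partial>leb_I) + (- c) * K)"
      unfolding v_def fK[symmetric]
      by (simp only: Bochner_Integration.integral_add ui xfi fi integrable_mult_right Bochner_Integration.integrable_add integral_mult_right_zero)
    then show ?thesis using K by (simp add: c_def)
  qed
  have vm: "v \<in> L0" unfolding v_def[abs_def]
    using ui xfi fi by (intro borel_measurable_add borel_measurable_times) auto
  define B where "B = norm \<kappa> + norm c"
  have vle: "norm (v x) powr q \<le> 2 powr q * (norm (u x) powr q + B powr q * norm (f x) powr q)" if x: "-1 < x" "x < 1" for x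
  proof -
    have "norm (v x) \<le> norm (u x) + B * norm (f x)"
    proof -
      have "norm ((- \<kappa>) * of_real x + (- c)) \<le> norm \<kappa> * \<bar>x\<bar> + norm c"
        using norm_triangle_ineq[of "(- \<kappa>) * of_real x" "- c"] by (simp add: norm_mult)
      also have "\<dots> \<le> B" unfolding B_def using x by (intro add_right_mono mult_left_le) auto
      finally have "norm ((- \<kappa>) * of_real x + (- c)) * norm (f x) \<le> B * norm (f x)" by (rule mult_right_mono) simp
      moreover have "v x = u x + ((- \<kappa>) * of_real x + (- c)) * f x" by (simp add: v_def algebra_simps)
      ultimately show ?thesis
        using norm_triangle_ineq[of "u x" "((- \<kappa>) * of_real x + (- c)) * f x"] by (simp only: norm_mult)
    qed
    then have "norm (v x) powr q \<le> (norm (u x) + B * norm (f x)) powr q" using q by (intro powr_mono2) auto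
    also have "\<dots> \<le> 2 powr q * (norm (u x) powr q + (B * norm (f x)) powr q)"
      using q by (intro powr_sum_le) (auto simp: B_def)
    finally show ?thesis by (simp add: powr_mult)
  qed
  have vq: "integrable leb_I (\<lambda>x. norm (v x) powr q)"
  proof (rule Bochner_Integration.integrable_bound)
    show "integrable leb_I (\<lambda>x. 2 powr q * (norm (u x) powr q + B powr q * norm (f x) powr q))"
      by (intro integrable_mult_right Bochner_Integration.integrable_add bspec[OF Lq u]) (simp add: f_def hilbert_eigenfun_Lq[OF q])
    show "(\<lambda>x. norm (v x) powr q) \<in> borel_measurable leb_I" using vm by measurable
    show "AE x in leb_I. norm (norm (v x) powr q) \<le> norm (2 powr q * (norm (u x) powr q + B powr q * norm (f x) powr q))"
      using AE_leb_I_in by eventually_elim (use vle in \<open>fastforce intro: order_trans\<close>)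
  qed
  have "AE t in leb_I. has_pv v t (\<i> * of_real (pi * tanh (pi * \<gamma>)) * v t)"
    using has_pv_ae[OF u] eq AE_leb_I_in
  proof eventually_elim
    case (elim t)
    have t: "-1 < t" "t < 1" using elim by auto
    have Tu: "finite_hilbert u t = \<mu> * u t - 1" using elim(2) by (simp add: \<mu>_def algebra_simps)
    have fpv: "has_pv f t (of_real pi * \<i> * \<mu> * f t)"
      using has_pv_hilbert_eigenfun[OF t, of \<gamma>] by (simp add: f_def \<mu>_def mult_ac)
    have xpv: "has_pv (\<lambda>x. of_real x * f x) t (of_real t * (of_real pi * \<i> * \<mu> * f t) + K)"
    proof -
      have "has_pv (\<lambda>x. of_real x * f x) t (of_real t * (of_real pi * \<i> * \<mu> * f t) + (\<integral>x. of_real 1 * f x \<partial>leb_I))"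
        by (rule has_pv_poly_factor[OF fpv _ fi]) (use fi in auto)
      then show ?thesis by (simp add: fK)
    qed
    have "has_pv v t (of_real pi * \<i> * (\<mu> * u t - 1)
        + ((- \<kappa>) * (of_real t * (of_real pi * \<i> * \<mu> * f t) + K) + (- c) * (of_real pi * \<i> * \<mu> * f t)))"
      unfolding v_def[abs_def]
      using elim(1) ui xfi fi
      by (intro has_pv_add has_pv_cmult xpv fpv) (auto simp: Tu)
    moreover have "of_real pi * \<i> * (\<mu> * u t - 1)
        + ((- \<kappa>) * (of_real t * (of_real pi * \<i> * \<mu> * f t) + K) + (- c) * (of_real pi * \<i> * \<mu> * f t))
        = of_real pi * \<i> * \<mu> * v t"
    proof -
      have "(- \<kappa>) * K = of_real pi * \<i>" using K by (simp add: \<kappa>_def)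
      then show ?thesis by (simp only: v_def distrib_left) (simp add: algebra_simps)
    qed
    ultimately show ?case by (simp add: \<mu>_def mult_ac)
  qed
  from hilbert_eigenfun_kernel_unique[OF q vm vq this vzero]
  have "AE x in leb_I. u x = (\<kappa> * of_real x + c) * hilbert_eigenfun \<gamma> x"
    by eventually_elim (simp add: v_def f_def algebra_simps add_eq_0_iff)
  then show thesis using that \<kappa> by blast
qed

end

section \<open>The spectrum\<close>

context ri_space
begin

text \<open>Near the endpoint e the linear factor is bounded away from 0, so that f is dominated
  there by a multiple of u. The condition 1 - r < e x describes a neighbourhood of either
  endpoint.\<close>

lemma near_endpoint_mem:
  assumes u: "u \<in> X" and eq: "AE x in leb_I. u x = (\<kappa> * of_real x + c) * hilbert_eigenfun \<gamma> x"
    and e: "e = 1 \<or> e = -1" and nz: "\<kappa> * of_real e + c \<noteq> 0"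
  obtains r where "0 < r" "r < 1" "(\<lambda>x. (if 1 - r < e * x then 1 else 0) * hilbert_eigenfun \<gamma> x) \<in> X"
proof -
  \<comment> \<open>Half of the value at e: over a distance r the linear factor changes by at most
    |\<kappa>| r \<le> \<eta>, so at least \<eta> remains.\<close>
  define \<eta> where "\<eta> = norm (\<kappa> * of_real e + c) / 2"
  have \<eta>: "0 < \<eta>" using nz by (simp add: \<eta>_def)
  define r where "r = min (1 / 2) (\<eta> / (norm \<kappa> + 1))"
  have k1: "0 < norm \<kappa> + 1" by (simp add: add_nonneg_pos)
  have r: "0 < r" "r < 1" "r \<le> \<eta> / (norm \<kappa> + 1)" using \<eta> k1 by (auto simp: r_def)
  have kr: "norm \<kappa> * r \<le> \<eta>"
  proof -
    have "norm \<kappa> * r \<le> (norm \<kappa> + 1) * r" using r by (intro mult_right_mono) auto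
    also have "\<dots> \<le> \<eta>" using r(3) k1 by (simp add: pos_le_divide_eq mult.commute)
    finally show ?thesis .
  qed
  let ?w = "\<lambda>x. (if 1 - r < e * x then 1 else 0) * hilbert_eigenfun \<gamma> x"
  have m: "(\<lambda>x. if 1 - r < e * x then 1 else 0 :: complex) \<in> L0"
    by (rule borel_measurable_leb_I) measurable
  have wL0: "?w \<in> L0"
    by (rule borel_measurable_times[OF m borel_measurable_integrable[OF integrable_hilbert_eigenfun]])
  have "AE x in leb_I. norm (?w x) \<le> norm (of_real (1 / \<eta>) * u x)"
    using eq AE_leb_I_in
  proof eventually_elim
    case (elim x)
    show ?case
    proof (cases "1 - r < e * x")
      case True
      have d: "\<bar>x - e\<bar> \<le> r" using e True elim(2) by auto
      have "\<kappa> * of_real e + c = (\<kappa> * of_real x + c) - \<kappa> * of_real (x - e)" by (simp add: algebra_simps)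
      then have "norm (\<kappa> * of_real e + c) \<le> norm (\<kappa> * of_real x + c) + norm (\<kappa> * of_real (x - e))"
        using norm_triangle_ineq4[of "\<kappa> * of_real x + c" "\<kappa> * of_real (x - e)"] by (simp only:)
      then have "2 * \<eta> \<le> norm (\<kappa> * of_real x + c) + norm \<kappa> * \<bar>x - e\<bar>"
        unfolding norm_mult norm_of_real by (simp add: \<eta>_def)
      moreover have "norm \<kappa> * \<bar>x - e\<bar> \<le> \<eta>" using mult_left_mono[OF d, of "norm \<kappa>"] kr by simp
      ultimately have "\<eta> \<le> norm (\<kappa> * of_real x + c)" by linarith
      then have "1 \<le> norm (\<kappa> * of_real x + c) / \<eta>" using \<eta> by simp
      then have "1 * norm (hilbert_eigenfun \<gamma> x) \<le> norm (\<kappa> * of_real x + c) / \<eta> * norm (hilbert_eigenfun \<gamma> x)"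
        by (rule mult_right_mono) simp
      then show ?thesis using True \<eta> elim(1) by (simp add: norm_mult norm_divide)
    qed simp
  qed
  from dominated(1)[OF wL0 scale_mem[OF u] this] show thesis using that r by blast
qed

text \<open>|f| is even, so reflecting the piece near one endpoint takes care of the other, even if
  the linear factor vanishes there; in between f is bounded.\<close>

lemma hilbert_eigenfun_mem_of_solution:
  assumes u: "u \<in> X" and \<kappa>: "\<kappa> \<noteq> 0"
    and eq: "AE x in leb_I. u x = (\<kappa> * of_real x + c) * hilbert_eigenfun \<gamma> x"
  shows "hilbert_eigenfun \<gamma> \<in> X"
proof -
  have "\<exists>e. (e = 1 \<or> e = -1) \<and> \<kappa> * of_real e + c \<noteq> 0"
  proof (rule ccontr)
    assume "\<not> ?thesis"
    then have "\<kappa> * of_real 1 + c = 0" "\<kappa> * of_real (-1) + c = 0" by blast+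
    then have "2 * \<kappa> = 0" by (simp add: algebra_simps)
    then show False using \<kappa> by simp
  qed
  then obtain e where e: "e = 1 \<or> e = -1" "\<kappa> * of_real e + c \<noteq> 0" by blast
  obtain r where r: "0 < r" "r < 1" and w: "(\<lambda>x. (if 1 - r < e * x then 1 else 0) * hilbert_eigenfun \<gamma> x) \<in> X"
    using near_endpoint_mem[OF u eq e] by blast
  let ?f = "hilbert_eigenfun \<gamma>"
  let ?w = "\<lambda>x. (if 1 - r < e * x then 1 else 0) * ?f x"
  have absX: "(\<lambda>x. complex_of_real (norm (g x))) \<in> X" if "g \<in> X" for g
    by (rule dominated(1)[OF _ that]) (use in_L0[OF that] in auto)
  define b where "b = 1 / sqrt (1 - (1 - r)\<^sup>2)"
  \<comment> \<open>Moduli are added in order that the two end pieces and the constant b for the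
    middle cannot cancel.\<close>
  let ?g = "\<lambda>x. (complex_of_real (norm (?w x)) + complex_of_real (norm (?w (- x)))) + of_real b * 1"
  have gX: "?g \<in> X" by (intro add_mem absX w reflect(1)[OF w] scale_mem const_1_mem)
  have b0: "0 \<le> b"
  proof -
    have "(1 - r)\<^sup>2 \<le> 1" using r by (simp add: abs_square_le_1)
    then show ?thesis by (simp add: b_def)
  qed
  have fL0: "?f \<in> L0" using integrable_hilbert_eigenfun by simp
  have "AE x in leb_I. norm (?f x) \<le> norm (?g x)"
    using AE_leb_I_in
  proof eventually_elim
    case (elim x)
    have even: "norm (?f (- x)) = norm (?f x)" by (simp add: norm_hilbert_eigenfun)
    have "?g x = complex_of_real (norm (?w x) + norm (?w (- x)) + b)" by simp
    then have ng: "norm (?g x) = norm (?w x) + norm (?w (- x)) + b"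
      using b0 by (simp only: norm_of_real) simp
    show ?case
    proof (cases "1 - r < \<bar>x\<bar>")
      case True
      then have "1 - r < e * x \<or> 1 - r < e * (- x)" using e(1) by auto
      then have "norm (?f x) \<le> norm (?w x) + norm (?w (- x))" using even by (auto simp: norm_mult)
      then show ?thesis unfolding ng using b0 by linarith
    next
      case False
      then have "x\<^sup>2 \<le> (1 - r)\<^sup>2" using r by (metis abs_ge_zero not_le power2_abs power_mono)
      moreover have "(1 - r)\<^sup>2 < 1" using r by (simp add: abs_square_less_1)
      ultimately have "norm (?f x) \<le> b"
        unfolding norm_hilbert_eigenfun b_def by (auto intro!: frac_le real_sqrt_le_mono)
      moreover have "0 \<le> norm (?w x) + norm (?w (- x))" by simp
      ultimately show ?thesis unfolding ng by linarith
    qed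
  qed
  then show ?thesis by (rule dominated(1)[OF fL0 gX])
qed

text \<open>An eigenfunction f in X with eigenvalue \<mu> satisfies (l - T) f = (l - \<mu>) f, so an
  inverse bounded by K requires |l - \<mu>| K \<ge> 1. The eigenfunction is constructed for a \<mu>
  that violates this.\<close>

lemma not_invertible:
  assumes l: "-1 \<le> l" "l \<le> 1"
  shows "\<not> invertible_op X N (\<lambda>f x. complex_of_real l * f x - finite_hilbert f x)"
proof
  let ?A = "\<lambda>f x. complex_of_real l * f x - finite_hilbert f x"
  assume "invertible_op X N ?A"
  then obtain B where A: "bounded_op X N ?A" and B: "bounded_op X N B"
    and BA: "\<And>f. f \<in> X \<Longrightarrow> AE x in leb_I. B (?A f) x = f x"
    and AB: "\<And>f. f \<in> X \<Longrightarrow> AE x in leb_I. ?A (B f) x = f x"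
    unfolding invertible_op_def by blast
  obtain CA where CA: "\<And>f. f \<in> X \<Longrightarrow> N (?A f) \<le> CA * N f" using A unfolding bounded_op_def by blast
  obtain CB where CB: "\<And>f. f \<in> X \<Longrightarrow> N (B f) \<le> CB * N f" using B unfolding bounded_op_def by blast
  have Am: "?A f \<in> X" if "f \<in> X" for f using A that unfolding bounded_op_def by blast
  have Teq: "finite_hilbert f = (\<lambda>x. complex_of_real l * f x - ?A f x)" for f by (simp add: fun_eq_iff)
  have Tm: "finite_hilbert f \<in> X" if "f \<in> X" for f
    by (subst Teq) (rule diff_mem[OF scale_mem[OF that] Am[OF that]])
  \<comment> \<open>\<open>invertible_op\<close> includes boundedness of l - T; writing T = l - (l -
    T) with |l| \<le> 1 gives the constant.\<close>
  interpret ri_hilbert X N "1 + CA"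
  proof unfold_locales
    show "finite_hilbert f \<in> X" if "f \<in> X" for f by (rule Tm[OF that])
    show "N (finite_hilbert f) \<le> (1 + CA) * N f" if f: "f \<in> X" for f
    proof -
      have "N (finite_hilbert f) = N (\<lambda>x. complex_of_real l * f x + (-1) * ?A f x)" by (subst Teq) simp
      also have "\<dots> \<le> N (\<lambda>x. complex_of_real l * f x) + N (\<lambda>x. (-1) * ?A f x)"
        by (rule norm_triangle[OF scale_mem[OF f] scale_mem[OF Am[OF f]]])
      also have "\<dots> = \<bar>l\<bar> * N f + N (?A f)" using norm_scale[OF f, of l] norm_scale[OF Am[OF f], of "-1"] by simp
      also have "\<dots> \<le> 1 * N f + CA * N f"
        using l norm_nonneg[OF f] CA[OF f] by (intro add_mono mult_right_mono) auto
      finally show ?thesis by (simp add: distrib_right)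
    qed
    show "AE x in leb_I. finite_hilbert (\<lambda>y. f y + g y) x = finite_hilbert f x + finite_hilbert g x"
      if "f \<in> X" "g \<in> X" for f g
    proof -
      have "AE x in leb_I. ?A (\<lambda>y. f y + g y) x = ?A f x + ?A g x" using A that unfolding bounded_op_def by blast
      then show ?thesis by eventually_elim (simp add: algebra_simps)
    qed
    show "AE x in leb_I. finite_hilbert (\<lambda>y. c * f y) x = c * finite_hilbert f x" if "f \<in> X" for f c
    proof -
      have "AE x in leb_I. ?A (\<lambda>y. c * f y) x = c * ?A f x" using A that unfolding bounded_op_def by blast
      then show ?thesis by eventually_elim (simp add: algebra_simps)
    qed
  qed
  define K where "K = max 1 CB"
  have K: "1 \<le> K" by (simp add: K_def)
  have KB: "N (B f) \<le> K * N f" if "f \<in> X" for f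
    using CB[OF that] mult_right_mono[of CB K "N f"] norm_nonneg[OF that] by (simp add: K_def)
  define d where "d = 1 / (2 * K)"
  have d: "0 < d" "d \<le> 1 / 2" "d * K = 1 / 2" using K by (auto simp: d_def field_simps)
  \<comment> \<open>Moving from l towards 0 keeps \<mu> strictly inside (-1, 1), the range of tanh,
    even if l is 1 or -1, and |\<mu> - l| \<le> d = 1 / (2 K).\<close>
  define \<mu> where "\<mu> = l * (1 - d)"
  have \<mu>: "-1 < \<mu>" "\<mu> < 1"
  proof -
    have "\<bar>\<mu>\<bar> \<le> 1 * (1 - d)" unfolding \<mu>_def abs_mult using l d by (intro mult_mono) auto
    then show "-1 < \<mu>" "\<mu> < 1" using d by auto
  qed
  have diff: "\<bar>\<mu> - l\<bar> * K \<le> 1 / 2"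
  proof -
    have "\<bar>\<mu> - l\<bar> = \<bar>l\<bar> * d" using d by (simp add: \<mu>_def right_diff_distrib abs_mult)
    also have "\<dots> \<le> 1 * d" using l d by (intro mult_right_mono) auto
    finally show ?thesis using mult_right_mono[of "\<bar>\<mu> - l\<bar>" d K] d K by simp
  qed
  define \<gamma> where "\<gamma> = artanh \<mu> / pi"
  have tg: "tanh (pi * \<gamma>) = \<mu>" using tanh_artanh[OF \<mu>] by (simp add: \<gamma>_def)
  let ?f = "hilbert_eigenfun \<gamma>"
  have fi: "integrable leb_I ?f" by (rule integrable_hilbert_eigenfun)
  have fX: "?f \<in> X"
  proof -
    have "\<exists>u\<in>X. AE x in leb_I. ?A u x + complex_of_real (\<mu> - l) * u x = 1"
    proof (rule perturbed_solution[OF A B AB KB _ _ const_1_mem])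
      show "norm (complex_of_real (\<mu> - l)) * K \<le> 1 / 2" unfolding norm_of_real by (rule diff)
    qed (use K in auto)
    then obtain u where u: "u \<in> X" and "AE x in leb_I. ?A u x + complex_of_real (\<mu> - l) * u x = 1" by blast
    then have "AE x in leb_I. complex_of_real (tanh (pi * \<gamma>)) * u x - finite_hilbert u x = 1"
      unfolding tg by (auto elim!: eventually_mono simp: algebra_simps)
    then obtain \<kappa> c where "\<kappa> \<noteq> 0" "AE x in leb_I. u x = (\<kappa> * of_real x + c) * ?f x"
      using resolvent_equation_solution[OF u] by blast
    then show ?thesis by (rule hilbert_eigenfun_mem_of_solution[OF u])
  qed
  have Tf: "finite_hilbert ?f t = \<mu> * ?f t" if "-1 < t" "t < 1" for t
    using finite_hilbert_eqI[OF fi that has_pv_hilbert_eigenfun[OF that]] by (simp add: tg)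
  have ae: "AE x in leb_I. ?A ?f x = complex_of_real (l - \<mu>) * ?f x"
    using AE_leb_I_in by eventually_elim (simp add: Tf algebra_simps)
  \<comment> \<open>Applying the inverse to (l - \<mu>) f gives N f \<le> N f / 2, hence f = 0
    almost everywhere, whereas its integral pi / cosh (pi \<gamma>) is nonzero.\<close>
  have "N ?f = N (B (?A ?f))"
    by (rule norm_ae_cong[OF fX _ AE_symmetric[OF BA[OF fX]]]) (use B Am[OF fX] in \<open>auto simp: bounded_op_def\<close>)
  also have "\<dots> \<le> K * N (?A ?f)" by (rule KB[OF Am[OF fX]])
  also have "N (?A ?f) = N (\<lambda>x. complex_of_real (l - \<mu>) * ?f x)"
    by (rule norm_ae_cong[OF Am[OF fX] scale_mem[OF fX] ae])
  also have "\<dots> = \<bar>\<mu> - l\<bar> * N ?f" using norm_scale[OF fX, of "complex_of_real (l - \<mu>)"] unfolding norm_of_real by (simp add: abs_minus_commute)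
  also have "K * (\<bar>\<mu> - l\<bar> * N ?f) = (\<bar>\<mu> - l\<bar> * K) * N ?f" by simp
  also have "\<dots> \<le> 1 / 2 * N ?f" using diff norm_nonneg[OF fX] by (rule mult_right_mono)
  finally have "N ?f = 0" using norm_nonneg[OF fX] by simp
  then have "AE x in leb_I. ?f x = 0" using norm_eq_0[OF fX] by blast
  then have "(\<integral>x. ?f x \<partial>leb_I) = 0" by (rule integral_eq_zero_AE)
  then show False unfolding integral_hilbert_eigenfun by simp
qed

end

theorem corollary5p4:
  fixes X :: "(real \<Rightarrow> complex) set" and N :: "(real \<Rightarrow> complex) \<Rightarrow> real"
  assumes "ri_space X N"
    and "0 < lower_boyd X N"
    and "lower_boyd X N \<le> upper_boyd X N"
    and "upper_boyd X N < 1"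
  shows "complex_of_real ` {-1..1} \<subseteq> op_spectrum X N finite_hilbert"
  using ri_space.not_invertible[OF assms(1)] by (auto simp: op_spectrum_def)

end
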